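(* Let $i,j,k\ge 0$ be integers. Then the Betti numbers $b^{2k}$ satisfy: $$b^{2k}(BR_{i,j})=\binom{i}{k}+\binom{i}{k-1}+\dots+\binom{i}{k-j+1}+\binom{i-j-1}{k-j}\quad\text{if } i>j>0;$$ $$b^{2k}(R_{i,j})=\binom{i+j-1}{k}+\binom{i+j-3}{k-1}+\dots+\binom{i+j-2\min\{i,j\}-1}{k-\min\{i,j\}}\quad\text{if } i,j>0 \text{ and } i\ne j;$$ $$b^{2k}(R_{i,i})=\binom{2i-1}{k}+\binom{2i-3}{k-1}+\dots+\binom{1}{k-i+1}\quad\text{if } i>1.$$ (The first sum is $\sum_{m=0}^{j-1}\binom{i}{k-m}$ plus the last term; the second is $\sum_{m=0}^{\min\{i,j\}}\binom{i+j-1-2m}{k-m}$; the third is $\sum_{m=0}^{i-1}\binom{2i-1-2m}{k-m}$.)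
   Context: $b^{2k}(X)$ is the $2k$-th Betti number of $X$ (rank of $H^{2k}(X;\mathbb{Z})$), and $\binom{n}{m}=0$ if $m<0$ or $m>n$. Bounded flag variety $BF_n$: let $e_0,\dots,e_n$ be the standard basis of $\mathbb{C}^{n+1}$. $BF_n$ is the variety of sequences $(l_0,\dots,l_n)$ of lines in $\mathbb{C}^{n+1}$ with $l_0=\mathbb{C}e_0$ and $l_k\subset l_{k-1}\oplus\mathbb{C}e_k$ for $k=1,\dots,n$. Write $z_k=[z_{k,0}:\dots:z_{k,k}]$ for the homogeneous coordinates of $l_k\subset\langle e_0,\dots,e_k\rangle$; this embeds $BF_n$ as a nonsingular closed subvariety of $\prod_{k=0}^n\mathbb{P}^k$ of dimension $n$. $BR_{i,j}$ is the hypersurface in $BF_i\times\mathbb{P}^j$ given by $\sum_{k=0}^{\min\{i,j\}} z_{i,i-k}w_{j-k}=0$, with $[w_0:\dots:w_j]$ the homogeneous coordinates on $\mathbb{P}^j$. $R_{i,j}$ is the hypersurface in $BF_i\times BF_j$ given by $\sum_{k=0}^{\min\{i,j\}} z_{i,i-k}w_{j,j-k}=0$, with $(z_0,\dots,z_i)$, $(w_0,\dots,w_j)$ the tuples of homogeneous coordinates on $BF_i$, $BF_j$. *)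

theory Defs
  imports "HOL-Homology.Homology" "HOL-Library.Extended_Nat"
begin

section \<open>Integral singular cohomology and Betti numbers\<close>

text \<open>Homomorphisms from the chain group to the integers, made extensional so that they are
  determined by their values on the carrier.\<close>

definition cochain_group :: "nat \<Rightarrow> 'a topology \<Rightarrow> ('a chain \<Rightarrow> int) monoid" where
  "cochain_group p X =
     \<lparr>carrier = hom (chain_group p X) integer_group \<inter> extensional (carrier (chain_group p X)),
      monoid.mult = (\<lambda>\<phi> \<psi>. \<lambda>c\<in>carrier (chain_group p X). \<phi> c + \<psi> c),
      one = (\<lambda>c\<in>carrier (chain_group p X). 0)\<rparr>"

definition coboundary :: "nat \<Rightarrow> 'a topology \<Rightarrow> ('a chain \<Rightarrow> int) \<Rightarrow> ('a chain \<Rightarrow> int)" where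
  "coboundary p X \<phi> = (\<lambda>c\<in>carrier (chain_group (Suc p) X). \<phi> (chain_boundary (Suc p) c))"

definition cocycles :: "nat \<Rightarrow> 'a topology \<Rightarrow> ('a chain \<Rightarrow> int) set" where
  "cocycles p X = kernel (cochain_group p X) (cochain_group (Suc p) X) (coboundary p X)"

definition coboundaries :: "nat \<Rightarrow> 'a topology \<Rightarrow> ('a chain \<Rightarrow> int) set" where
  "coboundaries p X =
     (if p = 0 then {\<one>\<^bsub>cochain_group 0 X\<^esub>}
      else coboundary (p - 1) X ` carrier (cochain_group (p - 1) X))"

definition cohomology_group :: "nat \<Rightarrow> 'a topology \<Rightarrow> ('a chain \<Rightarrow> int) set monoid" where
  "cohomology_group p X = subgroup_generated (cochain_group p X) (cocycles p X) Mod coboundaries p X"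

text \<open>The rank of an abelian group is the supremum of the cardinalities of its finite
  \<open>\<int>\<close>-linearly independent subsets; it lives in \<^typ>\<open>enat\<close>, so a finite value
  really asserts finite rank.\<close>

definition int_independent :: "('a, 'b) monoid_scheme \<Rightarrow> 'a set \<Rightarrow> bool" where
  "int_independent G S \<longleftrightarrow> finite S \<and> S \<subseteq> carrier G \<and>
     (\<forall>c :: 'a \<Rightarrow> int. finprod G (\<lambda>s. s [^]\<^bsub>G\<^esub> c s) S = \<one>\<^bsub>G\<^esub> \<longrightarrow> (\<forall>s\<in>S. c s = 0))"

definition abelian_rank :: "('a, 'b) monoid_scheme \<Rightarrow> enat" where
  "abelian_rank G = (SUP S\<in>{S. int_independent G S}. enat (card S))"

definition betti :: "nat \<Rightarrow> 'a topology \<Rightarrow> enat" where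
  "betti p X = abelian_rank (cohomology_group p X)"

lemma comm_group_cochain_group: "comm_group (cochain_group p X)"
proof (rule comm_groupI)
  let ?C = "chain_group p X"
  fix \<phi> assume \<phi>: "\<phi> \<in> carrier (cochain_group p X)"
  show "\<exists>\<psi>\<in>carrier (cochain_group p X). \<psi> \<otimes>\<^bsub>cochain_group p X\<^esub> \<phi> = \<one>\<^bsub>cochain_group p X\<^esub>"
    using \<phi> by (intro bexI[of _ "\<lambda>c\<in>carrier ?C. - \<phi> c"])
      (auto simp: cochain_group_def hom_def singular_chain_add)
  show "\<one>\<^bsub>cochain_group p X\<^esub> \<otimes>\<^bsub>cochain_group p X\<^esub> \<phi> = \<phi>"
    using \<phi> by (fastforce simp: cochain_group_def extensional_def)
qed (auto simp: cochain_group_def hom_def singular_chain_add)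

lemma coboundary_hom: "coboundary p X \<in> hom (cochain_group p X) (cochain_group (Suc p) X)"
proof -
  have 1: "singular_chain p X (chain_boundary (Suc p) c)" if "singular_chain (Suc p) X c" for c
    using singular_chain_boundary[OF that] by simp
  show ?thesis
    by (auto simp: hom_def cochain_group_def coboundary_def 1 singular_chain_add chain_boundary_add)
qed

lemma comm_group_cohomology_group: "comm_group (cohomology_group p X)"
proof -
  interpret C: comm_group "cochain_group p X" by (rule comm_group_cochain_group)
  interpret D: comm_group "cochain_group (Suc p) X" by (rule comm_group_cochain_group)
  interpret d: group_hom "cochain_group p X" "cochain_group (Suc p) X" "coboundary p X"
    by unfold_locales (rule coboundary_hom)
  let ?Z = "subgroup_generated (cochain_group p X) (cocycles p X)"
  have Z: "subgroup (cocycles p X) (cochain_group p X)"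
    unfolding cocycles_def by (rule d.subgroup_kernel)
  interpret Z: comm_group ?Z
    by (simp add: C.abelian_subgroup_generated comm_group_cochain_group)
  have B: "subgroup (coboundaries p X) (cochain_group p X)"
  proof (cases p)
    case 0
    then show ?thesis using C.triv_subgroup by (simp add: coboundaries_def)
  next
    case (Suc q)
    interpret E: comm_group "cochain_group q X" by (rule comm_group_cochain_group)
    interpret e: group_hom "cochain_group q X" "cochain_group p X" "coboundary q X"
      using coboundary_hom[of q X] Suc by unfold_locales auto
    show ?thesis using e.img_is_subgroup by (simp add: coboundaries_def Suc)
  qed
  have "coboundaries p X \<subseteq> cocycles p X"
  proof (cases p)
    case 0
    then show ?thesis using subgroup.one_closed[OF Z] by (simp add: coboundaries_def)
  next
    case (Suc q)
    have "coboundary p X (coboundary q X \<phi>) = \<one>\<^bsub>cochain_group (Suc p) X\<^esub>"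
      if \<phi>: "\<phi> \<in> carrier (cochain_group q X)" for \<phi>
    proof -
      have "\<phi> 0 = 0"
        using \<phi> hom_one[of \<phi> "chain_group q X" integer_group]
        by (auto simp: cochain_group_def)
      then show ?thesis
        unfolding Suc coboundary_def cochain_group_def
        using singular_chain_boundary[of "Suc (Suc q)" X] chain_boundary_boundary[of "Suc (Suc q)" X]
        by (auto intro!: restrict_ext)
    qed
    then show ?thesis
      using hom_in_carrier[OF coboundary_hom[of q X]] Suc
      by (auto simp: coboundaries_def cocycles_def kernel_def)
  qed
  then have "subgroup (coboundaries p X) ?Z"
    using B Z by (simp add: C.subgroup_of_subgroup_generated)
  then show ?thesis
    unfolding cohomology_group_def by (rule Z.abelian_FactGroup)
qed


section \<open>Projective spaces, bounded flag varieties and the hypersurfaces\<close>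

text \<open>\<open>\<complex>\<^sup>n\<^sup>+\<^sup>1\<close> is modelled by the functions vanishing above \<open>n\<close>, so that
  \<open>\<complex>\<^sup>k\<^sup>+\<^sup>1 = \<langle>e\<^sub>0, \<dots>, e\<^sub>k\<rangle>\<close> is literally a
  subspace of \<open>\<complex>\<^sup>n\<^sup>+\<^sup>1\<close> for \<open>k \<le> n\<close>.\<close>

definition cvec :: "nat \<Rightarrow> (nat \<Rightarrow> complex) set" where
  "cvec n = {v. \<forall>m>n. v m = 0}"

definition nzvec :: "nat \<Rightarrow> (nat \<Rightarrow> complex) set" where
  "nzvec n = cvec n - {\<lambda>_. 0}"

definition std_basis :: "nat \<Rightarrow> nat \<Rightarrow> complex" where
  "std_basis k = (\<lambda>m. if m = k then 1 else 0)"

definition cspan :: "(nat \<Rightarrow> complex) \<Rightarrow> (nat \<Rightarrow> complex) set" where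
  "cspan v = {(\<lambda>m. c * v m) |c. True}"

definition lines :: "nat \<Rightarrow> (nat \<Rightarrow> complex) set set" where
  "lines n = cspan ` nzvec n"

text \<open>Complex projective space with its analytic topology, as the quotient of
  \<open>\<complex>\<^sup>n\<^sup>+\<^sup>1 - {0}\<close> (see \<open>quotient_map_projective_space\<close> below).\<close>

definition projective_space :: "nat \<Rightarrow> (nat \<Rightarrow> complex) set topology" where
  "projective_space n =
     topology (\<lambda>U. U \<subseteq> lines n \<and> openin (top_of_set (nzvec n)) {v \<in> nzvec n. cspan v \<in> U})"

definition bounded_flags :: "nat \<Rightarrow> (nat \<Rightarrow> (nat \<Rightarrow> complex) set) set" where
  "bounded_flags n =
     {l \<in> (\<Pi>\<^sub>E k\<in>{..n}. lines n).
        l 0 = cspan (std_basis 0) \<and>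
        (\<forall>k\<in>{1..n}. l k \<subseteq> {(\<lambda>m. v m + c * std_basis k m) |v c. v \<in> l (k - 1)})}"

definition BF :: "nat \<Rightarrow> (nat \<Rightarrow> (nat \<Rightarrow> complex) set) topology" where
  "BF n = subtopology (product_topology projective_space {..n}) (bounded_flags n)"

text \<open>\<^term>\<open>cspan z = l\<close>, for a line \<open>l\<close>, says that \<open>z\<close> is a vector of homogeneous
  coordinates of \<open>l\<close>; by \<open>incidence_homogeneous\<close> below the choice does not matter.\<close>

definition BR :: "nat \<Rightarrow> nat \<Rightarrow> ((nat \<Rightarrow> (nat \<Rightarrow> complex) set) \<times> (nat \<Rightarrow> complex) set) topology"
  where
  "BR i j = subtopology (prod_topology (BF i) (projective_space j))
     {(l, q). \<exists>z w. cspan z = l i \<and> cspan w = q \<and> (\<Sum>k = 0..min i j. z (i - k) * w (j - k)) = 0}"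

definition RR ::
  "nat \<Rightarrow> nat \<Rightarrow> ((nat \<Rightarrow> (nat \<Rightarrow> complex) set) \<times> (nat \<Rightarrow> (nat \<Rightarrow> complex) set)) topology"
  where
  "RR i j = subtopology (prod_topology (BF i) (BF j))
     {(l, l'). \<exists>z w. cspan z = l i \<and> cspan w = l' j \<and> (\<Sum>k = 0..min i j. z (i - k) * w (j - k)) = 0}"

lemma openin_projective_space:
  "openin (projective_space n) U \<longleftrightarrow>
     U \<subseteq> lines n \<and> openin (top_of_set (nzvec n)) {v \<in> nzvec n. cspan v \<in> U}"
proof -
  let ?L = "\<lambda>U. U \<subseteq> lines n \<and> openin (top_of_set (nzvec n)) {v \<in> nzvec n. cspan v \<in> U}"
  have "istopology ?L"
    unfolding istopology_def
  proof (intro conjI allI impI)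
    fix S T assume "?L S" "?L T"
    moreover have "{v \<in> nzvec n. cspan v \<in> S \<inter> T}
        = {v \<in> nzvec n. cspan v \<in> S} \<inter> {v \<in> nzvec n. cspan v \<in> T}" by auto
    ultimately show "S \<inter> T \<subseteq> lines n"
      and "openin (top_of_set (nzvec n)) {v \<in> nzvec n. cspan v \<in> S \<inter> T}"
      by (auto intro: openin_Int)
  next
    fix K assume K: "\<forall>S\<in>K. ?L S"
    have "{v \<in> nzvec n. cspan v \<in> \<Union>K} = (\<Union>S\<in>K. {v \<in> nzvec n. cspan v \<in> S})" by auto
    then show "openin (top_of_set (nzvec n)) {v \<in> nzvec n. cspan v \<in> \<Union>K}"
      using K by (auto intro!: openin_Union)
    show "\<Union>K \<subseteq> lines n" using K by auto
  qed
  then show ?thesis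
    by (simp add: projective_space_def topology_inverse')
qed

lemma topspace_projective_space: "topspace (projective_space n) = lines n"
proof -
  have "{v \<in> nzvec n. cspan v \<in> lines n} = nzvec n" by (auto simp: lines_def)
  then have "openin (projective_space n) (lines n)"
    by (simp add: openin_projective_space)
  then show ?thesis
    by (metis openin_projective_space openin_subset openin_topspace subset_antisym)
qed

lemma quotient_map_projective_space:
  "quotient_map (top_of_set (nzvec n)) (projective_space n) cspan"
  by (simp add: quotient_map_def topspace_projective_space openin_projective_space)
     (simp add: lines_def)

lemma cspan_self: "v \<in> cspan v"
  unfolding cspan_def by (auto intro: exI[of _ 1])

lemma lines_cvec: "n \<le> N \<Longrightarrow> l \<in> lines N \<Longrightarrow> l \<subseteq> cvec n \<Longrightarrow> l \<in> lines n"
  using cspan_self by (fastforce simp: lines_def nzvec_def)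

lemma bounded_flags_subset: "bounded_flags n \<subseteq> topspace (product_topology projective_space {..n})"
proof
  fix l assume l: "l \<in> bounded_flags n"
  have "l k \<subseteq> cvec k" if "k \<le> n" for k
    using that
  proof (induction k)
    case 0
    then show ?case
      using l by (auto simp: bounded_flags_def cspan_def std_basis_def cvec_def)
  next
    case (Suc k)
    then have "l k \<subseteq> cvec k" by simp
    moreover have "l (Suc k) \<subseteq> {(\<lambda>m. v m + c * std_basis (Suc k) m) |v c. v \<in> l k}"
      using l Suc.prems by (force simp: bounded_flags_def)
    ultimately show ?case
      by (force simp: cvec_def std_basis_def)
  qed
  then show "l \<in> topspace (product_topology projective_space {..n})"
    using l lines_cvec by (fastforce simp: bounded_flags_def topspace_projective_space)
qed

lemma incidence_homogeneous:
  assumes "cspan z = cspan z'" "cspan w = cspan w'"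
    and "(\<Sum>k = 0..min i j. z (i - k) * w (j - k)) = 0"
  shows "(\<Sum>k = 0..min i j. z' (i - k) * w' (j - k)) = 0"
proof -
  obtain a where a: "z' = (\<lambda>m. a * z m)"
    using cspan_self[of z'] assms(1) by (auto simp: cspan_def)
  obtain b where b: "w' = (\<lambda>m. b * w m)"
    using cspan_self[of w'] assms(2) by (auto simp: cspan_def)
  have "(\<Sum>k = 0..min i j. z' (i - k) * w' (j - k))
      = a * b * (\<Sum>k = 0..min i j. z (i - k) * w (j - k))"
    unfolding a b sum_distrib_left by (rule sum.cong) (auto simp: algebra_simps)
  then show ?thesis using assms(3) by simp
qed


section \<open>Binomial coefficients with the convention of vanishing outside the range\<close>

definition binom :: "int \<Rightarrow> int \<Rightarrow> nat" where
  "binom n m = (if m < 0 \<or> m > n then 0 else nat n choose nat m)"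

end

theory Submission
  imports Defs "HOL-Computational_Algebra.Polynomial"
begin

text \<open>
  Both families of hypersurfaces have an open cover by charts \<open>\<complex>\<^sup>n\<close> and a partition into strata,
  one in each chart, such that the stratum is a coordinate subspace of its chart and does not meet
  the charts that come earlier. Adding the charts one by one, excision identifies the relative
  homology of each step with that of the complement of a coordinate subspace of complex
  codimension \<open>c\<close>, which is \<open>\<int>\<close> in degree \<open>2c\<close>. As all these degrees are even, homology is free with
  one generator for each stratum, and the universal coefficient theorem turns this into Betti numbers.

  On \<open>BF\<^sub>i\<close> write \<open>z\<^sub>k = a\<^sub>k z\<^sub>k\<^sub>-\<^sub>1 + b\<^sub>k e\<^sub>k\<close>; a chart normalises, for each \<open>k\<close>, one of
  \<open>a\<^sub>k\<close>, \<open>b\<^sub>k\<close> to \<open>1\<close>, and the strata are given by the vanishing pattern of the \<open>a\<^sub>k\<close>. On a second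
  factor \<open>BF\<^sub>j\<close> the vanishing pattern of the \<open>b\<^sub>k\<close> is used instead, and on \<open>\<P>\<^sup>j\<close> the position of the
  last nonzero coordinate. With these choices
  the incidence equation can be solved, in every product chart that is needed, for a coordinate that
  enters linearly, and strata remain coordinate subspaces. Counting strata by codimension
  yields the recursions \<open>R(i+1,j+1) = (1+L)\<^bsup>i+j+1\<^esup> + L R(i,j)\<close> and
  \<open>BR(i+1,j+1) = (1+L)\<^sup>i (1 + L + \<dots> + L\<^bsup>j+1\<^esup>) + L BR(i,j)\<close> for the Poincare polynomials in \<open>L\<close>.
\<close>

section \<open>Ranks of abelian groups\<close>

text \<open>The two factors need opposite vanishing patterns. On a stratum cut out by the
  \<open>a_k\<close>, the homogeneous coordinates below the pivot vanish and those above it are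
  free; on a stratum cut out by the \<open>b_k\<close>, or given by the last nonzero coordinate of a
  point of projective space, those above the pivot vanish instead. On a product stratum the
  incidence sum is therefore confined to the indices between the two pivot distances from the top.
  Were the first pattern used on both factors, two strata with equal positive pivot distances would
  lead to the equation "1 plus a sum of products of free coordinates is 0", an affine quadric and
  not a coordinate subspace. With opposite patterns such a pair is harmless: only the product of the
  two pivots is left, it equals 1, and the product stratum misses the hypersurface. Every other pair
  contributes one stratum. Its codimension in the hypersurface is the one in the product if the
  equation cuts it properly, and one less if the equation already holds on it.\<close>

lemma integer_relation:
  fixes M :: "'b \<Rightarrow> 's \<Rightarrow> int"
  assumes "finite B" "finite S" "card B < card S"
  shows "\<exists>c :: 's \<Rightarrow> int. (\<exists>s\<in>S. c s \<noteq> 0) \<and> (\<forall>b\<in>B. (\<Sum>s\<in>S. c s * M b s) = 0)"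
  using assms
proof (induction B arbitrary: S M rule: finite_induct)
  case empty
  then obtain s where "s \<in> S" by fastforce
  then show ?case by (intro exI[of _ "\<lambda>_. 1"]) auto
next
  case (insert b B)
  show ?case
  proof (cases "\<forall>s\<in>S. M b s = 0")
    case True
    from insert.IH[of S M] insert.prems insert.hyps obtain c
      where "\<exists>s\<in>S. c s \<noteq> 0" "\<forall>b\<in>B. (\<Sum>s\<in>S. c s * M b s) = 0"
      by auto
    with True show ?thesis by (intro exI[of _ c]) auto
  next
    case False
    then obtain t where t: "t \<in> S" "M b t \<noteq> 0" by blast
    \<comment> \<open>Integer elimination without division: \<open>N a s\<close> is the 2x2 minor of
      rows \<open>b\<close>, \<open>a\<close> and columns \<open>t\<close>, \<open>s\<close>. It
      vanishes for \<open>a = b\<close>, and the coefficient of \<open>t\<close> in \<open>d\<close>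
      is the one that makes row \<open>b\<close> cancel.\<close>
    define N where "N = (\<lambda>a s. M b t * M a s - M b s * M a t)"
    have "card B < card (S - {t})"
      using insert.prems insert.hyps t by simp
    with insert.IH[of "S - {t}" N] insert.prems obtain c
      where c: "\<exists>s\<in>S - {t}. c s \<noteq> 0" "\<forall>a\<in>B. (\<Sum>s\<in>S - {t}. c s * N a s) = 0"
      by auto
    define d where "d = (\<lambda>s. if s = t then - (\<Sum>r\<in>S - {t}. c r * M b r) else c s * M b t)"
    have split: "(\<Sum>s\<in>S. d s * M a s) = (\<Sum>s\<in>S - {t}. c s * N a s)" for a
    proof -
      have "(\<Sum>s\<in>S. d s * M a s) = d t * M a t + (\<Sum>s\<in>S - {t}. d s * M a s)"
        using t insert.prems by (simp add: sum.remove)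
      also have "(\<Sum>s\<in>S - {t}. d s * M a s) = (\<Sum>s\<in>S - {t}. c s * M b t * M a s)"
        by (rule sum.cong) (auto simp: d_def)
      also have "d t * M a t + \<dots> = (\<Sum>s\<in>S - {t}. c s * N a s)"
        by (simp add: d_def N_def sum_distrib_left sum_distrib_right sum_subtractf algebra_simps)
      finally show ?thesis .
    qed
    have "(\<Sum>s\<in>S. d s * M a s) = 0" if "a \<in> insert b B" for a
      using that c(2) split[of a] by (cases "a = b") (auto simp: N_def)
    moreover have "\<exists>s\<in>S. d s \<noteq> 0"
      using c(1) t by (auto simp: d_def)
    ultimately show ?thesis by (intro exI[of _ d]) auto
  qed
qed

lemma hom_integer_group_finprod:
  assumes "comm_group G" and h: "h \<in> hom G integer_group" and "f \<in> S \<rightarrow> carrier G"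
  shows "h (finprod G f S) = (\<Sum>s\<in>S. h (f s))"
proof -
  interpret G: comm_group G by fact
  interpret h: group_hom G integer_group h
    using h by (simp add: group_hom_def group_hom_axioms_def)
  show ?thesis using assms(3)
  proof (induction S rule: infinite_finite_induct)
    case (insert x S)
    then have "h (finprod G f (insert x S)) = h (f x \<otimes>\<^bsub>G\<^esub> finprod G f S)"
      by (subst G.finprod_insert) auto
    also have "\<dots> = h (f x) + h (finprod G f S)"
      using insert by (subst h.hom_mult) (auto simp: Pi_iff)
    finally show ?case using insert by (simp add: Pi_iff)
  qed (use h.hom_one in auto)
qed

lemma hom_integer_group_int_pow:
  assumes "group G" "h \<in> hom G integer_group" "x \<in> carrier G"
  shows "h (x [^]\<^bsub>G\<^esub> (n::int)) = n * h x"
  using assms by (subst hom_int_pow[of h G integer_group]) auto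

text \<open>More than \<open>card B\<close> elements have an integer relation between their vectors
  of values under \<open>E\<close>, and joint injectivity turns it into a relation in
  \<open>G\<close>. Conversely, applying \<open>E a\<close> to a relation between the
  \<open>x b\<close> isolates one coefficient.\<close>

lemma abelian_rank_eq_card_dual_basis:
  assumes G: "comm_group G" and fin: "finite B"
    and E: "\<And>b. b \<in> B \<Longrightarrow> E b \<in> hom G integer_group"
    and inj: "\<And>g. g \<in> carrier G \<Longrightarrow> (\<And>b. b \<in> B \<Longrightarrow> E b g = 0) \<Longrightarrow> g = \<one>\<^bsub>G\<^esub>"
    and x: "\<And>b. b \<in> B \<Longrightarrow> x b \<in> carrier G"
    and dual: "\<And>a b. a \<in> B \<Longrightarrow> b \<in> B \<Longrightarrow> E a (x b) = (if a = b then 1 else 0)"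
  shows "abelian_rank G = enat (card B)"
proof (rule antisym)
  interpret G: comm_group G by fact
  have eval: "E a (finprod G (\<lambda>s. s [^]\<^bsub>G\<^esub> c s) S) = (\<Sum>s\<in>S. c s * E a s)"
    if "a \<in> B" "S \<subseteq> carrier G" for a S and c :: "_ \<Rightarrow> int"
    using that E[of a]
    by (subst hom_integer_group_finprod[OF G])
       (auto intro!: sum.cong hom_integer_group_int_pow)
  show "abelian_rank G \<le> enat (card B)"
    unfolding abelian_rank_def
  proof (rule SUP_least)
    fix S assume "S \<in> {S. int_independent G S}"
    then have S: "finite S" "S \<subseteq> carrier G"
      and ind: "\<And>c :: _ \<Rightarrow> int. finprod G (\<lambda>s. s [^]\<^bsub>G\<^esub> c s) S = \<one>\<^bsub>G\<^esub> \<Longrightarrow> \<forall>s\<in>S. c s = 0"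
      by (auto simp: int_independent_def)
    have "card S \<le> card B"
    proof (rule ccontr)
      assume "\<not> card S \<le> card B"
      then obtain c where c: "\<exists>s\<in>S. c s \<noteq> 0" "\<forall>b\<in>B. (\<Sum>s\<in>S. c s * E b s) = 0"
        using integer_relation[OF fin S(1)] by (meson not_le)
      have "finprod G (\<lambda>s. s [^]\<^bsub>G\<^esub> c s) S = \<one>\<^bsub>G\<^esub>"
        using c(2) S eval by (intro inj G.finprod_closed) auto
      then show False using ind c(1) by blast
    qed
    then show "enat (card S) \<le> enat (card B)" by simp
  qed
  have injx: "inj_on x B"
    using dual by (intro inj_onI) (metis zero_neq_one)
  have "int_independent G (x ` B)"
    unfolding int_independent_def
  proof (intro conjI allI impI)
    fix c :: "_ \<Rightarrow> int"
    assume one: "finprod G (\<lambda>s. s [^]\<^bsub>G\<^esub> c s) (x ` B) = \<one>\<^bsub>G\<^esub>"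
    have "c (x a) = 0" if a: "a \<in> B" for a
    proof -
      have "E a \<one>\<^bsub>G\<^esub> = 0"
        using hom_one[OF E[OF a]] G.is_group by simp
      then have "0 = (\<Sum>s\<in>x ` B. c s * E a s)"
        using eval[OF a, of "x ` B" c] x one by auto
      also have "\<dots> = (\<Sum>b\<in>B. c (x b) * E a (x b))"
        by (rule sum.reindex_cong[OF injx]) auto
      also have "\<dots> = (\<Sum>b\<in>B. if a = b then c (x b) else 0)"
        by (rule sum.cong) (auto simp: dual a)
      finally show ?thesis using a fin by simp
    qed
    then show "\<forall>s\<in>x ` B. c s = 0" by blast
  qed (use fin x in auto)
  then have "enat (card (x ` B)) \<le> abelian_rank G"
    unfolding abelian_rank_def by (intro SUP_upper) auto
  then show "enat (card B) \<le> abelian_rank G"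
    by (simp add: card_image injx)
qed

section \<open>Bases of free homology groups\<close>

text \<open>Stated for representing cycles rather than for homology classes, because the lifting
  arguments and the evaluation of cochains below work with chains. The set \<open>S\<close> is the
  subspace of a pair; \<open>S = {}\<close> gives absolute homology.\<close>

definition homology_basis :: "nat \<Rightarrow> 'a topology \<Rightarrow> 'a set \<Rightarrow> 'a chain set \<Rightarrow> bool" where
  "homology_basis p X S B \<longleftrightarrow> finite B \<and> (\<forall>b\<in>B. singular_relcycle p X S b) \<and>
     (\<forall>z. singular_relcycle p X S z \<longrightarrow> (\<exists>n. homologous_rel p X S z (\<Sum>b\<in>B. frag_cmul (n b) b))) \<and>
     (\<forall>n. singular_relboundary p X S (\<Sum>b\<in>B. frag_cmul (n b) b) \<longrightarrow> (\<forall>b\<in>B. n b = 0))"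

lemma homology_basisD:
  assumes "homology_basis p X S B"
  shows "finite B" "b \<in> B \<Longrightarrow> singular_relcycle p X S b"
    and "singular_relboundary p X S (\<Sum>b\<in>B. frag_cmul (n b) b) \<Longrightarrow> b \<in> B \<Longrightarrow> n b = 0"
  using assms by (auto simp: homology_basis_def)

lemma homology_basis_span:
  assumes "homology_basis p X S B" "singular_relcycle p X S z"
  obtains n where "homologous_rel p X S z (\<Sum>b\<in>B. frag_cmul (n b) b)"
  using assms by (auto simp: homology_basis_def)

lemma homology_basis_empty:
  assumes "trivial_group (relative_homology_group (int p) X S)"
  shows "homology_basis p X S {}"
proof -
  have "singular_relboundary p X S z" if "singular_relcycle p X S z" for z
  proof -
    have "homologous_rel_set p X S z \<in> carrier (relative_homology_group (int p) X S)"
      using that by (auto simp: carrier_relative_homology_group)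
    then have "homologous_rel_set p X S z = singular_relboundary_set p X S"
      using assms by (auto simp: trivial_group_def)
    then show ?thesis by (simp add: homologous_rel_set_eq_relboundary)
  qed
  then show ?thesis by (auto simp: homology_basis_def homologous_rel_def)
qed

lemma homologous_rel_set_int_pow:
  assumes "singular_relcycle p X S z"
  shows "homologous_rel_set p X S z [^]\<^bsub>relative_homology_group (int p) X S\<^esub> (n::int)
       = homologous_rel_set p X S (frag_cmul n z)"
proof -
  let ?R = "relcycle_group p X S"
  interpret N: normal "singular_relboundary_set p X S" ?R
    by (rule normal_subgroup_singular_relboundary_relcycle)
  have hom: "homologous_rel_set p X S \<in> hom ?R (relative_homology_group (int p) X S)"
    using N.r_coset_hom_Mod
    by (simp add: right_coset_singular_relboundary nontrivial_relative_homology_group)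
  have "z [^]\<^bsub>?R\<^esub> n = z [^]\<^bsub>chain_group p X\<^esub> n"
    unfolding relcycle_group_def
    using assms by (intro group.int_pow_subgroup_generated)
      (auto simp flip: relcycle_group_def)
  also have "\<dots> = frag_cmul n z"
    unfolding chain_group_def
    using assms by (intro int_pow_free_Abelian_group) (auto simp: singular_relcycle singular_chain_def)
  finally show ?thesis
    using hom_int_pow[OF hom, of z n] assms by simp
qed

lemma homology_basis_singleton:
  assumes "relative_homology_group (int p) X S \<cong> integer_group"
  obtains b where "homology_basis p X S {b}"
proof -
  let ?H = "relative_homology_group (int p) X S"
  have "integer_group \<cong> ?H"
    using assms by (simp add: group.iso_sym)
  then obtain h where h: "h \<in> iso integer_group ?H" by (auto simp: is_iso_def)
  have hh: "h \<in> hom integer_group ?H" and bij: "bij_betw h UNIV (carrier ?H)"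
    using h by (auto simp: iso_def)
  have hn: "h n = h 1 [^]\<^bsub>?H\<^esub> n" for n
    using hom_int_pow[OF hh, of 1 n] by simp
  have "h 1 \<in> carrier ?H" using bij by (auto simp: bij_betw_def)
  then obtain b where b: "singular_relcycle p X S b" "h 1 = homologous_rel_set p X S b"
    by (auto simp: carrier_relative_homology_group)
  have hb: "h n = homologous_rel_set p X S (frag_cmul n b)" for n
    using hn[of n] b by (simp add: homologous_rel_set_int_pow)
  have "homology_basis p X S {b}"
    unfolding homology_basis_def
  proof (intro conjI allI impI ballI)
    fix z assume "singular_relcycle p X S z"
    then have "homologous_rel_set p X S z \<in> carrier ?H"
      by (auto simp: carrier_relative_homology_group)
    then obtain n where "homologous_rel_set p X S z = h n"
      using bij by (auto simp: bij_betw_def)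
    then have "homologous_rel p X S z (frag_cmul n b)"
      unfolding hb homologous_rel_set_eq by (metis homologous_rel_eq)
    then show "\<exists>n. homologous_rel p X S z (\<Sum>b\<in>{b}. frag_cmul (n b) b)"
      by (intro exI[of _ "\<lambda>_. n"]) simp
  next
    fix n a assume a: "singular_relboundary p X S (\<Sum>b\<in>{b}. frag_cmul (n b) b)" "a \<in> {b}"
    then have "h (n b) = singular_relboundary_set p X S"
      unfolding hb homologous_rel_set_eq_relboundary by simp
    moreover have "h 0 = singular_relboundary_set p X S"
      unfolding hb homologous_rel_set_eq_relboundary by simp
    ultimately have "h (n b) = h 0" by simp
    then show "n a = 0" using bij a by (auto simp: bij_betw_def inj_on_def)
  qed (use b in auto)
  then show ?thesis by (rule that)
qed

text \<open>From the exact sequence of the pair: if the relative homology of \<open>(X, U)\<close>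
  vanishes in degree \<open>p + 1\<close>, then the homology of \<open>U\<close> injects into that
  of \<open>X\<close> in degree \<open>p\<close>. A chain \<open>y\<close> bounded by
  \<open>c\<close> is a relative cycle, hence differs from a chain \<open>u\<close> in
  \<open>U\<close> by a boundary, and \<open>u\<close> has the same boundary as
  \<open>y\<close>.\<close>

lemma singular_boundary_of_subspace:
  assumes rel: "homology_basis (Suc p) X U {}"
    and c: "singular_chain p (subtopology X U) c" "singular_relboundary p X {} c"
  shows "singular_relboundary p (subtopology X U) {} c"
proof -
  obtain y where y: "singular_chain (Suc p) X y" "chain_boundary (Suc p) y = c"
    using c(2) by (auto simp: singular_boundary)
  then have "singular_relcycle (Suc p) X U y"
    using c(1) by (simp add: singular_relcycle)
  then have "singular_relboundary (Suc p) X U y"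
    using homology_basis_span[OF rel, of y] by (force simp: homologous_rel_def)
  then obtain w u where w: "singular_chain (Suc (Suc p)) X w"
    and u: "singular_chain (Suc p) (subtopology X U) u" "chain_boundary (Suc (Suc p)) w + u = y"
    by (auto simp: singular_relboundary)
  have "chain_boundary (Suc p) y = chain_boundary (Suc p) u"
    using chain_boundary_boundary_alt[OF w] u(2) by (auto simp: chain_boundary_add)
  then show ?thesis using u(1) y(2) by (auto simp: singular_boundary)
qed

lemma singular_relboundary_subspaceD:
  assumes "singular_relboundary p (subtopology X U) {} c"
  shows "singular_relboundary p X {} c"
  using assms by (auto simp: singular_boundary singular_chain_subtopology)

lemma singular_relcycle_subspaceD:
  assumes "singular_relcycle p (subtopology X U) {} c"
  shows "singular_relcycle p X {} c"
  using assms by (auto simp: singular_cycle singular_chain_subtopology)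

lemma singular_cycle_imp_relcycle:
  assumes "singular_relcycle p X {} z"
  shows "singular_relcycle p X U z"
  using assms by (simp add: singular_cycle) (simp add: singular_relcycle)

lemma singular_boundary_imp_relboundary:
  assumes "singular_relboundary p X {} c"
  shows "singular_relboundary p X U c"
proof -
  obtain d where "singular_chain (Suc p) X d" "chain_boundary (Suc p) d + 0 = c"
    using assms by (auto simp: singular_boundary)
  then show ?thesis unfolding singular_relboundary by blast
qed

text \<open>Exactness at the homology of \<open>X\<close>: a class that dies in the relative group
  comes from \<open>U\<close>.\<close>

lemma relcycle_lift_subspace_cycle:
  assumes z: "singular_relcycle p X {} z" and rb: "singular_relboundary p X U z"
  obtains e where "singular_relcycle p (subtopology X U) {} e" "homologous_rel p X {} z e"
proof -
  obtain d e where d: "singular_chain (Suc p) X d"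
    and e: "singular_chain p (subtopology X U) e" "chain_boundary (Suc p) d + e = z"
    using rb by (auto simp: singular_relboundary)
  have "chain_boundary p z = chain_boundary p e"
    using chain_boundary_boundary_alt[OF d] e(2) by (auto simp: chain_boundary_add)
  then have "singular_relcycle p (subtopology X U) {} e"
    using z e(1) by (simp add: singular_cycle)
  moreover have "homologous_rel p X {} z e"
    using d e(2) by (auto simp: homologous_rel_def singular_boundary)
  ultimately show ?thesis by (rule that)
qed

lemma singular_relcycle_combination:
  "(\<And>b. b \<in> B \<Longrightarrow> singular_relcycle p X S b) \<Longrightarrow> singular_relcycle p X S (\<Sum>b\<in>B. frag_cmul (n b) b)"
  by (intro singular_relcycle_sum singular_relcycle_cmul)

text \<open>The map from \<open>U\<close> to \<open>X\<close> is onto by \<open>rel\<close> and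
  injective by \<open>above\<close>. The alternative \<open>B = {}\<close> serves the odd degree
  just below the degree of the new relative generator, where the relative group in degree
  \<open>p + 1\<close> is not zero.\<close>

lemma homology_basis_extend_trivial:
  assumes B: "homology_basis p (subtopology X U) {} B"
    and rel: "homology_basis p X U {}" and above: "homology_basis (Suc p) X U {} \<or> B = {}"
  shows "homology_basis p X {} B"
  unfolding homology_basis_def
proof (intro conjI allI impI ballI)
  fix z assume z: "singular_relcycle p X {} z"
  have "singular_relboundary p X U z"
    using homology_basis_span[OF rel singular_cycle_imp_relcycle[OF z]]
    by (force simp: homologous_rel_def)
  then obtain e where e: "singular_relcycle p (subtopology X U) {} e" "homologous_rel p X {} z e"
    using relcycle_lift_subspace_cycle[OF z] by metis
  obtain n where "homologous_rel p (subtopology X U) {} e (\<Sum>b\<in>B. frag_cmul (n b) b)"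
    using homology_basis_span[OF B e(1)] .
  then have "homologous_rel p X {} e (\<Sum>b\<in>B. frag_cmul (n b) b)"
    unfolding homologous_rel_def by (rule singular_relboundary_subspaceD)
  then show "\<exists>n. homologous_rel p X {} z (\<Sum>b\<in>B. frag_cmul (n b) b)"
    using e(2) homologous_rel_trans by blast
next
  fix n b assume n: "singular_relboundary p X {} (\<Sum>b\<in>B. frag_cmul (n b) b)" and b: "b \<in> B"
  have "singular_chain p (subtopology X U) (\<Sum>b\<in>B. frag_cmul (n b) b)"
    using singular_relcycle_combination[OF homology_basisD(2)[OF B]] by (simp add: singular_cycle)
  then have "singular_relboundary p (subtopology X U) {} (\<Sum>b\<in>B. frag_cmul (n b) b)"
    using above b n singular_boundary_of_subspace by blast
  then show "n b = 0" using homology_basisD(3)[OF B] b by blast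
qed (simp_all add: homology_basisD(1)[OF B] singular_relcycle_subspaceD[OF homology_basisD(2)[OF B]])

text \<open>The relative generator lifts to an absolute cycle, since its boundary is a cycle of
  \<open>U\<close> in a degree where \<open>U\<close> has no homology. The short exact sequence left
  over then splits.\<close>

lemma homology_basis_extend_generator:
  assumes B: "homology_basis p (subtopology X U) {} B"
    and rel: "homology_basis p X U {r}" and above: "homology_basis (Suc p) X U {}"
    and below: "p = 0 \<or> homology_basis (p - 1) (subtopology X U) {} {}"
  obtains r' where "r' \<notin> B" "homology_basis p X {} (insert r' B)"
proof -
  have r: "singular_relcycle p X U r" using homology_basisD(2)[OF rel] by simp
  \<comment> \<open>The chain \<open>e\<close> of \<open>U\<close> corrects \<open>r\<close> to the
    absolute cycle \<open>r - e\<close>. In degree 0 every boundary is 0 by convention, so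
    \<open>e = 0\<close> will do.\<close>
  obtain e where e: "singular_chain p (subtopology X U) e" "chain_boundary p e = chain_boundary p r"
  proof (cases "p = 0")
    case True
    then show ?thesis by (intro that[of 0]) (simp_all add: chain_boundary_def)
  next
    case False
    then obtain q where q: "p = Suc q" by (cases p) auto
    have "singular_relcycle q (subtopology X U) {} (chain_boundary p r)"
      using r unfolding singular_relcycle singular_cycle q
      by (auto simp: chain_boundary_boundary_alt)
    then have "singular_relboundary q (subtopology X U) {} (chain_boundary p r)"
      using below homology_basis_span[of q "subtopology X U" "{}" "{}"] q
      by (force simp: homologous_rel_def)
    then show ?thesis using that q by (auto simp: singular_boundary)
  qed
  have eX: "singular_chain p X e" using e(1) by (simp add: singular_chain_subtopology)
  define r' where "r' = r - e"
  have r': "singular_relcycle p X {} r'"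
    using r e eX by (auto simp: r'_def singular_cycle singular_relcycle chain_boundary_diff singular_chain_diff)
  have err: "singular_relboundary p X U (r - r')"
    using e(1) by (simp add: r'_def singular_chain_imp_relboundary)
  have fin: "finite B" using homology_basisD(1)[OF B] .
  have Bch: "singular_chain p (subtopology X U) (\<Sum>b\<in>B. frag_cmul (n b) b)" for n
    using singular_relcycle_combination[OF homology_basisD(2)[OF B]] by (simp add: singular_cycle)
  have zero: "m = 0" if "singular_relboundary p X U (frag_cmul m r')" for m
  proof -
    have "singular_relboundary p X U (frag_cmul m r' + frag_cmul m (r - r'))"
      by (rule singular_relboundary_add[OF that singular_relboundary_cmul[OF err]])
    then have "singular_relboundary p X U (\<Sum>b\<in>{r}. frag_cmul ((\<lambda>_. m) b) b)"
      by (simp flip: frag_cmul_distrib2)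
    from homology_basisD(3)[OF rel this] show ?thesis by simp
  qed
  have notin: "r' \<notin> B"
  proof
    assume "r' \<in> B"
    then have "singular_chain p (subtopology X U) r'"
      using homology_basisD(2)[OF B] by (simp add: singular_cycle)
    then have "singular_relboundary p X U (frag_cmul 1 r')"
      by (simp add: singular_chain_imp_relboundary)
    from zero[OF this] show False by simp
  qed
  have "homology_basis p X {} (insert r' B)"
    unfolding homology_basis_def
  proof (intro conjI allI impI)
    fix z assume z: "singular_relcycle p X {} z"
    obtain m where "homologous_rel p X U z (\<Sum>b\<in>{r}. frag_cmul (m b) b)"
      using homology_basis_span[OF rel singular_cycle_imp_relcycle[OF z]] .
    then have 1: "singular_relboundary p X U (z - frag_cmul (m r) r)" by (simp add: homologous_rel_def)
    have eq: "z - frag_cmul (m r) r' = (z - frag_cmul (m r) r) + frag_cmul (m r) (r - r')"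
      by (rule poly_mapping_eqI) (simp add: lookup_minus lookup_add algebra_simps)
    have 3: "singular_relboundary p X U (z - frag_cmul (m r) r')"
      unfolding eq by (rule singular_relboundary_add[OF 1 singular_relboundary_cmul[OF err]])
    have 2: "singular_relcycle p X {} (z - frag_cmul (m r) r')"
      using z r' by (intro singular_relcycle_diff singular_relcycle_cmul)
    obtain e where e: "singular_relcycle p (subtopology X U) {} e"
        "homologous_rel p X {} (z - frag_cmul (m r) r') e"
      by (rule relcycle_lift_subspace_cycle[OF 2 3])
    obtain n where "homologous_rel p (subtopology X U) {} e (\<Sum>b\<in>B. frag_cmul (n b) b)"
      using homology_basis_span[OF B e(1)] .
    then have "homologous_rel p X {} e (\<Sum>b\<in>B. frag_cmul (n b) b)"
      unfolding homologous_rel_def by (rule singular_relboundary_subspaceD)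
    then have "homologous_rel p X {} (z - frag_cmul (m r) r') (\<Sum>b\<in>B. frag_cmul (n b) b)"
      using e(2) homologous_rel_trans by blast
    moreover have "(\<Sum>b\<in>insert r' B. frag_cmul ((n(r' := m r)) b) b)
        = frag_cmul (m r) r' + (\<Sum>b\<in>B. frag_cmul (n b) b)"
      using fin notin by (simp, intro sum.cong) auto
    ultimately show "\<exists>n. homologous_rel p X {} z (\<Sum>b\<in>insert r' B. frag_cmul (n b) b)"
      by (intro exI[of _ "n(r' := m r)"]) (simp only: homologous_rel_def diff_diff_add)
  next
    fix n assume "singular_relboundary p X {} (\<Sum>b\<in>insert r' B. frag_cmul (n b) b)"
    then have n: "singular_relboundary p X {} (frag_cmul (n r') r' + (\<Sum>b\<in>B. frag_cmul (n b) b))"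
      using fin notin by simp
    then have "singular_relboundary p X U (frag_cmul (n r') r' + (\<Sum>b\<in>B. frag_cmul (n b) b))"
      by (rule singular_boundary_imp_relboundary)
    from singular_relboundary_diff[OF this singular_chain_imp_relboundary[OF Bch[of n]]]
    have nr: "n r' = 0" using zero by simp
    then have "singular_relboundary p (subtopology X U) {} (\<Sum>b\<in>B. frag_cmul (n b) b)"
      using n singular_boundary_of_subspace[OF above Bch] by simp
    then show "\<forall>b\<in>insert r' B. n b = 0"
      using homology_basisD(3)[OF B] nr by blast
  qed (auto simp: fin r' singular_relcycle_subspaceD[OF homology_basisD(2)[OF B]])
  with notin show ?thesis by (rule that)
qed

section \<open>Universal coefficients for free homology\<close>

text \<open>Coordinates of a homology class. The choice is determined only on \<open>B\<close>;
  values elsewhere are arbitrary.\<close>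

definition homology_coefficients :: "nat \<Rightarrow> 'a topology \<Rightarrow> 'a chain set \<Rightarrow> 'a chain \<Rightarrow> 'a chain \<Rightarrow> int" where
  "homology_coefficients p X B z = (SOME n. homologous_rel p X {} z (\<Sum>b\<in>B. frag_cmul (n b) b))"

lemma homologous_homology_coefficients:
  assumes "homology_basis p X {} B" "singular_relcycle p X {} z"
  shows "homologous_rel p X {} z (\<Sum>b\<in>B. frag_cmul (homology_coefficients p X B z b) b)"
  unfolding homology_coefficients_def using assms
  by (intro someI_ex[where P = "\<lambda>n. homologous_rel p X {} z (\<Sum>b\<in>B. frag_cmul (n b) b)"])
     (simp add: homology_basis_def)

lemma homology_coefficients_unique:
  assumes B: "homology_basis p X {} B"
    and z: "singular_relcycle p X {} z" and n: "homologous_rel p X {} z (\<Sum>b\<in>B. frag_cmul (n b) b)"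
    and b: "b \<in> B"
  shows "homology_coefficients p X B z b = n b"
proof -
  let ?n = "homology_coefficients p X B z"
  have "homologous_rel p X {} (\<Sum>b\<in>B. frag_cmul (?n b) b) (\<Sum>b\<in>B. frag_cmul (n b) b)"
    using homologous_homology_coefficients[OF B z] n homologous_rel_sym homologous_rel_trans by blast
  then have "singular_relboundary p X {} (\<Sum>b\<in>B. frag_cmul (?n b - n b) b)"
    by (simp add: homologous_rel_def frag_cmul_diff_distrib sum_subtractf)
  from homology_basisD(3)[OF B this b] show ?thesis by simp
qed

lemma homology_coefficients_diff:
  assumes B: "homology_basis p X {} B" and z: "singular_relcycle p X {} z"
    and w: "singular_relcycle p X {} w" and b: "b \<in> B"
  shows "homology_coefficients p X B (z - w) b = homology_coefficients p X B z b - homology_coefficients p X B w b"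
proof -
  have "homologous_rel p X {} (z - w) (\<Sum>b\<in>B.
      frag_cmul (homology_coefficients p X B z b - homology_coefficients p X B w b) b)"
    using homologous_rel_diff[OF homologous_homology_coefficients[OF B z]
        homologous_homology_coefficients[OF B w]]
    by (simp add: frag_cmul_diff_distrib sum_subtractf)
  from homology_coefficients_unique[OF B singular_relcycle_diff[OF z w] this b] show ?thesis .
qed

lemma homology_coefficients_boundary:
  assumes B: "homology_basis p X {} B" and z: "singular_relboundary p X {} z" and b: "b \<in> B"
  shows "homology_coefficients p X B z b = 0"
proof -
  have "homologous_rel p X {} z (\<Sum>b\<in>B. frag_cmul ((\<lambda>_. 0) b) b)"
    using z by (simp add: homologous_rel_def)
  from homology_coefficients_unique[OF B singular_relboundary_imp_relcycle[OF z] this b]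
  show ?thesis .
qed

lemma homology_coefficients_basis:
  assumes B: "homology_basis p X {} B" and a: "a \<in> B" and b: "b \<in> B"
  shows "homology_coefficients p X B a b = (if a = b then 1 else 0)"
proof -
  have "(\<Sum>c\<in>B. frag_cmul (if a = c then 1 else 0) c) = (\<Sum>c\<in>B. if a = c then c else 0)"
    by (rule sum.cong) auto
  also have "\<dots> = a" using homology_basisD(1)[OF B] a by simp
  finally have "homologous_rel p X {} a (\<Sum>c\<in>B. frag_cmul ((\<lambda>c. if a = c then 1 else 0) c) c)"
    by simp
  from homology_coefficients_unique[OF B homology_basisD(2)[OF B a] this b] show ?thesis .
qed

text \<open>The cycles are a direct summand of the chains: given a retraction \<open>\<rho>\<close> in degree \<open>p\<close>, a cycle is
  homologous to its basis expansion \<open>\<kappa>\<close>, so that a primitive of \<open>\<rho> f - \<kappa> (\<rho> f)\<close> for every simplex \<open>f\<close>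
  splits the boundary map from degree \<open>p + 1\<close>. This avoids the theorem that subgroups
  of free abelian groups are free. Additivity is stated for differences to match
  \<open>frag_induction\<close>.\<close>

lemma cycle_retraction:
  assumes B: "\<And>q. homology_basis q X {} (B q)"
  shows "\<exists>\<rho>. (\<forall>c. singular_chain p X c \<longrightarrow> singular_relcycle p X {} (\<rho> c)) \<and>
     (\<forall>c d. singular_chain p X c \<longrightarrow> singular_chain p X d \<longrightarrow> \<rho> (c - d) = \<rho> c - \<rho> d) \<and>
     (\<forall>z. singular_relcycle p X {} z \<longrightarrow> \<rho> z = z)"
proof (induction p)
  case 0
  show ?case by (rule exI[of _ id]) (auto simp: singular_cycle chain_boundary_def)
next
  case (Suc p)
  then obtain \<rho> where \<rho>: "\<And>c. singular_chain p X c \<Longrightarrow> singular_relcycle p X {} (\<rho> c)"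
      "\<And>c d. singular_chain p X c \<Longrightarrow> singular_chain p X d \<Longrightarrow> \<rho> (c - d) = \<rho> c - \<rho> d"
      "\<And>z. singular_relcycle p X {} z \<Longrightarrow> \<rho> z = z"
    by blast
  define coef where "coef = homology_coefficients p X (B p)"
  note coef = homologous_homology_coefficients[OF B[of p], folded coef_def]
    homology_coefficients_diff[OF B[of p], folded coef_def]
    homology_coefficients_boundary[OF B[of p], folded coef_def]
    homology_coefficients_basis[OF B[of p], folded coef_def]
  define \<kappa> where "\<kappa> = (\<lambda>z. \<Sum>b\<in>B p. frag_cmul (coef z b) b)"
  define \<tau> where "\<tau> = (\<lambda>f. SOME y. singular_chain (Suc p) X y \<and>
      chain_boundary (Suc p) y = \<rho> (frag_of f) - \<kappa> (\<rho> (frag_of f)))"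
  have \<tau>: "singular_chain (Suc p) X (\<tau> f)"
       "chain_boundary (Suc p) (\<tau> f) = \<rho> (frag_of f) - \<kappa> (\<rho> (frag_of f))"
    if "singular_simplex p X f" for f
  proof -
    have "singular_relcycle p X {} (\<rho> (frag_of f))"
      using that by (intro \<rho>(1)) (simp add: singular_chain_of)
    from coef(1)[OF this] have "\<exists>y. singular_chain (Suc p) X y \<and>
        chain_boundary (Suc p) y = \<rho> (frag_of f) - \<kappa> (\<rho> (frag_of f))"
      by (simp add: homologous_rel_def singular_boundary \<kappa>_def)
    from someI_ex[OF this] show "singular_chain (Suc p) X (\<tau> f)"
       "chain_boundary (Suc p) (\<tau> f) = \<rho> (frag_of f) - \<kappa> (\<rho> (frag_of f))"
      by (simp_all add: \<tau>_def)
  qed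
  define \<sigma> where "\<sigma> = frag_extend \<tau>"
  have \<kappa>_diff: "\<kappa> (z - w) = \<kappa> z - \<kappa> w"
    if "singular_relcycle p X {} z" "singular_relcycle p X {} w" for z w
    unfolding \<kappa>_def using coef(2)[OF that]
    by (simp add: frag_cmul_diff_distrib sum_subtractf)
  have \<rho>0: "\<rho> 0 = 0" using \<rho>(3)[of 0] by simp
  have \<sigma>: "singular_chain p X c \<and> singular_chain (Suc p) X (\<sigma> c) \<and>
     chain_boundary (Suc p) (\<sigma> c) = \<rho> c - \<kappa> (\<rho> c)" if "singular_chain p X c" for c
  proof -
    have "Poly_Mapping.keys c \<subseteq> singular_simplex_set p X"
      using that by (simp add: singular_chain_def)
    then show ?thesis
    proof (induction c rule: frag_induction)
      case zero
      have "\<kappa> 0 = 0" unfolding \<kappa>_def using coef(3)[of 0] by simp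
      then show ?case by (simp add: \<sigma>_def \<rho>0)
    next
      case (one f)
      then show ?case using \<tau> by (simp add: \<sigma>_def singular_chain_of)
    next
      case (diff a b)
      then show ?case
        by (auto simp: \<sigma>_def frag_extend_diff singular_chain_diff chain_boundary_diff \<rho> \<kappa>_diff)
    qed
  qed
  have \<sigma>_diff: "\<sigma> (c - d) = \<sigma> c - \<sigma> d" for c d
    by (simp add: \<sigma>_def frag_extend_diff)
  have section_bd: "chain_boundary (Suc p) (\<sigma> z) = z" if z: "singular_relboundary p X {} z" for z
  proof -
    have "singular_relcycle p X {} z" using z by (rule singular_relboundary_imp_relcycle)
    then have "\<rho> z = z" and "singular_chain p X z" by (auto simp: \<rho>(3) singular_cycle)
    moreover have "\<kappa> z = 0" unfolding \<kappa>_def using coef(3)[OF z] by simp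
    ultimately show ?thesis using \<sigma>[of z] by simp
  qed
  \<comment> \<open>\<open>\<sigma>\<close> inverts the boundary map on boundaries, so subtracting
    \<open>\<sigma>\<close> of the boundary of \<open>c\<close> from \<open>c\<close> cancels that
    boundary, and nothing changes when \<open>c\<close> is a cycle.\<close>
  let ?r = "\<lambda>c. c - \<sigma> (chain_boundary (Suc p) c)"
  have bd: "singular_relboundary p X {} (chain_boundary (Suc p) c)" if "singular_chain (Suc p) X c" for c
    using that by (auto simp: singular_boundary)
  show ?case
  proof (intro exI[of _ ?r] conjI allI impI)
    fix c assume c: "singular_chain (Suc p) X c"
    then have "singular_chain (Suc p) X (\<sigma> (chain_boundary (Suc p) c))"
      using \<sigma>[OF singular_chain_boundary_alt[OF c]] by simp
    then show "singular_relcycle (Suc p) X {} (?r c)"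
      using c section_bd[OF bd[OF c]]
      by (simp add: singular_cycle singular_chain_diff chain_boundary_diff)
  next
    fix c d assume "singular_chain (Suc p) X c" "singular_chain (Suc p) X d"
    show "?r (c - d) = ?r c - ?r d" by (simp add: chain_boundary_diff \<sigma>_diff)
  next
    fix z assume "singular_relcycle (Suc p) X {} z"
    then show "?r z = z" by (simp add: singular_cycle \<sigma>_def)
  qed
qed

lemma hom_chain_group_integer_group_iff:
  "\<phi> \<in> hom (chain_group p X) integer_group \<longleftrightarrow>
   (\<forall>c d. singular_chain p X c \<longrightarrow> singular_chain p X d \<longrightarrow> \<phi> (c - d) = \<phi> c - \<phi> d)"
proof
  assume \<phi>: "\<phi> \<in> hom (chain_group p X) integer_group"
  have "\<phi> (c - d) = \<phi> c - \<phi> d" if "singular_chain p X c" "singular_chain p X d" for c d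
  proof -
    have "\<phi> (c - d + d) = \<phi> (c - d) + \<phi> d"
      using \<phi> that singular_chain_diff[OF that] unfolding hom_def by fastforce
    then show ?thesis by simp
  qed
  then show "\<forall>c d. singular_chain p X c \<longrightarrow> singular_chain p X d \<longrightarrow> \<phi> (c - d) = \<phi> c - \<phi> d"
    by simp
next
  assume \<phi>: "\<forall>c d. singular_chain p X c \<longrightarrow> singular_chain p X d \<longrightarrow> \<phi> (c - d) = \<phi> c - \<phi> d"
  have \<phi>0: "\<phi> 0 = 0" using \<phi>[rule_format, of 0 0] by simp
  have "\<phi> (c + d) = \<phi> c + \<phi> d" if c: "singular_chain p X c" and d: "singular_chain p X d" for c d
  proof -
    have "\<phi> (- d) = - \<phi> d"
      using \<phi>[rule_format, of 0 d] d \<phi>0 by simp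
    moreover have "\<phi> (c - (- d)) = \<phi> c - \<phi> (- d)"
      by (rule \<phi>[rule_format, OF c]) (simp add: singular_chain_minus d)
    ultimately show ?thesis by simp
  qed
  then show "\<phi> \<in> hom (chain_group p X) integer_group" by (auto simp: hom_def)
qed

lemma singular_cycle_boundary:
  assumes "singular_chain (Suc p) X c"
  shows "singular_relcycle p X {} (chain_boundary (Suc p) c)"
  using assms by (intro singular_relboundary_imp_relcycle) (auto simp: singular_boundary)

lemma mem_cocycles_iff:
  "\<phi> \<in> cocycles p X \<longleftrightarrow> \<phi> \<in> carrier (cochain_group p X) \<and>
     (\<forall>c. singular_chain (Suc p) X c \<longrightarrow> \<phi> (chain_boundary (Suc p) c) = 0)"
  by (auto simp: cocycles_def kernel_def coboundary_def cochain_group_def fun_eq_iff restrict_def)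

lemma coboundary_eq_on_cycles:
  assumes "\<psi> \<in> coboundaries p X" "singular_relcycle p X {} z"
  shows "\<psi> z = 0"
proof (cases p)
  case 0
  then show ?thesis
    using assms by (auto simp: coboundaries_def cochain_group_def singular_cycle)
next
  case (Suc q)
  then obtain \<theta> where \<theta>: "\<theta> \<in> carrier (cochain_group q X)" "\<psi> = coboundary q X \<theta>"
    using assms(1) by (auto simp: coboundaries_def)
  have "\<theta> (0 - 0) = \<theta> 0 - \<theta> 0"
    using \<theta>(1) by (intro hom_chain_group_integer_group_iff[THEN iffD1, rule_format, where p = q and X = X])
      (auto simp: cochain_group_def)
  then show ?thesis
    using assms(2) \<theta>(2) Suc by (auto simp: coboundary_def singular_cycle)
qed

text \<open>This is where the Ext term disappears. A cochain that kills cycles depends only on the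
  boundary of its argument, so it is a functional on boundaries, which must be extended to all
  chains of one degree less. The extension \<open>\<theta>\<close> retracts a chain to a cycle by
  \<open>\<rho>\<close>, subtracts its basis expansion \<open>\<kappa>\<close> to get a boundary,
  and applies \<open>\<phi>\<close> to a primitive \<open>y\<close>.\<close>

lemma vanishing_on_cycles_imp_coboundary:
  assumes B: "\<And>q. homology_basis q X {} (B q)"
    and \<phi>: "\<phi> \<in> carrier (cochain_group p X)" and zero: "\<And>z. singular_relcycle p X {} z \<Longrightarrow> \<phi> z = 0"
  shows "\<phi> \<in> coboundaries p X"
proof (cases p)
  case 0
  have "\<phi> = \<one>\<^bsub>cochain_group 0 X\<^esub>"
  proof
    fix c show "\<phi> c = \<one>\<^bsub>cochain_group 0 X\<^esub> c"
    proof (cases "singular_chain 0 X c")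
      case True
      then have "singular_relcycle 0 X {} c" by (simp add: singular_cycle chain_boundary_def)
      then show ?thesis using zero 0 True by (simp add: cochain_group_def)
    next
      case False
      then show ?thesis using \<phi> 0 by (simp add: cochain_group_def extensional_def)
    qed
  qed
  then show ?thesis by (simp add: coboundaries_def 0)
next
  case (Suc q)
  have \<phi>_diff: "\<phi> (c - d) = \<phi> c - \<phi> d" if "singular_chain p X c" "singular_chain p X d" for c d
    using \<phi> that hom_chain_group_integer_group_iff[of \<phi> p X] by (simp add: cochain_group_def)
  obtain \<rho> where \<rho>: "\<forall>c. singular_chain q X c \<longrightarrow> singular_relcycle q X {} (\<rho> c)"
      "\<forall>c d. singular_chain q X c \<longrightarrow> singular_chain q X d \<longrightarrow> \<rho> (c - d) = \<rho> c - \<rho> d"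
      "\<forall>z. singular_relcycle q X {} z \<longrightarrow> \<rho> z = z"
    using cycle_retraction[OF B, of q] by blast
  define coef where "coef = homology_coefficients q X (B q)"
  note coef = homologous_homology_coefficients[OF B[of q], folded coef_def]
    homology_coefficients_diff[OF B[of q], folded coef_def]
    homology_coefficients_boundary[OF B[of q], folded coef_def]
    homology_coefficients_basis[OF B[of q], folded coef_def]
  define \<kappa> where "\<kappa> = (\<lambda>z. \<Sum>b\<in>B q. frag_cmul (coef z b) b)"
  define y where "y = (\<lambda>z. SOME y. singular_chain p X y \<and> chain_boundary p y = z - \<kappa> z)"
  have y: "singular_chain p X (y z)" "chain_boundary p (y z) = z - \<kappa> z"
    if "singular_relcycle q X {} z" for z
  proof -
    have "\<exists>y. singular_chain p X y \<and> chain_boundary p y = z - \<kappa> z"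
      using coef(1)[OF that] by (simp add: homologous_rel_def singular_boundary \<kappa>_def Suc)
    from someI_ex[OF this] show "singular_chain p X (y z)" "chain_boundary p (y z) = z - \<kappa> z"
      by (simp_all add: y_def)
  qed
  \<comment> \<open>Makes \<open>\<phi> (y z)\<close> independent of the chosen primitive, hence
    additive in \<open>z\<close>.\<close>
  have well: "\<phi> c = \<phi> d" if c: "singular_chain p X c" and d: "singular_chain p X d"
    and "chain_boundary p c = chain_boundary p d" for c d
  proof -
    have "singular_relcycle p X {} (c - d)"
      using that by (simp add: singular_cycle singular_chain_diff chain_boundary_diff)
    then show ?thesis using zero[of "c - d"] \<phi>_diff[OF c d] by simp
  qed
  have \<kappa>_diff: "\<kappa> (z - w) = \<kappa> z - \<kappa> w"
    if "singular_relcycle q X {} z" "singular_relcycle q X {} w" for z w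
    unfolding \<kappa>_def using coef(2)[OF that]
    by (simp add: frag_cmul_diff_distrib sum_subtractf)
  define \<theta> where "\<theta> = (\<lambda>c\<in>carrier (chain_group q X). \<phi> (y (\<rho> c)))"
  have "\<theta> (c - d) = \<theta> c - \<theta> d" if c: "singular_chain q X c" and d: "singular_chain q X d" for c d
  proof -
    have cyc: "singular_relcycle q X {} (\<rho> c)" "singular_relcycle q X {} (\<rho> d)"
        "singular_relcycle q X {} (\<rho> (c - d))"
      using \<rho>(1) c d by (simp_all add: singular_chain_diff)
    have "\<rho> (c - d) = \<rho> c - \<rho> d" using \<rho>(2) c d by simp
    then have "\<phi> (y (\<rho> (c - d))) = \<phi> (y (\<rho> c) - y (\<rho> d))"
      using cyc by (intro well) (simp_all add: y singular_chain_diff chain_boundary_diff \<kappa>_diff)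
    also have "\<dots> = \<phi> (y (\<rho> c)) - \<phi> (y (\<rho> d))"
      by (rule \<phi>_diff[OF y(1) y(1)]) (use cyc in auto)
    finally show ?thesis using c d by (simp add: \<theta>_def singular_chain_diff)
  qed
  then have \<theta>: "\<theta> \<in> carrier (cochain_group q X)"
    by (simp add: cochain_group_def hom_chain_group_integer_group_iff) (simp add: \<theta>_def)
  have "\<phi> = coboundary q X \<theta>"
  proof
    fix c show "\<phi> c = coboundary q X \<theta> c"
    proof (cases "singular_chain p X c")
      case True
      let ?z = "chain_boundary p c"
      have bd: "singular_relboundary q X {} ?z" using True Suc by (auto simp: singular_boundary)
      then have cyc: "singular_relcycle q X {} ?z" by (rule singular_relboundary_imp_relcycle)
      have "\<kappa> ?z = 0" using coef(3)[OF bd] by (simp add: \<kappa>_def)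
      then have "\<phi> (y ?z) = \<phi> c"
        using y[OF cyc] True by (intro well) auto
      moreover have "\<rho> ?z = ?z" using \<rho>(3) cyc by blast
      moreover have "singular_chain q X ?z" using cyc by (simp add: singular_cycle)
      ultimately show ?thesis using True Suc by (simp add: coboundary_def \<theta>_def)
    next
      case False
      then show ?thesis using \<phi> Suc by (simp add: cochain_group_def extensional_def coboundary_def)
    qed
  qed
  then show ?thesis using \<theta> Suc by (simp add: coboundaries_def)
qed

text \<open>The coordinate functional lives on cycles; composing it with the retraction onto cycles
  extends it to all chains. It is a cocycle because boundaries have zero coordinates.\<close>

lemma dual_cocycle:
  assumes B: "\<And>q. homology_basis q X {} (B q)" and b: "b \<in> B p"
  shows "\<exists>\<phi>. \<phi> \<in> cocycles p X \<and> (\<forall>a\<in>B p. \<phi> a = (if a = b then 1 else 0))"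
proof -
  obtain \<rho> where \<rho>: "\<forall>c. singular_chain p X c \<longrightarrow> singular_relcycle p X {} (\<rho> c)"
      "\<forall>c d. singular_chain p X c \<longrightarrow> singular_chain p X d \<longrightarrow> \<rho> (c - d) = \<rho> c - \<rho> d"
      "\<forall>z. singular_relcycle p X {} z \<longrightarrow> \<rho> z = z"
    using cycle_retraction[OF B, of p] by blast
  define coef where "coef = homology_coefficients p X (B p)"
  note coef = homologous_homology_coefficients[OF B[of p], folded coef_def]
    homology_coefficients_diff[OF B[of p], folded coef_def]
    homology_coefficients_boundary[OF B[of p], folded coef_def]
    homology_coefficients_basis[OF B[of p], folded coef_def]
  define \<phi> where "\<phi> = (\<lambda>c\<in>carrier (chain_group p X). coef (\<rho> c) b)"
  have \<phi>_cycle: "\<phi> z = coef z b" if "singular_relcycle p X {} z" for z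
    using that \<rho>(3) by (simp add: \<phi>_def singular_cycle)
  have "\<phi> (c - d) = \<phi> c - \<phi> d" if "singular_chain p X c" "singular_chain p X d" for c d
    using that \<rho>(1,2) coef(2) b by (simp add: \<phi>_def singular_chain_diff)
  then have "\<phi> \<in> carrier (cochain_group p X)"
    by (simp add: cochain_group_def hom_chain_group_integer_group_iff) (simp add: \<phi>_def)
  moreover have "\<phi> (chain_boundary (Suc p) c) = 0" if "singular_chain (Suc p) X c" for c
  proof -
    have bd: "singular_relboundary p X {} (chain_boundary (Suc p) c)"
      using that by (auto simp: singular_boundary)
    then show ?thesis
      using \<phi>_cycle[OF singular_relboundary_imp_relcycle[OF bd]] coef(3)[OF bd b] by simp
  qed
  ultimately have "\<phi> \<in> cocycles p X" by (simp add: mem_cocycles_iff)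
  moreover have "\<phi> a = (if a = b then 1 else 0)" if "a \<in> B p" for a
    using \<phi>_cycle[OF homology_basisD(2)[OF B that]] coef(4)[OF that b] by simp
  ultimately show ?thesis by blast
qed

text \<open>Cohomology is paired with the basis cycles by evaluation. The
  \<open>dual_cocycle\<close>s are dual to these evaluations, and a class on which all of them
  vanish is zero by \<open>vanishing_on_cycles_imp_coboundary\<close>.\<close>

theorem betti_eq_card_homology_basis:
  fixes X :: "'a topology"
  assumes B: "\<And>q. homology_basis q X {} (B q)"
  shows "betti p X = enat (card (B p))"
proof -
  let ?C = "cochain_group p X" and ?H = "cohomology_group p X"
  let ?Z = "subgroup_generated ?C (cocycles p X)" and ?D = "coboundaries p X"
  interpret C: comm_group ?C by (rule comm_group_cochain_group)
  interpret C': comm_group "cochain_group (Suc p) X" by (rule comm_group_cochain_group)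
  interpret d: group_hom ?C "cochain_group (Suc p) X" "coboundary p X"
    by unfold_locales (rule coboundary_hom)
  interpret Zs: subgroup "cocycles p X" ?C
    unfolding cocycles_def by (rule d.subgroup_kernel)
  interpret Z: comm_group ?Z
    by (simp add: C.abelian_subgroup_generated comm_group_cochain_group)
  interpret H: comm_group ?H by (rule comm_group_cohomology_group)
  have carrZ: "carrier ?Z = cocycles p X" by simp
  have multZ: "(\<phi> \<otimes>\<^bsub>?Z\<^esub> \<psi>) z = \<phi> z + \<psi> z" if "singular_chain p X z" for \<phi> \<psi> z
    using that by (simp add: cochain_group_def)
  have bcyc: "singular_relcycle p X {} b" if "b \<in> B p" for b
    by (rule homology_basisD(2)[OF B that])
  have bch: "singular_chain p X b" if "b \<in> B p" for b
    using bcyc[OF that] by (simp add: singular_cycle)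
  \<comment> \<open>Evaluates an arbitrary representative of the coset \<open>K\<close>;
    \<open>E_cls\<close> shows independence of the representative, as coboundaries vanish on
    cycles.\<close>
  define E where "E = (\<lambda>(b :: 'a chain) K. (SOME \<phi>. \<phi> \<in> K) b :: int)"
  define cls where "cls = (\<lambda>\<phi>. ?D #>\<^bsub>?Z\<^esub> \<phi>)"
  have carrH: "carrier ?H = cls ` cocycles p X"
    by (auto simp: cohomology_group_def FactGroup_def RCOSETS_def cls_def)
  have D_sub: "?D \<subseteq> cocycles p X"
  proof
    fix \<psi> assume \<psi>: "\<psi> \<in> ?D"
    have "\<psi> \<in> carrier ?C"
    proof (cases p)
      case 0
      then show ?thesis using \<psi> C.one_closed by (simp add: coboundaries_def)
    next
      case (Suc q)
      then show ?thesis using \<psi> hom_in_carrier[OF coboundary_hom[of q X]] by (auto simp: coboundaries_def)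
    qed
    then show "\<psi> \<in> cocycles p X"
      using coboundary_eq_on_cycles[OF \<psi> singular_cycle_boundary]
      by (simp add: mem_cocycles_iff)
  qed
  have E_cls: "E b (cls \<phi>) = \<phi> b" if "\<phi> \<in> cocycles p X" "b \<in> B p" for \<phi> b
  proof -
    have "\<psi> b = \<phi> b" if "\<psi> \<in> cls \<phi>" for \<psi>
      using that coboundary_eq_on_cycles[OF _ bcyc[OF \<open>b \<in> B p\<close>]] multZ[OF bch[OF \<open>b \<in> B p\<close>]]
      by (auto simp: cls_def r_coset_def)
    moreover have "cls \<phi> \<noteq> {}"
    proof -
      have "\<one>\<^bsub>?Z\<^esub> \<in> ?D"
      proof (cases p)
        case 0
        then show ?thesis by (simp add: coboundaries_def)
      next
        case (Suc q)
        interpret C0: comm_group "cochain_group q X" by (rule comm_group_cochain_group)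
        have "coboundary q X \<one>\<^bsub>cochain_group q X\<^esub> = \<one>\<^bsub>?C\<^esub>"
          using hom_one[OF coboundary_hom[of q X]] C.is_group C0.is_group Suc by simp
        then show ?thesis using Suc C0.one_closed by (auto simp: coboundaries_def intro: rev_image_eqI)
      qed
      then show ?thesis by (auto simp: cls_def r_coset_def)
    qed
    ultimately show ?thesis by (simp add: E_def some_in_eq)
  qed
  have D: "subgroup ?D ?Z"
  proof -
    have "subgroup ?D ?C"
    proof (cases p)
      case 0
      then show ?thesis using C.triv_subgroup by (simp add: coboundaries_def)
    next
      case (Suc q)
      interpret C0: comm_group "cochain_group q X" by (rule comm_group_cochain_group)
      interpret e: group_hom "cochain_group q X" ?C "coboundary q X"
        using coboundary_hom[of q X] Suc by unfold_locales auto
      show ?thesis using e.img_is_subgroup by (simp add: coboundaries_def Suc)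
    qed
    then show ?thesis
      using D_sub Zs.subgroup_axioms by (simp add: C.subgroup_of_subgroup_generated)
  qed
  have cls_mult: "cls \<phi> \<otimes>\<^bsub>?H\<^esub> cls \<psi> = cls (\<phi> \<otimes>\<^bsub>?Z\<^esub> \<psi>)"
    if "\<phi> \<in> cocycles p X" "\<psi> \<in> cocycles p X" for \<phi> \<psi>
  proof -
    interpret N: normal ?D ?Z using D by (simp add: Z.normal_iff_subgroup)
    show ?thesis
      using that N.rcos_sum[of \<phi> \<psi>] by (simp add: cls_def cohomology_group_def FactGroup_def)
  qed
  define x where "x = (\<lambda>b. SOME \<phi>. \<phi> \<in> cocycles p X \<and> (\<forall>a\<in>B p. \<phi> a = (if a = b then 1 else 0)))"
  have x: "x b \<in> cocycles p X \<and> (\<forall>a\<in>B p. x b a = (if a = b then 1 else 0))" if "b \<in> B p" for b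
    unfolding x_def by (rule someI_ex[OF dual_cocycle[OF B that]])
  show ?thesis
    unfolding betti_def
  proof (rule abelian_rank_eq_card_dual_basis[where E = E and x = "\<lambda>b. cls (x b)"])
    show "comm_group ?H" by (rule comm_group_cohomology_group)
    show "finite (B p)" by (rule homology_basisD(1)[OF B])
  next
    fix b assume b: "b \<in> B p"
    show "E b \<in> hom ?H integer_group"
    proof (rule homI)
      fix K L assume "K \<in> carrier ?H" "L \<in> carrier ?H"
      then obtain \<phi> \<psi> where \<phi>: "\<phi> \<in> cocycles p X" "K = cls \<phi>" and \<psi>: "\<psi> \<in> cocycles p X" "L = cls \<psi>"
        by (auto simp: carrH)
      have "\<phi> \<otimes>\<^bsub>?Z\<^esub> \<psi> \<in> cocycles p X"
        using \<phi> \<psi> Z.m_closed[of \<phi> \<psi>] by simp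
      then show "E b (K \<otimes>\<^bsub>?H\<^esub> L) = E b K \<otimes>\<^bsub>integer_group\<^esub> E b L"
        using \<phi> \<psi> b multZ[OF bch[OF b]] by (simp add: cls_mult E_cls)
    qed simp
    show "cls (x b) \<in> carrier ?H" using x[OF b] by (simp add: carrH)
  next
    fix a b assume "a \<in> B p" "b \<in> B p"
    then show "E a (cls (x b)) = (if a = b then 1 else 0)" by (simp add: E_cls x)
  next
    fix K assume K: "K \<in> carrier ?H" and zero: "\<And>b. b \<in> B p \<Longrightarrow> E b K = 0"
    obtain \<phi> where \<phi>: "\<phi> \<in> cocycles p X" "K = cls \<phi>" using K by (auto simp: carrH)
    have \<phi>_hom: "\<phi> \<in> hom (chain_group p X) integer_group"
      using \<phi>(1) by (simp add: mem_cocycles_iff cochain_group_def)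
    \<comment> \<open>Up to a boundary, which the cocycle kills, \<open>z\<close> is an integral
      combination of the basis cycles, and the assumption \<open>zero\<close> makes
      \<open>\<phi>\<close> vanish on each of these.\<close>
    have "\<phi> z = 0" if z: "singular_relcycle p X {} z" for z
    proof -
      obtain n where "homologous_rel p X {} z (\<Sum>b\<in>B p. frag_cmul (n b) b)"
        using homology_basis_span[OF B z] .
      then obtain y where y: "singular_chain (Suc p) X y"
          "chain_boundary (Suc p) y = z - (\<Sum>b\<in>B p. frag_cmul (n b) b)"
        by (auto simp: homologous_rel_def singular_boundary)
      have ch: "singular_chain p X (\<Sum>b\<in>A. frag_cmul (n b) b)" if "A \<subseteq> B p" for A
        using that bch by (intro singular_chain_sum singular_chain_cmul) auto
      have cmul: "\<phi> (frag_cmul k b) = k * \<phi> b" if b: "b \<in> B p" for k b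
      proof -
        have "b [^]\<^bsub>chain_group p X\<^esub> k = frag_cmul k b"
          unfolding chain_group_def using bch[OF b]
          by (intro int_pow_free_Abelian_group) (simp add: singular_chain_def)
        then show ?thesis
          using hom_integer_group_int_pow[OF group_chain_group \<phi>_hom, of b k] bch[OF b] by simp
      qed
      have add: "\<phi> (c + d) = \<phi> c + \<phi> d" if "singular_chain p X c" "singular_chain p X d" for c d
        using \<phi>_hom that by (auto simp: hom_def)
      have "finite A \<Longrightarrow> A \<subseteq> B p \<Longrightarrow> \<phi> (\<Sum>b\<in>A. frag_cmul (n b) b) = 0" for A
      proof (induction A rule: finite_induct)
        case empty
        have "\<phi> 0 = 0" using add[of 0 0] by simp
        then show ?case by simp
      next
        case (insert b A)
        then show ?case
          using zero[of b] E_cls[OF \<phi>(1), of b] \<phi>(2) cmul[of b] ch[of A] bch[of b]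
          by (simp add: add singular_chain_cmul)
      qed
      then have "\<phi> (\<Sum>b\<in>B p. frag_cmul (n b) b) = 0"
        using homology_basisD(1)[OF B] by blast
      moreover have "\<phi> (chain_boundary (Suc p) y) = 0"
        using \<phi>(1) y(1) by (simp add: mem_cocycles_iff)
      ultimately show ?thesis
        using add[OF ch[OF order_refl] singular_chain_boundary_alt[OF y(1)]] y(2) by simp
    qed
    then have "\<phi> \<in> ?D"
      using \<phi>(1) by (intro vanishing_on_cycles_imp_coboundary[OF B]) (auto simp: mem_cocycles_iff)
    then show "K = \<one>\<^bsub>?H\<^esub>"
      using subgroup.rcos_const[OF D Z.is_group]
      by (simp add: \<phi>(2) cls_def cohomology_group_def FactGroup_def)
  qed
qed

section \<open>Complements of coordinate subspaces\<close>

text \<open>The index type is left arbitrary so that a product of charts can be indexed by a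
  disjoint sum, and solving an equation for one coordinate just removes an index.\<close>

definition coord_space :: "'k set \<Rightarrow> ('k \<Rightarrow> complex) set" where
  "coord_space K = {v. \<forall>m. m \<notin> K \<longrightarrow> v m = 0}"

lemma homotopic_with_top_of_setI:
  fixes h :: "real \<times> 'a::topological_space \<Rightarrow> 'b::topological_space"
  assumes "continuous_on ({0..1} \<times> S) h" "\<And>s x. s \<in> {0..1} \<Longrightarrow> x \<in> S \<Longrightarrow> h (s, x) \<in> T"
    and "\<And>x. x \<in> S \<Longrightarrow> h (0, x) = f x" "\<And>x. x \<in> S \<Longrightarrow> h (1, x) = g x"
  shows "homotopic_with (\<lambda>x. True) (top_of_set S) (top_of_set T) f g"
proof -
  have "continuous_map (prod_topology (top_of_set {0..1}) (top_of_set S)) (top_of_set T) h"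
    using assms(1,2) by (simp flip: subtopology_Times) (auto simp: Pi_iff)
  then show ?thesis
    using assms(3,4) by (subst homotopic_with) auto
qed

lemma continuous_on_coordinate:
  "continuous_on (U :: ('k \<Rightarrow> 'b::topological_space) set) (\<lambda>v. v t)"
  by (rule continuous_on_subset[OF continuous_on_product_coordinates]) simp

lemma continuous_on_snd_coordinate:
  "continuous_on (A \<times> (B :: ('k \<Rightarrow> 'b::topological_space) set)) (\<lambda>x. snd x t)"
  by (rule continuous_on_product_then_coordinatewise[OF continuous_on_snd[OF continuous_on_id]])

lemma contractible_coord_space: "contractible_space (top_of_set (coord_space K))"
proof -
  have "continuous_on ({0..1} \<times> coord_space K) (\<lambda>(s :: real, v :: 'a \<Rightarrow> complex). \<lambda>t. of_real (1 - s) * v t)"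
    unfolding case_prod_unfold
    by (intro continuous_on_coordinatewise_then_product continuous_intros continuous_on_snd_coordinate)
  then have "homotopic_with (\<lambda>x. True) (top_of_set (coord_space K)) (top_of_set (coord_space K)) id (\<lambda>_ _. 0)"
    by (rule homotopic_with_top_of_setI) (auto simp: coord_space_def)
  then show ?thesis unfolding contractible_space_def by blast
qed

text \<open>The coordinates in \<open>J\<close> are normalised to length 1 and the others are
  contracted to 0; each complex coordinate gives two real ones, hence the dimension.\<close>

lemma punctured_coord_space_homotopy_sphere:
  fixes J K :: "'k set"
  assumes fin: "finite J" and ne: "J \<noteq> {}" and sub: "J \<subseteq> K"
  shows "nsphere (2 * card J - 1) homotopy_equivalent_space
    top_of_set (coord_space K \<inter> {v. \<exists>t\<in>J. v t \<noteq> 0})"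
proof -
  let ?c = "card J" and ?A = "coord_space K \<inter> {v. \<exists>t\<in>J. v t \<noteq> 0}"
  have c: "?c > 0" using fin ne by (simp add: card_gt_0_iff)
  obtain e where e: "bij_betw e J {..<?c}"
    using ex_bij_betw_finite_nat[OF fin] by (auto simp: atLeast0LessThan)
  define d where "d = inv_into J e"
  have de: "d (e t) = t" "e t < ?c" if "t \<in> J" for t
    using e that by (auto simp: d_def bij_betw_def)
  have ed: "e (d m) = m" "d m \<in> J" if "m < ?c" for m
    using e that by (auto simp: d_def bij_betw_def f_inv_into_f inv_into_into)
  let ?S = "{x :: nat \<Rightarrow> real. (\<Sum>i\<le>2 * ?c - 1. (x i)\<^sup>2) = 1 \<and> (\<forall>i>2 * ?c - 1. x i = 0)}"
  have sph: "nsphere (2 * ?c - 1) = top_of_set ?S"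
    by (simp add: nsphere euclidean_product_topology)
  have pairs: "(\<Sum>i\<le>2 * ?c - 1. h i) = (\<Sum>m<?c. h (2 * m) + h (2 * m + 1))" for h :: "nat \<Rightarrow> real"
  proof -
    have "{..2 * ?c - 1} = {..<2 * ?c}" using c by auto
    moreover have "(\<Sum>i<2 * n. h i) = (\<Sum>m<n. h (2 * m) + h (2 * m + 1))" for n
      by (induction n) auto
    ultimately show ?thesis by simp
  qed
  \<comment> \<open>\<open>e\<close> numbers \<open>J\<close>, and the real coordinates
    \<open>2 * m\<close> and \<open>2 * m + 1\<close> are the real and imaginary parts of the
    \<open>m\<close>-th complex one.\<close>
  define f where "f = (\<lambda>(x :: nat \<Rightarrow> real) t. if t \<in> J then Complex (x (2 * e t)) (x (2 * e t + 1)) else 0)"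
  define nrm where "nrm = (\<lambda>v :: 'k \<Rightarrow> complex. sqrt (\<Sum>t\<in>J. (cmod (v t))\<^sup>2))"
  define g where "g = (\<lambda>v i. if i < 2 * ?c then
      (if even i then Re (v (d (i div 2))) else Im (v (d (i div 2)))) / nrm v else (0::real))"
  have nrm_f: "nrm (f x) = 1" if "x \<in> ?S" for x
  proof -
    have "(\<Sum>t\<in>J. (cmod (f x t))\<^sup>2) = (\<Sum>t\<in>J. (x (2 * e t))\<^sup>2 + (x (2 * e t + 1))\<^sup>2)"
      by (rule sum.cong) (auto simp: f_def cmod_power2)
    also have "\<dots> = (\<Sum>m<?c. (x (2 * m))\<^sup>2 + (x (2 * m + 1))\<^sup>2)"
      by (rule sum.reindex_bij_betw[OF e])
    also have "\<dots> = 1" using that pairs[of "\<lambda>i. (x i)\<^sup>2"] by simp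
    finally show ?thesis by (simp add: nrm_def)
  qed
  have nrm_pos: "nrm v > 0" if "v \<in> ?A" for v
  proof -
    obtain t where t: "t \<in> J" "v t \<noteq> 0" using \<open>v \<in> ?A\<close> by auto
    have "0 < (\<Sum>t\<in>J. (cmod (v t))\<^sup>2)"
      by (rule sum_pos2[OF fin t(1)]) (use t in auto)
    then show ?thesis by (simp add: nrm_def)
  qed
  have f_A: "f x \<in> ?A" if "x \<in> ?S" for x
  proof -
    have "\<exists>t\<in>J. f x t \<noteq> 0"
    proof (rule ccontr)
      assume "\<not> ?thesis"
      then have "nrm (f x) = 0" by (simp add: nrm_def)
      then show False using nrm_f[OF that] by simp
    qed
    then show ?thesis using sub by (auto simp: coord_space_def f_def)
  qed
  have g_S: "g v \<in> ?S" if "v \<in> ?A" for v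
  proof -
    have "(\<Sum>i\<le>2 * ?c - 1. (g v i)\<^sup>2) = (\<Sum>m<?c. (cmod (v (d m)))\<^sup>2 / (nrm v)\<^sup>2)"
      unfolding pairs by (rule sum.cong) (auto simp: g_def cmod_power2 power_divide add_divide_distrib)
    also have "\<dots> = (\<Sum>m<?c. (cmod (v (d m)))\<^sup>2) / (nrm v)\<^sup>2"
      by (simp add: sum_divide_distrib)
    also have "(\<Sum>m<?c. (cmod (v (d m)))\<^sup>2) = (\<Sum>t\<in>J. (cmod (v t))\<^sup>2)"
      using sum.reindex_bij_betw[OF e, of "\<lambda>m. (cmod (v (d m)))\<^sup>2"] by (simp add: de)
    also have "\<dots> = (nrm v)\<^sup>2" by (simp add: nrm_def sum_nonneg)
    finally have "(\<Sum>i\<le>2 * ?c - 1. (g v i)\<^sup>2) = 1"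
      using nrm_pos[OF that] by simp
    moreover have "\<forall>i>2 * ?c - 1. g v i = 0" by (auto simp: g_def)
    ultimately show ?thesis by blast
  qed
  have gf: "g (f x) = x" if "x \<in> ?S" for x
  proof
    fix i show "g (f x) i = x i"
    proof (cases "i < 2 * ?c")
      case True
      then have "i div 2 < ?c" by auto
      then show ?thesis
        using True nrm_f[OF that] ed[of "i div 2"] by (auto simp: g_def f_def)
    next
      case False
      then show ?thesis using that c by (auto simp: g_def)
    qed
  qed
  have fg: "f (g v) t = (if t \<in> J then v t / of_real (nrm v) else 0)" for v t
  proof -
    have "2 * e t < 2 * ?c" "Suc (2 * e t) < 2 * ?c" if "t \<in> J"
      using de(2)[OF that] by auto
    then show ?thesis
      using de by (auto simp: f_def g_def complex_eq_iff)
  qed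
  have contf: "continuous_on ?S f"
  proof (rule continuous_on_coordinatewise_then_product)
    fix t show "continuous_on ?S (\<lambda>x. f x t)"
      by (cases "t \<in> J")
         (simp_all add: f_def Complex_eq continuous_on_add continuous_on_mult_left continuous_on_of_real
            continuous_on_coordinate)
  qed
  have coord: "continuous_on U (\<lambda>v. v t)" for U :: "('k \<Rightarrow> complex) set" and t
    by (rule continuous_on_coordinate)
  have contn: "continuous_on U nrm" for U
    unfolding nrm_def by (intro continuous_intros coord)
  have contg: "continuous_on ?A g"
  proof (rule continuous_on_coordinatewise_then_product)
    fix i
    have nz: "\<forall>v\<in>?A. nrm v \<noteq> 0" using nrm_pos by fastforce
    have "continuous_on ?A (\<lambda>v. Re (v (d (i div 2))) / nrm v)"
         "continuous_on ?A (\<lambda>v. Im (v (d (i div 2))) / nrm v)"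
      by (intro continuous_on_divide continuous_on_Re continuous_on_Im coord contn nz)+
    then show "continuous_on ?A (\<lambda>v. g v i)"
      by (cases "i < 2 * ?c"; cases "even i") (simp_all add: g_def)
  qed
  have "homotopic_with (\<lambda>x. True) (top_of_set ?A) (top_of_set ?A) (f \<circ> g) id"
  proof (rule homotopic_with_top_of_setI)
    \<comment> \<open>The straight-line homotopy multiplies the coordinates in \<open>J\<close> by a
      positive real number, so it never makes all of them vanish.\<close>
    let ?h = "\<lambda>(s :: real, v). \<lambda>t. of_real (1 - s) * f (g v) t + of_real s * v t"
    have nz: "nrm (snd x) \<noteq> 0" if "x \<in> {0..1} \<times> ?A" for x :: "real \<times> _"
      using nrm_pos[of "snd x"] mem_Times_iff[THEN iffD1, OF that] by simp
    have cn: "continuous_on ({0..1::real} \<times> ?A) (\<lambda>x. nrm (snd x))"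
      by (rule continuous_on_compose2[OF contn[of UNIV] continuous_on_snd[OF continuous_on_id]]) simp
    have "continuous_on ({0..1::real} \<times> ?A) (\<lambda>x. f (g (snd x)) t)" for t
    proof -
      have "\<forall>x\<in>{0..1::real} \<times> ?A. complex_of_real (nrm (snd x)) \<noteq> 0"
        by (intro ballI) (simp only: of_real_eq_0_iff nz not_False_eq_True)
      then have "continuous_on ({0..1::real} \<times> ?A) (\<lambda>x. snd x t / of_real (nrm (snd x)))"
        by (intro continuous_on_divide continuous_on_of_real continuous_on_snd_coordinate cn)
      then show ?thesis by (cases "t \<in> J") (simp_all add: fg)
    qed
    then show "continuous_on ({0..1} \<times> ?A) ?h"
      unfolding case_prod_unfold
      by (intro continuous_on_coordinatewise_then_product continuous_on_add continuous_on_mult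
            continuous_on_of_real continuous_on_diff continuous_on_const continuous_on_fst
            continuous_on_id continuous_on_snd_coordinate)
    fix s :: real and v assume s: "s \<in> {0..1}" and v: "v \<in> ?A"
    obtain t where t: "t \<in> J" "v t \<noteq> 0" using v by auto
    have "(1 - s) / nrm v + s > 0"
      using s nrm_pos[OF v] by (cases "s = 1") (auto intro!: add_pos_nonneg)
    moreover have "of_real (1 - s) * f (g v) t + of_real s * v t = of_real ((1 - s) / nrm v + s) * v t"
      using t by (simp add: fg algebra_simps)
    ultimately have "of_real (1 - s) * f (g v) t + of_real s * v t \<noteq> 0"
      using t(2) by (metis less_numeral_extra(3) mult_eq_0_iff of_real_eq_0_iff)
    then show "?h (s, v) \<in> ?A"
      using v sub t(1) by (auto simp: coord_space_def fg)
  qed auto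
  moreover have "homotopic_with (\<lambda>x. True) (top_of_set ?S) (top_of_set ?S) (g \<circ> f) id"
  proof (rule homotopic_with_equal)
    show "continuous_map (top_of_set ?S) (top_of_set ?S) (g \<circ> f)"
      by (rule continuous_map_eq[OF continuous_map_id]) (simp add: gf)
  qed (auto simp: gf)
  ultimately show ?thesis
    unfolding homotopy_equivalent_space_def sph
    using contf contg f_A g_S by (intro exI[of _ f] exI[of _ g]) (auto simp: Pi_iff)
qed

text \<open>As the whole space is contractible, the relative group is the reduced homology of a
  sphere, shifted by one degree. For \<open>J = {}\<close> the complement is empty, there is no
  sphere, and the group is the absolute homology of a contractible space.\<close>

theorem relative_homology_coord_space:
  fixes J K :: "'k set"
  assumes fin: "finite J" and sub: "J \<subseteq> K"
  shows "if p = 2 * int (card J)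
    then relative_homology_group p (top_of_set (coord_space K)) {v. \<exists>t\<in>J. v t \<noteq> 0} \<cong> integer_group
    else trivial_group (relative_homology_group p (top_of_set (coord_space K)) {v. \<exists>t\<in>J. v t \<noteq> 0})"
proof (cases "J = {}")
  case True
  let ?E = "top_of_set (coord_space K)"
  have ne: "topspace ?E \<noteq> {}" by (auto simp: coord_space_def)
  have "path_connected_space ?E"
    by (rule contractible_imp_path_connected_space[OF contractible_coord_space])
  from isomorphic_integer_zeroth_homology_group[OF this ne]
  have 0: "homology_group 0 ?E \<cong> integer_group" .
  have "trivial_group (homology_group p ?E)" if "p \<noteq> 0"
    using trivial_reduced_homology_group_contractible_space[OF contractible_coord_space[of K], of p]
      un_reduced_homology_group[OF that, of ?E] by simp
  with 0 True show ?thesis by simp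
next
  case False
  let ?E = "top_of_set (coord_space K)" and ?A = "{v. \<exists>t\<in>J. v t \<noteq> 0} :: ('k \<Rightarrow> complex) set"
  let ?n = "2 * card J - 1"
  have c: "card J > 0" using fin False by (simp add: card_gt_0_iff)
  obtain t where t: "t \<in> J" using False by blast
  have "(\<lambda>m. if m = t then 1 else 0) \<in> topspace ?E \<inter> ?A"
    using t sub by (auto simp: coord_space_def)
  then have "topspace ?E \<inter> ?A \<noteq> {}" by blast
  from isomorphic_group_relative_homology_of_contractible[OF contractible_coord_space this]
  have 1: "relative_homology_group p ?E ?A \<cong> reduced_homology_group (p - 1) (top_of_set (coord_space K \<inter> ?A))"
    by (simp add: subtopology_subtopology)
  have 2: "reduced_homology_group (p - 1) (nsphere ?n) \<cong>
      reduced_homology_group (p - 1) (top_of_set (coord_space K \<inter> ?A))"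
    by (rule homotopy_equivalent_space_imp_isomorphic_reduced_homology_groups
        [OF punctured_coord_space_homotopy_sphere[OF fin False sub]])
  have 3: "relative_homology_group p ?E ?A \<cong> reduced_homology_group (p - 1) (nsphere ?n)"
    using iso_trans[OF 1 group.iso_sym[OF _ 2]] by simp
  show ?thesis
  proof (cases "p = 2 * int (card J)")
    case True
    then have "p - 1 = int ?n" using c by auto
    then have "relative_homology_group p ?E ?A \<cong> integer_group"
      using reduced_homology_group_nsphere(1)[of ?n] by (intro iso_trans[OF 3]) simp
    then show ?thesis using True by simp
  next
    case False
    then have "p - 1 \<noteq> int ?n" using c by auto
    from reduced_homology_group_nsphere(2)[OF this] False show ?thesis
      using isomorphic_group_triviality[OF 3] by simp
  qed
qed

section \<open>Homology of a space with cell charts\<close>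

text \<open>\<open>g\<close> parametrises the open set \<open>W\<close> with inverse \<open>x\<close>; the stratum \<open>S\<close> in \<open>W\<close> is where
  the coordinates indexed by \<open>J\<close> vanish, so its complex codimension is \<open>card J\<close>.\<close>

definition cell_chart ::
  "'x topology \<Rightarrow> 'x set \<Rightarrow> 'x set \<Rightarrow> 'k set \<Rightarrow> 'k set \<Rightarrow> (('k \<Rightarrow> complex) \<Rightarrow> 'x) \<Rightarrow> ('x \<Rightarrow> 'k \<Rightarrow> complex) \<Rightarrow> bool"
  where
  "cell_chart X W S K J g x \<longleftrightarrow> finite K \<and> J \<subseteq> K \<and> openin X W \<and> S \<subseteq> W \<and>
     homeomorphic_maps (top_of_set (coord_space K)) (subtopology X W) g x \<and>
     (\<forall>v\<in>coord_space K. g v \<in> S \<longleftrightarrow> (\<forall>t\<in>J. v t = 0))"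

lemma cell_chart_subtopology:
  assumes "cell_chart X W S K J g x" "openin X U" "W \<subseteq> U"
  shows "cell_chart (subtopology X U) W S K J g x"
  using assms
  by (auto simp: cell_chart_def subtopology_subtopology openin_open_subtopology inf.absorb2)

text \<open>The set excised is the complement of \<open>W\<close>: it is closed, and it lies in the
  open set \<open>U\<close> because \<open>S \<subseteq> W\<close>. What remains is transported to
  the coordinate space by the chart.\<close>

lemma relative_homology_cell_complement:
  assumes chart: "cell_chart X W S K J g x" and op: "openin X U" and U: "U = topspace X - S"
  shows "if p = 2 * int (card J) then relative_homology_group p X U \<cong> integer_group
    else trivial_group (relative_homology_group p X U)"
proof -
  let ?E = "top_of_set (coord_space K)" and ?A = "{v. \<exists>t\<in>J. v t \<noteq> 0}"
  have W: "openin X W" "S \<subseteq> W" "W \<subseteq> topspace X" and JK: "finite J" "J \<subseteq> K"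
    and hm: "homeomorphic_maps ?E (subtopology X W) g x"
    and gS: "\<And>v. v \<in> coord_space K \<Longrightarrow> g v \<in> S \<longleftrightarrow> (\<forall>t\<in>J. v t = 0)"
    using chart by (auto simp: cell_chart_def openin_subset finite_subset)
  have hom: "homeomorphic_map ?E (subtopology X W) g"
    using hm homeomorphic_maps_map by blast
  have "X closure_of (topspace X - W) \<subseteq> X interior_of U"
    using W op U by (simp add: closure_of_closedin closedin_diff interior_of_openin) blast
  from homology_excision_axiom[OF this, of "topspace X" p]
  have exc: "hom_induced p (subtopology X (topspace X - (topspace X - W))) (U - (topspace X - W))
        (subtopology X (topspace X)) U id
      \<in> iso (relative_homology_group p (subtopology X (topspace X - (topspace X - W))) (U - (topspace X - W)))
          (relative_homology_group p (subtopology X (topspace X)) U)"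
    using U by blast
  have sets: "topspace X - (topspace X - W) = W" "U - (topspace X - W) = W - S"
    using W(3) U by auto
  have 1: "relative_homology_group p (subtopology X W) (W - S) \<cong> relative_homology_group p X U"
    using is_isoI[OF exc] unfolding sets by simp
  have im: "g ` coord_space K = W"
    using homeomorphic_imp_surjective_map[OF hom] W(3) by auto
  have "g ` (coord_space K \<inter> ?A) = W - S"
    using gS im by auto
  from is_isoI[OF homeomorphic_map_relative_homology_iso[OF hom _ this, of p]]
  have 2: "relative_homology_group p ?E (coord_space K \<inter> ?A) \<cong> relative_homology_group p (subtopology X W) (W - S)"
    by simp
  have "relative_homology_group p ?E (coord_space K \<inter> ?A) = relative_homology_group p ?E ?A"
    using relative_homology_group_restrict[of p ?E ?A] by simp
  then have 3: "relative_homology_group p ?E ?A \<cong> relative_homology_group p X U"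
    using iso_trans[OF 2 1] by simp
  then have 4: "relative_homology_group p X U \<cong> relative_homology_group p ?E ?A"
    by (simp add: group.iso_sym)
  show ?thesis
    using relative_homology_coord_space[OF JK, of p] iso_trans[OF 4, of integer_group]
      isomorphic_group_triviality[OF 3] by (auto split: if_splits)
qed

text \<open>A stratum of maximal rank is removed. Any other chart meeting it would have still larger
  rank, so the remaining charts cover exactly its complement, which is therefore open and falls
  under the induction hypothesis. The rank condition also forces distinct strata to be disjoint,
  since each lies in its own chart.\<close>

theorem homology_basis_of_cell_charts:
  assumes "finite I" "\<And>c. c \<in> I \<Longrightarrow> cell_chart X (W c) (S c) (K c) (J c) (g c) (x c)"
    and "topspace X = (\<Union>c\<in>I. S c)"
    and "\<And>c d. c \<in> I \<Longrightarrow> d \<in> I \<Longrightarrow> c \<noteq> d \<Longrightarrow> S d \<inter> W c \<noteq> {} \<Longrightarrow> rk d < (rk c :: nat)"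
  shows "\<exists>B. homology_basis q X {} B \<and> card B = card {c \<in> I. 2 * card (J c) = q}"
  using assms
proof (induction "card I" arbitrary: I X q)
  case 0
  then have "I = {}" and "topspace X = {}" by auto
  then show ?case
    using homology_basis_empty[OF trivial_homology_group_empty, of X q] by auto
next
  case (Suc n)
  then have "finite I" "I \<noteq> {}" by auto
  have "Max (rk ` I) \<in> rk ` I"
    using \<open>finite I\<close> \<open>I \<noteq> {}\<close> by (intro Max_in) auto
  then obtain m where m: "m \<in> I" and mx: "Max (rk ` I) = rk m" by auto
  have max: "rk c \<le> rk m" if "c \<in> I" for c
    using that \<open>finite I\<close> by (simp flip: mx)
  define I' where "I' = I - {m}"
  have I: "I = insert m I'" "m \<notin> I'" "finite I'" "card I' = n"
    using m Suc.hyps(2) \<open>finite I\<close> by (auto simp: I'_def)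
  have disj: "W c \<inter> S m = {}" if "c \<in> I'" for c
    using Suc.prems(4)[of c m] max[of c] that m I by force
  have sub: "S c \<subseteq> W c" "openin X (W c)" if "c \<in> I" for c
    using Suc.prems(2)[OF that] by (auto simp: cell_chart_def)
  define U where "U = (\<Union>c\<in>I'. W c)"
  have op: "openin X U" unfolding U_def using sub I by auto
  have U: "U = topspace X - S m"
  proof
    show "U \<subseteq> topspace X - S m"
      using disj openin_subset[OF op] by (auto simp: U_def)
    show "topspace X - S m \<subseteq> U"
      using Suc.prems(3) sub(1) I by (auto simp: U_def)
  qed
  have US: "U = (\<Union>c\<in>I'. S c)"
    using disj sub(1) Suc.prems(3) U I by fastforce
  have IH: "\<exists>B. homology_basis q (subtopology X U) {} B \<and> card B = card {c \<in> I'. 2 * card (J c) = q}" for q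
  proof (rule Suc.hyps(1))
    show "n = card I'" "finite I'" using I by auto
    show "cell_chart (subtopology X U) (W c) (S c) (K c) (J c) (g c) (x c)" if "c \<in> I'" for c
      using that I by (intro cell_chart_subtopology Suc.prems op) (auto simp: U_def)
    show "topspace (subtopology X U) = (\<Union>c\<in>I'. S c)"
      using US openin_subset[OF op] by auto
    show "rk d < rk c" if "c \<in> I'" "d \<in> I'" "c \<noteq> d" "S d \<inter> W c \<noteq> {}" for c d
      using Suc.prems(4)[of c d] that I by auto
  qed
  note rel = relative_homology_cell_complement[OF Suc.prems(2)[OF m] op U]
  have triv: "homology_basis q X U {}" if "q \<noteq> 2 * card (J m)" for q
    using rel[of "int q"] that by (intro homology_basis_empty) auto
  \<comment> \<open>Supplies the vanishing one degree below the even degree of the new generator,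
    which allows that generator to be lifted.\<close>
  have odd_empty: "homology_basis q (subtopology X U) {} {}" if "odd q" for q
  proof -
    obtain B where B: "homology_basis q (subtopology X U) {} B" "card B = card {c \<in> I'. 2 * card (J c) = q}"
      using IH by blast
    have none: "{c \<in> I'. 2 * card (J c) = q} = {}" using that by auto
    then have "B = {}" using homology_basisD(1)[OF B(1)] B(2) unfolding none by simp
    then show ?thesis using B by simp
  qed
  obtain B where B: "homology_basis q (subtopology X U) {} B" "card B = card {c \<in> I'. 2 * card (J c) = q}"
    using IH by blast
  show ?case
  proof (cases "q = 2 * card (J m)")
    case True
    then have "relative_homology_group (int q) X U \<cong> integer_group"
      using rel[of "int q"] by simp
    then obtain r where r: "homology_basis q X U {r}"
      by (rule homology_basis_singleton)
    have "homology_basis (Suc q) X U {}" using True by (intro triv) presburger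
    moreover have "q = 0 \<or> homology_basis (q - 1) (subtopology X U) {} {}"
      using True odd_empty[of "q - 1"] by (cases "q = 0") auto
    ultimately obtain r' where r': "r' \<notin> B" "homology_basis q X {} (insert r' B)"
      using homology_basis_extend_generator[OF B(1) r] by metis
    have "{c \<in> I. 2 * card (J c) = q} = insert m {c \<in> I'. 2 * card (J c) = q}"
      using True I by auto
    then have "card (insert r' B) = card {c \<in> I. 2 * card (J c) = q}"
      using B I r' homology_basisD(1)[OF B(1)] by simp
    then show ?thesis using r' by blast
  next
    case False
    have "homology_basis (Suc q) X U {} \<or> B = {}"
    proof (cases "even q")
      case True
      then show ?thesis by (intro disjI1 triv) presburger
    next
      case False
      then have "{c \<in> I'. 2 * card (J c) = q} = {}" by auto
      then show ?thesis using homology_basisD(1)[OF B(1)] B(2) by (metis card_0_eq card.empty)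
    qed
    then have "homology_basis q X {} B"
      by (rule homology_basis_extend_trivial[OF B(1) triv[OF False]])
    moreover have "{c \<in> I. 2 * card (J c) = q} = {c \<in> I'. 2 * card (J c) = q}"
      using False I by auto
    ultimately show ?thesis using B by metis
  qed
qed

corollary betti_of_cell_charts:
  assumes "finite I" "\<And>c. c \<in> I \<Longrightarrow> cell_chart X (W c) (S c) (K c) (J c) (g c) (x c)"
    and "topspace X = (\<Union>c\<in>I. S c)"
    and "\<And>c d. c \<in> I \<Longrightarrow> d \<in> I \<Longrightarrow> c \<noteq> d \<Longrightarrow> S d \<inter> W c \<noteq> {} \<Longrightarrow> rk d < (rk c :: nat)"
  shows "betti (2 * k) X = enat (card {c \<in> I. card (J c) = k})"
proof -
  define B where "B = (\<lambda>q. SOME B. homology_basis q X {} B \<and> card B = card {c \<in> I. 2 * card (J c) = q})"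
  have B: "homology_basis q X {} (B q) \<and> card (B q) = card {c \<in> I. 2 * card (J c) = q}" for q
    unfolding B_def by (rule someI_ex[OF homology_basis_of_cell_charts[OF assms]])
  have "betti (2 * k) X = enat (card (B (2 * k)))"
    using B by (intro betti_eq_card_homology_basis) blast
  then show ?thesis using B[of "2 * k"] by simp
qed

section \<open>Incidence hypersurfaces\<close>

lemma cell_chart_prod:
  assumes c1: "cell_chart Y W S K J g x" and c2: "cell_chart Y' W' S' K' J' g' x'"
  shows "cell_chart (prod_topology Y Y') (W \<times> W') (S \<times> S') (K <+> K') (J <+> J')
    (\<lambda>v. (g (\<lambda>m. v (Inl m)), g' (\<lambda>m. v (Inr m)))) (\<lambda>(l, l'). case_sum (x l) (x' l'))"
proof -
  let ?A = "coord_space K" and ?B = "coord_space K'" and ?C = "coord_space (K <+> K')"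
  let ?f = "\<lambda>(a, b). case_sum a b" and ?h = "\<lambda>v. (\<lambda>m. v (Inl m), \<lambda>m. v (Inr m))"
  have hm: "homeomorphic_maps (top_of_set ?A) (subtopology Y W) g x"
      "homeomorphic_maps (top_of_set ?B) (subtopology Y' W') g' x'"
    using c1 c2 by (auto simp: cell_chart_def)
  have mem: "v \<in> ?C \<longleftrightarrow> (\<lambda>m. v (Inl m)) \<in> ?A \<and> (\<lambda>m. v (Inr m)) \<in> ?B" for v :: "_ \<Rightarrow> complex"
  proof -
    have "v \<in> ?C \<longleftrightarrow> (\<forall>m. m \<notin> K \<longrightarrow> v (Inl m) = 0) \<and> (\<forall>m. m \<notin> K' \<longrightarrow> v (Inr m) = 0)"
      unfolding coord_space_def mem_Collect_eq by (metis InlI InrI PlusE sum.exhaust Inl_inject Inr_inject sum.distinct(1))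
    then show ?thesis by (simp add: coord_space_def)
  qed
  have A: "homeomorphic_maps (prod_topology (top_of_set ?A) (top_of_set ?B))
      (prod_topology (subtopology Y W) (subtopology Y' W')) (\<lambda>(a, b). (g a, g' b)) (\<lambda>(l, l'). (x l, x' l'))"
    unfolding homeomorphic_maps_prod using hm by blast
  have B: "homeomorphic_maps (top_of_set ?C) (prod_topology (top_of_set ?A) (top_of_set ?B)) ?h ?f"
  proof -
    have "continuous_on ?C ?h"
      by (intro continuous_on_Pair continuous_on_coordinatewise_then_product continuous_on_coordinate)
    moreover have "continuous_on (?A \<times> ?B) (\<lambda>p. ?f p t)" for t
    proof (cases t)
      case (Inl m)
      have "continuous_on (?A \<times> ?B) (\<lambda>p. fst p m)"
        by (rule continuous_on_product_then_coordinatewise[OF continuous_on_fst[OF continuous_on_id]])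
      then show ?thesis by (simp add: Inl case_prod_unfold)
    next
      case (Inr m)
      then show ?thesis by (simp add: case_prod_unfold continuous_on_snd_coordinate)
    qed
    then have "continuous_on (?A \<times> ?B) ?f"
      by (rule continuous_on_coordinatewise_then_product)
    ultimately show ?thesis
      by (auto simp: homeomorphic_maps_def mem simp flip: subtopology_Times split: sum.split)
  qed
  have "homeomorphic_maps (top_of_set ?C) (prod_topology (subtopology Y W) (subtopology Y' W'))
      ((\<lambda>(a, b). (g a, g' b)) \<circ> ?h) (?f \<circ> (\<lambda>(l, l'). (x l, x' l')))"
    by (rule homeomorphic_maps_compose[OF conjI[OF B A]])
  moreover have "(\<lambda>(a, b). (g a, g' b)) \<circ> ?h = (\<lambda>v. (g (\<lambda>m. v (Inl m)), g' (\<lambda>m. v (Inr m))))"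
    "?f \<circ> (\<lambda>(l, l'). (x l, x' l')) = (\<lambda>(l, l'). case_sum (x l) (x' l'))"
    by auto
  ultimately show ?thesis
    using c1 c2 mem
    by (simp add: cell_chart_def subtopology_Times openin_prod_Times_iff)
       (auto simp: Plus_def)
qed

text \<open>In the chart the hypersurface is the graph of \<open>F\<close> over the coordinates
  other than \<open>t\<close>. If \<open>v t = 0\<close> is one of the conditions of the stratum,
  \<open>van\<close> makes it follow from the others, so that on the graph the stratum is again a
  coordinate subspace.\<close>

lemma cell_chart_graph:
  assumes chart: "cell_chart Z W S M J g x" and t: "t \<in> M"
    and F: "continuous_on (coord_space M) F"
    and indep: "\<And>v y. v \<in> coord_space M \<Longrightarrow> F (v(t := y)) = F v"
    and H: "\<And>v. v \<in> coord_space M \<Longrightarrow> g v \<in> H \<longleftrightarrow> v t = F v"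
    and van: "\<And>v. t \<in> J \<Longrightarrow> v \<in> coord_space M \<Longrightarrow> (\<And>m. m \<in> J - {t} \<Longrightarrow> v m = 0) \<Longrightarrow> F v = 0"
  shows "cell_chart (subtopology Z H) (W \<inter> H) (S \<inter> H) (M - {t}) (J - {t})
    (\<lambda>u. g (u(t := F u))) (\<lambda>p. (x p)(t := 0))"
proof -
  let ?A = "coord_space (M - {t})" and ?C = "coord_space M"
  have hm: "homeomorphic_maps (top_of_set ?C) (subtopology Z W) g x"
    and W: "openin Z W" "W \<subseteq> topspace Z" "S \<subseteq> W"
    and gS: "\<And>v. v \<in> ?C \<Longrightarrow> g v \<in> S \<longleftrightarrow> (\<forall>t\<in>J. v t = 0)"
    using chart by (auto simp: cell_chart_def openin_subset)
  have g: "continuous_map (top_of_set ?C) (subtopology Z W) g"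
    and x: "continuous_map (subtopology Z W) (top_of_set ?C) x"
    and xg: "\<And>v. v \<in> ?C \<Longrightarrow> x (g v) = v" and gx: "\<And>p. p \<in> W \<Longrightarrow> g (x p) = p"
    using hm W(2) by (auto simp: homeomorphic_maps_def)
  have gW: "g v \<in> W" if "v \<in> ?C" for v
    using continuous_map_image_subset_topspace[OF g] that by auto
  have xC: "x p \<in> ?C" if "p \<in> W" for p
    using continuous_map_image_subset_topspace[OF x] that W(2) by auto
  have AC: "?A \<subseteq> ?C" by (auto simp: coord_space_def)
  have upd: "u(t := y) \<in> ?C" if "u \<in> ?C" for u y
    using that t by (auto simp: coord_space_def)
  have upd0: "u(t := 0) \<in> ?A" if "u \<in> ?C" for u
    using that by (auto simp: coord_space_def)
  have graph: "g (u(t := F u)) \<in> H" if "u \<in> ?C" for u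
    using H[OF upd[OF that]] indep[OF that] by simp
  have "homeomorphic_maps (top_of_set ?A) (subtopology (subtopology Z H) (W \<inter> H))
      (\<lambda>u. g (u(t := F u))) (\<lambda>p. (x p)(t := 0))"
    unfolding homeomorphic_maps_def
  proof (intro conjI ballI)
    have "continuous_on ?A (\<lambda>u. (u(t := F u)) m)" for m
      using continuous_on_subset[OF F AC]
      by (cases "m = t") (simp_all add: continuous_on_coordinate)
    then have "continuous_on ?A (\<lambda>u. u(t := F u))"
      by (rule continuous_on_coordinatewise_then_product)
    then have "continuous_map (top_of_set ?A) (top_of_set ?C) (\<lambda>u. u(t := F u))"
      using upd AC by auto
    from continuous_map_compose[OF this g]
    have "continuous_map (top_of_set ?A) (subtopology Z W) (\<lambda>u. g (u(t := F u)))"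
      by (simp add: o_def)
    then show "continuous_map (top_of_set ?A) (subtopology (subtopology Z H) (W \<inter> H)) (\<lambda>u. g (u(t := F u)))"
      using graph AC by (auto simp: continuous_map_in_subtopology)
  next
    have "continuous_on ?C (\<lambda>u. (u(t := 0)) m)" for m
      by (cases "m = t") (simp_all add: continuous_on_coordinate)
    then have "continuous_on ?C (\<lambda>u. u(t := 0))"
      by (rule continuous_on_coordinatewise_then_product)
    then have "continuous_map (top_of_set ?C) (top_of_set ?A) (\<lambda>u. u(t := 0))"
      using upd0 by auto
    from continuous_map_compose[OF x this]
    have "continuous_map (subtopology Z W) (top_of_set ?A) (\<lambda>p. (x p)(t := 0))"
      by (simp add: o_def)
    then have "continuous_map (subtopology (subtopology Z W) H) (top_of_set ?A) (\<lambda>p. (x p)(t := 0))"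
      by (rule continuous_map_from_subtopology)
    moreover have "subtopology (subtopology Z H) (W \<inter> H) = subtopology (subtopology Z W) H"
      by (simp add: subtopology_subtopology Int_ac)
    ultimately show "continuous_map (subtopology (subtopology Z H) (W \<inter> H)) (top_of_set ?A) (\<lambda>p. (x p)(t := 0))"
      by simp
  next
    fix u assume "u \<in> topspace (top_of_set ?A)"
    then have "u \<in> ?A" by simp
    then have "x (g (u(t := F u))) = u(t := F u)" using xg upd AC by blast
    moreover have "u t = 0" using \<open>u \<in> ?A\<close> by (auto simp: coord_space_def)
    ultimately show "(x (g (u(t := F u))))(t := 0) = u" by auto
  next
    fix p assume "p \<in> topspace (subtopology (subtopology Z H) (W \<inter> H))"
    then have p: "p \<in> W" "p \<in> H" by auto
    then have "x p t = F (x p)" using H[OF xC[OF p(1)]] gx[OF p(1)] by simp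
    moreover have "F ((x p)(t := 0)) = F (x p)" by (rule indep[OF xC[OF p(1)]])
    ultimately have "((x p)(t := 0))(t := F ((x p)(t := 0))) = x p" by auto
    then show "g (((x p)(t := 0))(t := F ((x p)(t := 0)))) = p" using gx p by simp
  qed
  moreover have "g (u(t := F u)) \<in> S \<inter> H \<longleftrightarrow> (\<forall>m\<in>J - {t}. u m = 0)" if "u \<in> ?A" for u
  proof -
    have u: "u \<in> ?C" using that AC by blast
    have "g (u(t := F u)) \<in> S \<inter> H \<longleftrightarrow> (\<forall>m\<in>J. (u(t := F u)) m = 0)"
      using gS[OF upd[OF u]] graph[OF u] by simp
    also have "\<dots> \<longleftrightarrow> (\<forall>m\<in>J - {t}. u m = 0)"
      using van[OF _ u] by (auto split: if_splits)
    finally show ?thesis .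
  qed
  ultimately show ?thesis
    using chart by (auto simp: cell_chart_def openin_subtopology)
qed

text \<open>A chart with a lift \<open>z\<close> of the line \<open>lam l \<subseteq> \<complex>\<^sup>n\<^sup>+\<^sup>1\<close> to homogeneous coordinates, normalised at the
  pivot \<open>P\<close>. The entries above the pivot are free coordinates of the chart and do not influence
  the other entries, which is why the incidence equation can be solved for one of them.\<close>

definition line_chart ::
  "'y topology \<Rightarrow> ('y \<Rightarrow> (nat \<Rightarrow> complex) set) \<Rightarrow> nat \<Rightarrow> 'y set \<Rightarrow> 'y set \<Rightarrow> nat set \<Rightarrow> nat set \<Rightarrow>
    ((nat \<Rightarrow> complex) \<Rightarrow> 'y) \<Rightarrow> ('y \<Rightarrow> nat \<Rightarrow> complex) \<Rightarrow> ((nat \<Rightarrow> complex) \<Rightarrow> nat \<Rightarrow> complex) \<Rightarrow> nat \<Rightarrow> bool"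
  where
  "line_chart Y lam n W S K J g x z P \<longleftrightarrow> cell_chart Y W S K J g x \<and> P \<le> n \<and> {P<..n} \<subseteq> K \<and>
     continuous_on (coord_space K) z \<and>
     (\<forall>v\<in>coord_space K. cspan (z v) = lam (g v) \<and> z v P = 1 \<and> (\<forall>m\<in>{P<..n}. z v m = v m)) \<and>
     (\<forall>v\<in>coord_space K. \<forall>v'\<in>coord_space K.
        (\<forall>m. m \<notin> {P<..n} \<longrightarrow> v m = v' m) \<longrightarrow> (\<forall>m<P. z v m = z v' m))"

lemma line_chartD:
  assumes "line_chart Y lam n W S K J g x z P"
  shows "cell_chart Y W S K J g x" "P \<le> n" "{P<..n} \<subseteq> K" "continuous_on (coord_space K) z"
    and "v \<in> coord_space K \<Longrightarrow> cspan (z v) = lam (g v)" "v \<in> coord_space K \<Longrightarrow> z v P = 1"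
    and "v \<in> coord_space K \<Longrightarrow> P < m \<Longrightarrow> m \<le> n \<Longrightarrow> z v m = v m"
  using assms by (auto simp: line_chart_def)

text \<open>A coordinate above the pivot influences only the entry with its own index. Hence the
  terms of the incidence sum other than the one solved for do not involve the unknown.\<close>

lemma line_chart_indep:
  assumes c: "line_chart Y lam n W S K J g x z P" and v: "v \<in> coord_space K" "v' \<in> coord_space K"
    and t: "P < t" "t \<le> n" and eq: "\<And>m. m \<noteq> t \<Longrightarrow> v m = v' m" and m: "m \<noteq> t" "m \<le> n"
  shows "z v m = z v' m"
proof -
  consider "m < P" | "m = P" | "P < m" by linarith
  then show ?thesis
  proof cases
    case 1
    have "v m = v' m" if "m \<notin> {P<..n}" for m
      by (rule eq) (use that t in auto)
    moreover have "\<forall>v\<in>coord_space K. \<forall>v'\<in>coord_space K.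
        (\<forall>m. m \<notin> {P<..n} \<longrightarrow> v m = v' m) \<longrightarrow> (\<forall>m<P. z v m = z v' m)"
      using c unfolding line_chart_def by (elim conjE)
    ultimately show ?thesis using v 1 by blast
  next
    case 2
    then show ?thesis using line_chartD(6)[OF c] v by simp
  next
    case 3
    then show ?thesis using line_chartD(7)[OF c] v m eq[OF m(1)] by simp
  qed
qed

section \<open>Solving the incidence equation in product charts\<close>

definition incidence ::
  "nat \<Rightarrow> nat \<Rightarrow> ('y \<Rightarrow> (nat \<Rightarrow> complex) set) \<Rightarrow> ('y' \<Rightarrow> (nat \<Rightarrow> complex) set) \<Rightarrow> ('y \<times> 'y') set" where
  "incidence i j lam lam' = {(l, l'). \<exists>z w. cspan z = lam l \<and> cspan w = lam' l' \<and>
     (\<Sum>k = 0..min i j. z (i - k) * w (j - k)) = 0}"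

lemma incidence_iff:
  assumes "cspan z = lam l" "cspan w = lam' l'"
  shows "(l, l') \<in> incidence i j lam lam' \<longleftrightarrow> (\<Sum>k = 0..min i j. z (i - k) * w (j - k)) = 0"
  using assms incidence_homogeneous[of _ z _ w i j] by (auto simp: incidence_def)

text \<open>On the first stratum the entries of \<open>z\<close> below \<open>P\<close> vanish
  (\<open>low\<close>), while those above are not among the conditions (\<open>J\<close>). On the
  second the entries of \<open>z'\<close> above \<open>P'\<close> are among the conditions
  (\<open>J'\<close>). So on the product stratum a term with index \<open>k\<close> can be nonzero
  only for \<open>j - P' \<le> k\<close> and \<open>k \<le> i - P\<close>.\<close>

locale incidence_charts =
  fixes Y :: "'y topology" and Y' :: "'y' topology" and lam lam' i j
    and W S K J g x z P and W' S' K' J' g' x' z' P'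
  assumes c: "line_chart Y lam i W S K J g x z P" and c': "line_chart Y' lam' j W' S' K' J' g' x' z' P'"
    and J: "J \<inter> {P<..i} = {}" and J': "{P'<..j} \<subseteq> J'"
    and low: "\<And>v m. v \<in> coord_space K \<Longrightarrow> (\<And>t. t \<in> J \<Longrightarrow> v t = 0) \<Longrightarrow> m < P \<Longrightarrow> z v m = 0"
begin

abbreviation "M \<equiv> K <+> K'"
abbreviation "lft v \<equiv> (\<lambda>m. v (Inl m))"
abbreviation "rgt v \<equiv> (\<lambda>m. v (Inr m))"
abbreviation "G \<equiv> (\<lambda>v. (g (lft v), g' (rgt v)))"
abbreviation "term v k \<equiv> z (lft v) (i - k) * z' (rgt v) (j - k)"
abbreviation "others r v \<equiv> - (\<Sum>k\<in>{0..min i j} - {r}. term v k)"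

lemma lft_rgt: assumes "v \<in> coord_space M" shows "lft v \<in> coord_space K" "rgt v \<in> coord_space K'"
  using assms by (auto simp: coord_space_def)

lemma G_incidence:
  assumes v: "v \<in> coord_space M"
  shows "G v \<in> incidence i j lam lam' \<longleftrightarrow> (\<Sum>k = 0..min i j. term v k) = 0"
  by (rule incidence_iff) (use line_chartD(5)[OF c] line_chartD(5)[OF c'] lft_rgt[OF v] in auto)

lemma G_incidence_split:
  assumes v: "v \<in> coord_space M" and r: "r \<le> min i j"
  shows "G v \<in> incidence i j lam lam' \<longleftrightarrow> term v r = others r v"
  unfolding G_incidence[OF v] using r by (simp add: sum.remove[of _ r] eq_neg_iff_add_eq_0)

lemma continuous_others: "continuous_on (coord_space M) (others r)"
proof -
  have lr: "continuous_on (coord_space M) lft" "continuous_on (coord_space M) rgt"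
    by (intro continuous_on_coordinatewise_then_product continuous_on_coordinate)+
  then have "continuous_on (coord_space M) (\<lambda>v. z (lft v))" "continuous_on (coord_space M) (\<lambda>v. z' (rgt v))"
    using lft_rgt
    by (auto intro!: continuous_on_compose2[OF line_chartD(4)[OF c] lr(1)]
        continuous_on_compose2[OF line_chartD(4)[OF c'] lr(2)])
  then have "continuous_on (coord_space M) (\<lambda>v. term v k)" for k
    by (rule continuous_on_mult[OF continuous_on_product_then_coordinatewise
          continuous_on_product_then_coordinatewise])
  then show ?thesis by (intro continuous_on_minus continuous_on_sum)
qed

lemma lower_terms_vanish:
  assumes v: "v \<in> coord_space M" and Jv: "\<And>t. t \<in> J \<Longrightarrow> v (Inl t) = 0"
    and k: "i - P < k" "k \<le> i"
  shows "term v k = 0"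
  using low[OF lft_rgt(1)[OF v], of "i - k"] Jv k by simp

lemma upper_terms_vanish:
  assumes v: "v \<in> coord_space M" and "v (Inr (j - k)) = 0" and k: "k < j - P'"
  shows "term v k = 0"
  using line_chartD(7)[OF c' lft_rgt(2)[OF v], of "j - k"] assms by simp

text \<open>The range of possibly nonzero terms shrinks to the single index \<open>i - P\<close>,
  where both factors are pivots and the term is 1.\<close>

lemma stratum_disjoint:
  assumes eq: "i - P = j - P'"
  shows "(S \<times> S') \<inter> incidence i j lam lam' = {}"
proof -
  let ?s = "i - P"
  have le: "P \<le> i" "P' \<le> j" using line_chartD(2)[OF c] line_chartD(2)[OF c'] .
  then have s: "?s \<le> min i j" "i - ?s = P" "j - ?s = P'" using eq by auto
  have prod: "cell_chart (prod_topology Y Y') (W \<times> W') (S \<times> S') M (J <+> J') G (\<lambda>(l, l'). case_sum (x l) (x' l'))"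
    by (rule cell_chart_prod[OF line_chartD(1)[OF c] line_chartD(1)[OF c']])
  have "p \<notin> incidence i j lam lam'" if p: "p \<in> S \<times> S'" for p
  proof -
    have hm: "homeomorphic_maps (top_of_set (coord_space M)) (subtopology (prod_topology Y Y') (W \<times> W'))
        G (\<lambda>(l, l'). case_sum (x l) (x' l'))"
      and pW: "p \<in> W \<times> W'" and oW: "openin (prod_topology Y Y') (W \<times> W')"
      using prod p unfolding cell_chart_def by blast+
    have "homeomorphic_map (top_of_set (coord_space M)) (subtopology (prod_topology Y Y') (W \<times> W')) G"
      using hm homeomorphic_maps_map by blast
    from homeomorphic_imp_surjective_map[OF this] openin_subset[OF oW]
    have "G ` coord_space M = W \<times> W'" by auto
    with pW have "p \<in> G ` coord_space M" by simp
    then obtain v where v: "v \<in> coord_space M" "p = G v" by blast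
    have "\<forall>v\<in>coord_space M. G v \<in> S \<times> S' \<longleftrightarrow> (\<forall>t\<in>J <+> J'. v t = 0)"
      using prod unfolding cell_chart_def by (elim conjE)
    from bspec[OF this v(1)] have "G v \<in> S \<times> S' \<longleftrightarrow> (\<forall>t\<in>J <+> J'. v t = 0)" .
    then have Jv: "\<And>t. t \<in> J \<Longrightarrow> v (Inl t) = 0" "\<And>t. t \<in> J' \<Longrightarrow> v (Inr t) = 0"
      using p v(2) by blast+
    have tz: "term v k = 0" if "k \<in> {0..min i j} - {?s}" for k
    proof (cases "k < ?s")
      case True
      then have "j - k \<in> {P'<..j}" using eq by auto
      then have "v (Inr (j - k)) = 0" using J' Jv(2) by blast
      then show ?thesis using True eq by (intro upper_terms_vanish[OF v(1)]) auto
    next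
      case False
      then show ?thesis using that by (intro lower_terms_vanish[OF v(1) Jv(1)]) auto
    qed
    have "(\<Sum>k\<in>{0..min i j} - {?s}. term v k) = 0" by (intro sum.neutral ballI tz)
    then have "others ?s v = 0" by simp
    moreover have "term v ?s = 1"
      using s line_chartD(6)[OF c] line_chartD(6)[OF c'] lft_rgt[OF v(1)] by simp
    ultimately show ?thesis using G_incidence_split[OF v(1) s(1)] v(2) by simp
  qed
  then show ?thesis by blast
qed

text \<open>At the smaller of the two pivot distances one factor of the term is a pivot, hence 1,
  and the other lies above its own pivot, hence is the coordinate \<open>t\<close>. So the equation
  can be solved for \<open>t\<close> on the whole product chart, not only on the stratum.\<close>

lemma incidence_cell_chart:
  assumes ne: "i - P \<noteq> j - P'"
  defines "t \<equiv> if j - P' < i - P then Inl (i - (j - P')) else Inr (j - (i - P))"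
  shows "\<exists>g x. cell_chart (subtopology (prod_topology Y Y') (incidence i j lam lam'))
    ((W \<times> W') \<inter> incidence i j lam lam') ((S \<times> S') \<inter> incidence i j lam lam') (M - {t}) ((J <+> J') - {t}) g x"
proof -
  let ?r = "min (i - P) (j - P')"
  have le: "P \<le> i" "P' \<le> j" using line_chartD(2)[OF c] line_chartD(2)[OF c'] .
  have Ksub: "{P<..i} \<subseteq> K" "{P'<..j} \<subseteq> K'" using line_chartD(3)[OF c] line_chartD(3)[OF c'] .
  have r: "?r \<le> min i j" by auto
  have t: "t \<in> M" "t = Inl (i - ?r) \<and> j - P' < i - P \<or> t = Inr (j - ?r) \<and> i - P < j - P'"
  proof -
    have "i - (j - P') \<in> {P<..i}" if "j - P' < i - P" using that le by auto
    moreover have "j - (i - P) \<in> {P'<..j}" if "i - P < j - P'" using that le by auto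
    ultimately show "t \<in> M" using Ksub ne by (auto simp only: t_def split: if_splits)
    show "t = Inl (i - ?r) \<and> j - P' < i - P \<or> t = Inr (j - ?r) \<and> i - P < j - P'"
      using ne by (auto simp: t_def min_def)
  qed
  have upd: "v(t := y) \<in> coord_space M" if "v \<in> coord_space M" for v y
    using that t(1) by (auto simp: coord_space_def)
  have "cell_chart (subtopology (prod_topology Y Y') (incidence i j lam lam'))
    ((W \<times> W') \<inter> incidence i j lam lam') ((S \<times> S') \<inter> incidence i j lam lam') (M - {t}) ((J <+> J') - {t})
    (\<lambda>u. G (u(t := others ?r u))) (\<lambda>p. ((\<lambda>(l, l'). case_sum (x l) (x' l')) p)(t := 0))"
  proof (rule cell_chart_graph)
    show "cell_chart (prod_topology Y Y') (W \<times> W') (S \<times> S') M (J <+> J') G (\<lambda>(l, l'). case_sum (x l) (x' l'))"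
      by (rule cell_chart_prod[OF line_chartD(1)[OF c] line_chartD(1)[OF c']])
    show "t \<in> M" by (rule t)
    show "continuous_on (coord_space M) (others ?r)" by (rule continuous_others)
  next
    fix v y assume v: "v \<in> coord_space M"
    let ?u = "v(t := y)"
    have "term ?u k = term v k" if k: "k \<in> {0..min i j} - {?r}" for k
      using t(2)
    proof
      assume a: "t = Inl (i - ?r) \<and> j - P' < i - P"
      then have "rgt ?u = rgt v" by auto
      moreover have "z (lft ?u) (i - k) = z (lft v) (i - k)"
        by (rule line_chart_indep[OF c lft_rgt(1)[OF upd[OF v]] lft_rgt(1)[OF v], of "i - ?r"])
           (use a k le in \<open>auto simp: min_def split: if_splits\<close>)
      ultimately show ?thesis by simp
    next
      assume a: "t = Inr (j - ?r) \<and> i - P < j - P'"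
      then have "lft ?u = lft v" by auto
      moreover have "z' (rgt ?u) (j - k) = z' (rgt v) (j - k)"
        by (rule line_chart_indep[OF c' lft_rgt(2)[OF upd[OF v]] lft_rgt(2)[OF v], of "j - ?r"])
           (use a k le in \<open>auto simp: min_def split: if_splits\<close>)
      ultimately show ?thesis by simp
    qed
    then show "others ?r ?u = others ?r v" by simp
  next
    fix v assume v: "v \<in> coord_space M"
    have "term v ?r = v t"
      using t(2)
    proof
      assume a: "t = Inl (i - ?r) \<and> j - P' < i - P"
      then have "i - ?r > P" "j - ?r = P'" using le by auto
      then show ?thesis
        using a line_chartD(6)[OF c' lft_rgt(2)[OF v]] line_chartD(7)[OF c lft_rgt(1)[OF v]] by simp
    next
      assume a: "t = Inr (j - ?r) \<and> i - P < j - P'"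
      then have "j - ?r > P'" "i - ?r = P" using le by auto
      then show ?thesis
        using a line_chartD(6)[OF c lft_rgt(1)[OF v]] line_chartD(7)[OF c' lft_rgt(2)[OF v]] by simp
    qed
    then show "G v \<in> incidence i j lam lam' \<longleftrightarrow> v t = others ?r v"
      using G_incidence_split[OF v r] by simp
  next
    fix v assume tJ: "t \<in> J <+> J'" and v: "v \<in> coord_space M"
      and zero: "\<And>m. m \<in> (J <+> J') - {t} \<Longrightarrow> v m = 0"
    \<comment> \<open>An unknown in the first factor lies above its pivot and by \<open>J\<close> is
      not a condition. So the unknown is in the second factor, the range of possibly nonzero terms
      on the stratum is empty, and the equation holds there automatically.\<close>
    have a: "t = Inr (j - ?r) \<and> i - P < j - P'"
      using t(2)
    proof
      assume a: "t = Inl (i - ?r) \<and> j - P' < i - P"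
      then have "i - ?r \<in> J" using tJ by auto
      moreover have "i - ?r \<in> {P<..i}" using a le by auto
      ultimately show ?thesis using J by blast
    qed
    then have Jv: "\<And>m. m \<in> J \<Longrightarrow> v (Inl m) = 0" using zero by auto
    have tz: "term v k = 0" if k: "k \<in> {0..min i j} - {?r}" for k
    proof (cases "k < ?r")
      case True
      then have "j - k \<in> {P'<..j}" "j - k \<noteq> j - ?r" by auto
      then have "v (Inr (j - k)) = 0" using J' a by (intro zero) auto
      then show ?thesis using True by (intro upper_terms_vanish[OF v]) auto
    next
      case False
      then show ?thesis using k a by (intro lower_terms_vanish[OF v Jv]) auto
    qed
    have "(\<Sum>k\<in>{0..min i j} - {?r}. term v k) = 0" by (intro sum.neutral ballI tz)
    then show "others ?r v = 0" by simp
  qed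
  then show ?thesis by blast
qed

text \<open>For \<open>j - P' < i - P\<close> the equation cuts the stratum, whose conditions stay
  the same. Otherwise the stratum lies inside the hypersurface, and one of its conditions is
  absorbed by the equation.\<close>

lemma card_conditions:
  assumes ne: "i - P \<noteq> j - P'"
  defines "t \<equiv> if j - P' < i - P then Inl (i - (j - P')) else Inr (j - (i - P))"
  shows "card ((J <+> J') - {t}) = (if j - P' < i - P then card J + card J' else card J + card J' - 1)"
proof -
  have fin: "finite J" "finite J'"
    using line_chartD(1)[OF c] line_chartD(1)[OF c'] by (auto simp: cell_chart_def finite_subset)
  have le: "P \<le> i" "P' \<le> j" using line_chartD(2)[OF c] line_chartD(2)[OF c'] .
  show ?thesis
  proof (cases "j - P' < i - P")
    case True
    then have "i - (j - P') \<in> {P<..i}" using le by auto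
    then have "i - (j - P') \<notin> J" using J by blast
    then have "(J <+> J') - {t} = J <+> J'" using True by (auto simp: t_def)
    then show ?thesis using True fin by (simp add: card_Plus)
  next
    case False
    then have "j - (i - P) \<in> {P'<..j}" using ne le by auto
    then have "t \<in> J <+> J'" using False J' by (auto simp: t_def)
    then show ?thesis using False fin by (simp add: card_Plus)
  qed
qed

end

theorem betti_incidence:
  fixes I :: "'c set" and I' :: "'d set"
  assumes fin: "finite I" "finite I'"
    and charts: "\<And>c d. c \<in> I \<Longrightarrow> d \<in> I' \<Longrightarrow> incidence_charts Y Y' lam lam' i j
      (W c) (S c) (K c) (J c) (g c) (x c) (z c) (P c) (W' d) (S' d) (K' d) (J' d) (g' d) (x' d) (z' d) (P' d)"
    and cover: "topspace Y = (\<Union>c\<in>I. S c)" "topspace Y' = (\<Union>d\<in>I'. S' d)"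
    and order: "\<And>a b. a \<in> I \<Longrightarrow> b \<in> I \<Longrightarrow> a \<noteq> b \<Longrightarrow> S b \<inter> W a \<noteq> {} \<Longrightarrow> card (J b) < card (J a)"
    and order': "\<And>a b. a \<in> I' \<Longrightarrow> b \<in> I' \<Longrightarrow> a \<noteq> b \<Longrightarrow> S' b \<inter> W' a \<noteq> {} \<Longrightarrow> card (J' b) < card (J' a)"
  shows "betti (2 * k) (subtopology (prod_topology Y Y') (incidence i j lam lam')) =
    enat (card {(c, d). c \<in> I \<and> d \<in> I' \<and> i - P c \<noteq> j - P' d \<and>
      (if j - P' d < i - P c then card (J c) + card (J' d) else card (J c) + card (J' d) - 1) = k})"
proof -
  define T where "T = {(c, d). c \<in> I \<and> d \<in> I' \<and> i - P c \<noteq> j - P' d}"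
  let ?H = "incidence i j lam lam'"
  define t where "t = (\<lambda>(c, d). if j - P' d < i - P c then Inl (i - (j - P' d)) else Inr (j - (i - P c)))"
  let ?WW = "\<lambda>(c, d). (W c \<times> W' d) \<inter> ?H" and ?SS = "\<lambda>(c, d). (S c \<times> S' d) \<inter> ?H"
  let ?KK = "\<lambda>(c, d). (K c <+> K' d) - {t (c, d)}" and ?JJ = "\<lambda>(c, d). (J c <+> J' d) - {t (c, d)}"
  let ?X = "subtopology (prod_topology Y Y') ?H"
  have "\<forall>e\<in>T. \<exists>gx. cell_chart ?X (?WW e) (?SS e) (?KK e) (?JJ e) (fst gx) (snd gx)"
  proof
    fix e assume "e \<in> T"
    then obtain c d where e: "e = (c, d)" "c \<in> I" "d \<in> I'" "i - P c \<noteq> j - P' d"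
      by (auto simp: T_def)
    from incidence_charts.incidence_cell_chart[OF charts[OF e(2,3)] e(4)]
    obtain g0 x0 where "cell_chart ?X (?WW e) (?SS e) (?KK e) (?JJ e) g0 x0"
      unfolding e(1) t_def split by blast
    then show "\<exists>gx. cell_chart ?X (?WW e) (?SS e) (?KK e) (?JJ e) (fst gx) (snd gx)"
      by (intro exI[of _ "(g0, x0)"]) (simp only: fst_conv snd_conv)
  qed
  from bchoice[OF this] obtain gx where
    gx: "\<And>e. e \<in> T \<Longrightarrow> cell_chart ?X (?WW e) (?SS e) (?KK e) (?JJ e) (fst (gx e)) (snd (gx e))"
    by blast
  have "betti (2 * k) ?X = enat (card {e \<in> T. card (?JJ e) = k})"
  \<comment> \<open>The rank is the codimension in the ambient product, before the equation is
    imposed, because this is what the orders on the two factors control.\<close>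
  proof (rule betti_of_cell_charts[where rk = "\<lambda>(c, d). card (J c) + card (J' d)"])
    show "finite T"
      by (rule finite_subset[of _ "I \<times> I'"]) (use fin in \<open>auto simp: T_def\<close>)
    show "cell_chart ?X (?WW e) (?SS e) (?KK e) (?JJ e) (fst (gx e)) (snd (gx e))" if "e \<in> T" for e
      by (rule gx[OF that])
    show "topspace ?X = (\<Union>e\<in>T. ?SS e)"
    proof
      show "topspace ?X \<subseteq> (\<Union>e\<in>T. ?SS e)"
      proof
        fix p assume p: "p \<in> topspace ?X"
        then obtain c d where cd: "c \<in> I" "d \<in> I'" "p \<in> S c \<times> S' d" "p \<in> ?H"
          using cover by auto
        then have "(c, d) \<in> T"
          using incidence_charts.stratum_disjoint[OF charts[OF cd(1,2)]] by (auto simp: T_def)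
        then show "p \<in> (\<Union>e\<in>T. ?SS e)" using cd by blast
      qed
      show "(\<Union>e\<in>T. ?SS e) \<subseteq> topspace ?X"
        using cover by (auto simp: T_def)
    qed
  next
    fix e f assume "e \<in> T" "f \<in> T" "e \<noteq> f" and ne: "?SS f \<inter> ?WW e \<noteq> {}"
    then obtain c d c' d' where e: "e = (c, d)" "f = (c', d')" and cd: "c \<in> I" "d \<in> I'" "c' \<in> I" "d' \<in> I'"
      by (auto simp: T_def)
    have "S c' \<inter> W c \<noteq> {}" "S' d' \<inter> W' d \<noteq> {}" using ne e by auto
    then have "c' = c \<or> card (J c') < card (J c)" "d' = d \<or> card (J' d') < card (J' d)"
      using order[OF cd(1,3)] order'[OF cd(2,4)] by auto
    then show "(case f of (c, d) \<Rightarrow> card (J c) + card (J' d)) < (case e of (c, d) \<Rightarrow> card (J c) + card (J' d))"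
      using \<open>e \<noteq> f\<close> e by auto
  qed
  moreover have cardJ: "card (?JJ (c, d)) = (if j - P' d < i - P c then card (J c) + card (J' d) else card (J c) + card (J' d) - 1)"
    if "(c, d) \<in> T" for c d
    using incidence_charts.card_conditions[OF charts[of c d]] that by (simp add: T_def t_def)
  have "{e \<in> T. card (?JJ e) = k} = {(c, d). c \<in> I \<and> d \<in> I' \<and> i - P c \<noteq> j - P' d \<and>
      (if j - P' d < i - P c then card (J c) + card (J' d) else card (J c) + card (J' d) - 1) = k}"
  proof (rule Set.set_eqI)
    fix e :: "'c \<times> 'd"
    obtain c d where e: "e = (c, d)" by (cases e)
    have "(c, d) \<in> T \<longleftrightarrow> c \<in> I \<and> d \<in> I' \<and> i - P c \<noteq> j - P' d" by (simp add: T_def)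
    then show "e \<in> {e \<in> T. card (?JJ e) = k} \<longleftrightarrow> e \<in> {(c, d). c \<in> I \<and> d \<in> I' \<and> i - P c \<noteq> j - P' d \<and>
      (if j - P' d < i - P c then card (J c) + card (J' d) else card (J c) + card (J' d) - 1) = k}"
      unfolding e mem_Collect_eq case_prod_conv using cardJ[of c d] by (simp only: case_prod_conv) metis
  qed
  ultimately show ?thesis by simp
qed

section \<open>Charts of projective spaces and bounded flag varieties\<close>

definition normalized :: "nat \<Rightarrow> (nat \<Rightarrow> complex) set \<Rightarrow> nat \<Rightarrow> complex" where
  "normalized p l = (SOME v. v \<in> l \<and> v p = 1)"

lemma normalized_cspan:
  assumes "v p \<noteq> 0"
  shows "normalized p (cspan v) = (\<lambda>m. v m / v p)"
proof -
  have uniq: "u = (\<lambda>m. v m / v p)" if u: "u \<in> cspan v \<and> u p = 1" for u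
  proof -
    obtain c where c: "u = (\<lambda>m. c * v m)" using u by (auto simp: cspan_def)
    then have "c = 1 / v p" using u assms by (auto simp: field_simps)
    then show ?thesis using c by auto
  qed
  have "(\<lambda>m. v m / v p) \<in> cspan v \<and> (\<lambda>m. v m / v p) p = 1"
    using assms by (auto simp: cspan_def intro!: exI[of _ "1 / v p"])
  from someI[where P = "\<lambda>u. u \<in> cspan v \<and> u p = 1", OF this] show ?thesis
    unfolding normalized_def by (rule uniq)
qed

lemma cspan_scale:
  assumes "c \<noteq> 0"
  shows "cspan (\<lambda>m. c * v m) = cspan v"
proof
  show "cspan (\<lambda>m. c * v m) \<subseteq> cspan v"
    by (auto simp: cspan_def mult.assoc[symmetric])
  show "cspan v \<subseteq> cspan (\<lambda>m. c * v m)"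
  proof
    fix u assume "u \<in> cspan v"
    then obtain a where "u = (\<lambda>m. a * v m)" by (auto simp: cspan_def)
    then have "u = (\<lambda>m. (a / c) * (c * v m))" using assms by simp
    then show "u \<in> cspan (\<lambda>m. c * v m)" unfolding cspan_def by blast
  qed
qed

lemma line_normalized:
  assumes l: "l \<in> lines n" and u: "u \<in> l" "u p \<noteq> 0"
  shows "l = cspan (normalized p l)" "normalized p l \<in> l" "normalized p l p = 1"
    and "normalized p l \<in> cvec n" "normalized p l = (\<lambda>m. u m / u p)"
proof -
  obtain v where v: "v \<in> nzvec n" "l = cspan v" using l by (auto simp: lines_def)
  obtain c where c: "u = (\<lambda>m. c * v m)" using u(1) v(2) by (auto simp: cspan_def)
  then have nz: "c \<noteq> 0" "v p \<noteq> 0" using u(2) by auto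
  have eq: "normalized p l = (\<lambda>m. v m / v p)" using normalized_cspan[of v p] nz(2) v(2) by simp
  have "cspan (\<lambda>m. inverse (v p) * v m) = cspan v" using nz by (intro cspan_scale) simp
  then show *: "l = cspan (normalized p l)" using v(2) eq by (simp add: field_simps)
  show "normalized p l \<in> l" using cspan_self[of "normalized p l"] unfolding *[symmetric] .
  show "normalized p l p = 1" using eq nz by simp
  show "normalized p l \<in> cvec n" using eq v(1) by (simp add: nzvec_def cvec_def)
  show "normalized p l = (\<lambda>m. u m / u p)" using eq c nz by auto
qed

abbreviation affine_part :: "nat \<Rightarrow> nat \<Rightarrow> (nat \<Rightarrow> complex) set set" where
  "affine_part n p \<equiv> {l \<in> lines n. \<exists>u\<in>l. u p \<noteq> 0}"

lemma cspan_mem_affine_part: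
  "v \<in> nzvec n \<Longrightarrow> cspan v \<in> affine_part n p \<longleftrightarrow> v p \<noteq> 0"
  using cspan_self[of v] by (auto simp: lines_def cspan_def)

lemma openin_affine_part: "openin (projective_space n) (affine_part n p)"
proof -
  have "{v \<in> nzvec n. cspan v \<in> affine_part n p} = nzvec n \<inter> {v. v p \<noteq> 0}"
    using cspan_mem_affine_part by blast
  moreover have "open {v :: nat \<Rightarrow> complex. v p \<noteq> 0}"
    by (intro open_Collect_neq continuous_on_coordinate continuous_on_const)
  ultimately show ?thesis by (auto simp: openin_projective_space openin_open_Int)
qed

text \<open>Continuity is checked on homogeneous coordinates: over the open affine part
  \<open>cspan\<close> is still a quotient map, and there the function is a quotient of two
  coordinates.\<close>

lemma continuous_map_normalized:
  "continuous_map (subtopology (projective_space n) (affine_part n p)) euclidean (\<lambda>l. normalized p l m)"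
proof (rule continuous_compose_quotient_map)
  let ?U = "nzvec n \<inter> {v. v p \<noteq> 0}"
  have U: "{v \<in> topspace (top_of_set (nzvec n)). cspan v \<in> affine_part n p} = ?U"
    using cspan_mem_affine_part by auto
  show "quotient_map (subtopology (top_of_set (nzvec n)) ?U)
      (subtopology (projective_space n) (affine_part n p)) cspan"
    by (rule quotient_map_restriction[OF quotient_map_projective_space U disjI1[OF openin_affine_part]])
  have "continuous_on ?U (\<lambda>v. v m / v p)"
    by (intro continuous_on_divide continuous_on_coordinate) auto
  then have "continuous_on ?U ((\<lambda>l. normalized p l m) \<circ> cspan)"
    by (rule continuous_on_eq) (simp add: normalized_cspan)
  moreover have "subtopology (top_of_set (nzvec n)) ?U = top_of_set ?U"
    by (simp add: subtopology_subtopology inf_left_idem)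
  ultimately show "continuous_map (subtopology (top_of_set (nzvec n)) ?U) euclidean ((\<lambda>l. normalized p l m) \<circ> cspan)"
    by (simp only: continuous_map_iff_continuous)
qed

lemma continuous_map_cspan:
  assumes "continuous_on A z" "z \<in> A \<rightarrow> nzvec n"
  shows "continuous_map (top_of_set A) (projective_space n) (\<lambda>v. cspan (z v))"
proof -
  have "continuous_map (top_of_set A) (top_of_set (nzvec n)) z"
    using assms by auto
  from continuous_map_compose[OF this quotient_imp_continuous_map[OF quotient_map_projective_space]]
  show ?thesis by (simp add: o_def)
qed

text \<open>These strata are the Schubert cells. Their conditions are exactly the entries above the
  pivot \<open>p\<close>, as required of the second factor in
  \<open>incidence_charts\<close>.\<close>

lemma projective_line_chart:
  assumes p: "p \<le> j"
  shows "line_chart (projective_space j) (\<lambda>q. q) j (affine_part j p)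
    {l \<in> affine_part j p. \<forall>u\<in>l. \<forall>m>p. u m = 0} ({..j} - {p}) {p<..j}
    (\<lambda>v. cspan (v(p := 1))) (\<lambda>l. (normalized p l)(p := 0)) (\<lambda>v. v(p := 1)) p"
proof -
  let ?K = "{..j} - {p}" and ?z = "\<lambda>v :: nat \<Rightarrow> complex. v(p := 1)"
  have nz: "?z v \<in> nzvec j" if "v \<in> coord_space ?K" for v
  proof -
    have "?z v \<in> cvec j" using that p by (auto simp: coord_space_def cvec_def)
    moreover have "?z v \<noteq> (\<lambda>_. 0)" by (metis fun_upd_same zero_neq_one)
    ultimately show ?thesis by (simp add: nzvec_def)
  qed
  have "continuous_on A (\<lambda>v. ?z v m)" for A m
    by (cases "m = p") (simp_all add: continuous_on_coordinate)
  then have contz: "continuous_on A ?z" for A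
    by (rule continuous_on_coordinatewise_then_product)
  have aff: "cspan (?z v) \<in> affine_part j p" if "v \<in> coord_space ?K" for v
    using cspan_mem_affine_part[OF nz[OF that], of p] by simp
  have norm_z: "normalized p (cspan (?z v)) = ?z v" for v
    by (subst normalized_cspan) auto
  have hm: "homeomorphic_maps (top_of_set (coord_space ?K)) (subtopology (projective_space j) (affine_part j p))
      (\<lambda>v. cspan (?z v)) (\<lambda>l. (normalized p l)(p := 0))"
    unfolding homeomorphic_maps_def
  proof (intro conjI ballI)
    show "continuous_map (top_of_set (coord_space ?K)) (subtopology (projective_space j) (affine_part j p)) (\<lambda>v. cspan (?z v))"
      unfolding continuous_map_in_subtopology
    proof
      show "continuous_map (top_of_set (coord_space ?K)) (projective_space j) (\<lambda>v. cspan (?z v))"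
        by (rule continuous_map_cspan[OF contz]) (use nz in blast)
    qed (use aff in auto)
    have "continuous_map (subtopology (projective_space j) (affine_part j p)) euclidean (\<lambda>l. ((normalized p l)(p := 0)) m)" for m
      by (cases "m = p") (simp_all add: continuous_map_normalized)
    then have "continuous_map (subtopology (projective_space j) (affine_part j p)) euclidean (\<lambda>l. (normalized p l)(p := 0))"
      by (simp add: continuous_map_componentwise_UNIV flip: euclidean_product_topology)
    moreover have "(normalized p l)(p := 0) \<in> coord_space ?K" if l: "l \<in> affine_part j p" for l
      using l line_normalized(4)[of l j _ p] by (auto simp: coord_space_def cvec_def)
    ultimately show "continuous_map (subtopology (projective_space j) (affine_part j p)) (top_of_set (coord_space ?K)) (\<lambda>l. (normalized p l)(p := 0))"
      by (auto simp: continuous_map_in_subtopology)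
  next
    fix v assume "v \<in> topspace (top_of_set (coord_space ?K))"
    then have "v p = 0" by (simp add: coord_space_def)
    then show "(normalized p (cspan (?z v)))(p := 0) = v" by (auto simp: norm_z)
  next
    fix l assume "l \<in> topspace (subtopology (projective_space j) (affine_part j p))"
    then obtain u where u: "l \<in> lines j" "u \<in> l" "u p \<noteq> 0" by auto
    have "((normalized p l)(p := 0))(p := 1) = normalized p l"
      using line_normalized(3)[OF u] by auto
    then show "cspan (?z ((normalized p l)(p := 0))) = l"
      using line_normalized(1)[OF u] by simp
  qed
  have str: "cspan (?z v) \<in> {l \<in> affine_part j p. \<forall>u\<in>l. \<forall>m>p. u m = 0} \<longleftrightarrow> (\<forall>m\<in>{p<..j}. v m = 0)"
    if v: "v \<in> coord_space ?K" for v
  proof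
    assume "cspan (?z v) \<in> {l \<in> affine_part j p. \<forall>u\<in>l. \<forall>m>p. u m = 0}"
    then have "\<forall>m>p. ?z v m = 0" using cspan_self[of "?z v"] by blast
    then show "\<forall>m\<in>{p<..j}. v m = 0" by auto
  next
    assume "\<forall>m\<in>{p<..j}. v m = 0"
    then have "v m = 0" if "m > p" for m
      using v that by (cases "m \<le> j") (auto simp: coord_space_def)
    then show "cspan (?z v) \<in> {l \<in> affine_part j p. \<forall>u\<in>l. \<forall>m>p. u m = 0}"
      using aff[OF v] by (auto simp: cspan_def)
  qed
  have "cell_chart (projective_space j) (affine_part j p)
    {l \<in> affine_part j p. \<forall>u\<in>l. \<forall>m>p. u m = 0} ?K {p<..j} (\<lambda>v. cspan (?z v)) (\<lambda>l. (normalized p l)(p := 0))"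
    unfolding cell_chart_def using hm str openin_affine_part by auto
  then show ?thesis
    unfolding line_chart_def using p contz by auto
qed

text \<open>In the notation \<open>z\<^sub>k = a\<^sub>k z\<^sub>k\<^sub>-\<^sub>1 + b\<^sub>k e\<^sub>k\<close>, the set \<open>\<sigma>\<close> consists of the \<open>k\<close> with \<open>b\<^sub>k = 1\<close> and
  coordinate \<open>v k = a\<^sub>k\<close>; for the other \<open>k\<close>, \<open>a\<^sub>k = 1\<close> and \<open>v k = b\<^sub>k\<close>.\<close>

primrec flag_lift :: "nat set \<Rightarrow> (nat \<Rightarrow> complex) \<Rightarrow> nat \<Rightarrow> nat \<Rightarrow> complex" where
  "flag_lift \<sigma> v 0 = std_basis 0"
| "flag_lift \<sigma> v (Suc k) = (if Suc k \<in> \<sigma>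
     then (\<lambda>m. v (Suc k) * flag_lift \<sigma> v k m + std_basis (Suc k) m)
     else (\<lambda>m. flag_lift \<sigma> v k m + v (Suc k) * std_basis (Suc k) m))"

text \<open>The largest element of \<open>\<sigma>\<close> in \<open>{1..k}\<close>, or 0 if there
  is none. It is the last step with \<open>b = 1\<close>; later steps have \<open>a = 1\<close> and
  keep this entry of the lift equal to 1.\<close>

primrec pivot :: "nat set \<Rightarrow> nat \<Rightarrow> nat" where
  "pivot \<sigma> 0 = 0"
| "pivot \<sigma> (Suc k) = (if Suc k \<in> \<sigma> then Suc k else pivot \<sigma> k)"

lemma pivot_le: "pivot \<sigma> k \<le> k"
  by (induction k) auto

lemma pivot_mem: "pivot \<sigma> k = 0 \<or> pivot \<sigma> k \<in> \<sigma>"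
  by (induction k) auto

lemma not_mem_above_pivot: "pivot \<sigma> k < m \<Longrightarrow> m \<le> k \<Longrightarrow> m \<notin> \<sigma>"
  by (induction k) (auto simp: le_Suc_eq split: if_splits)

lemma flag_lift_above: "k < m \<Longrightarrow> flag_lift \<sigma> v k m = 0"
  by (induction k) (auto simp: std_basis_def)

lemma flag_lift_pivot: "flag_lift \<sigma> v k (pivot \<sigma> k) = 1"
proof (induction k)
  case (Suc k)
  then show ?case using pivot_le[of \<sigma> k] flag_lift_above[of k "Suc k" \<sigma> v] by (auto simp: std_basis_def)
qed (simp add: std_basis_def)

lemma flag_lift_above_pivot: "pivot \<sigma> k < m \<Longrightarrow> m \<le> k \<Longrightarrow> flag_lift \<sigma> v k m = v m"
proof (induction k)
  case (Suc k)
  then show ?case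
    using flag_lift_above[of k "Suc k" \<sigma> v] by (cases "m = Suc k") (auto simp: std_basis_def split: if_splits)
qed simp

lemma flag_lift_cong: "(\<And>m. m \<le> k \<Longrightarrow> v m = v' m) \<Longrightarrow> flag_lift \<sigma> v k = flag_lift \<sigma> v' k"
  by (induction k) (auto simp: fun_eq_iff)

text \<open>The entries below the pivot are settled once the pivot step is done: each later step
  only adds a multiple of a basis vector with larger index.\<close>

lemma flag_lift_below_pivot_cong:
  "(\<And>m. m \<le> pivot \<sigma> k \<Longrightarrow> v m = v' m) \<Longrightarrow> m < pivot \<sigma> k \<Longrightarrow> flag_lift \<sigma> v k m = flag_lift \<sigma> v' k m"
proof (induction k)
  case (Suc k)
  show ?case
  proof (cases "Suc k \<in> \<sigma>")
    case True
    then show ?thesis using Suc.prems flag_lift_cong[of "Suc k" v v' \<sigma>] by simp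
  next
    case False
    then show ?thesis using Suc pivot_le[of \<sigma> k] by (simp add: std_basis_def)
  qed
qed simp

text \<open>At the pivot step the factor \<open>a\<close> is zero and erases all that was built
  before.\<close>

lemma flag_lift_below_pivot:
  "(\<And>t. t \<in> \<sigma> \<Longrightarrow> v t = 0) \<Longrightarrow> m < pivot \<sigma> k \<Longrightarrow> flag_lift \<sigma> v k m = 0"
proof (induction k)
  case (Suc k)
  then show ?case using pivot_le[of \<sigma> k] by (cases "Suc k \<in> \<sigma>") (auto simp: std_basis_def)
qed simp

lemma flag_lift_nzvec:
  assumes "k \<le> n"
  shows "flag_lift \<sigma> v k \<in> nzvec n"
proof -
  have "flag_lift \<sigma> v k \<noteq> (\<lambda>_. 0)" using flag_lift_pivot[of \<sigma> v k] by force
  then show ?thesis using flag_lift_above[of k] assms by (auto simp: nzvec_def cvec_def)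
qed

lemma continuous_on_flag_lift: "continuous_on A (\<lambda>v. flag_lift \<sigma> v k)"
proof (rule continuous_on_coordinatewise_then_product)
  show "continuous_on A (\<lambda>v. flag_lift \<sigma> v k m)" for m
  proof (induction k)
    case (Suc k)
    then show ?case
      by (cases "Suc k \<in> \<sigma>")
         (auto intro!: continuous_on_add continuous_on_mult continuous_on_coordinate continuous_on_const)
  qed simp
qed

lemma cspan_flag_lift_affine:
  "cspan (flag_lift \<sigma> v k) \<in> affine_part k (pivot \<sigma> k)"
  "normalized (pivot \<sigma> k) (cspan (flag_lift \<sigma> v k)) = flag_lift \<sigma> v k"
  using cspan_mem_affine_part[OF flag_lift_nzvec[of k k], of _ _ "pivot \<sigma> k"]
  by (simp_all add: flag_lift_pivot normalized_cspan)

definition flag_chart :: "nat \<Rightarrow> nat set \<Rightarrow> (nat \<Rightarrow> complex) \<Rightarrow> nat \<Rightarrow> (nat \<Rightarrow> complex) set" where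
  "flag_chart n \<sigma> v = (\<lambda>k\<in>{..n}. cspan (flag_lift \<sigma> v k))"

text \<open>If \<open>k \<in> \<sigma>\<close>, the preceding lift has entry 1 at its own pivot, so
  the factor \<open>a_k\<close> can be read off there; otherwise \<open>b_k\<close> is the entry at
  \<open>k\<close>.\<close>

definition flag_coord :: "nat \<Rightarrow> nat set \<Rightarrow> (nat \<Rightarrow> (nat \<Rightarrow> complex) set) \<Rightarrow> nat \<Rightarrow> complex" where
  "flag_coord n \<sigma> l = (\<lambda>k. if k \<in> {1..n} then
     normalized (pivot \<sigma> k) (l k) (if k \<in> \<sigma> then pivot \<sigma> (k - 1) else k) else 0)"

definition flag_domain :: "nat \<Rightarrow> nat set \<Rightarrow> (nat \<Rightarrow> (nat \<Rightarrow> complex) set) set" where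
  "flag_domain n \<sigma> = {l \<in> bounded_flags n. \<forall>k\<le>n. l k \<in> affine_part k (pivot \<sigma> k)}"

section \<open>Coordinates on bounded flag varieties\<close>

lemma bounded_flags_lines:
  assumes "l \<in> bounded_flags n" "k \<le> n"
  shows "l k \<in> lines k"
  using bounded_flags_subset[of n] assms by (force simp: topspace_projective_space)

lemma bounded_flags_step:
  assumes "l \<in> bounded_flags n" "Suc k \<le> n" "u \<in> l (Suc k)"
  obtains y c where "y \<in> l k" "u = (\<lambda>m. y m + c * std_basis (Suc k) m)"
  using assms unfolding bounded_flags_def by force

lemma bounded_flags_above:
  assumes "l \<in> bounded_flags n" "k \<le> n" "y \<in> l k" "k < m"
  shows "y m = 0"
  using bounded_flags_lines[OF assms(1,2)] assms(3,4) by (auto simp: lines_def nzvec_def cvec_def cspan_def)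

lemma flag_chart_mem: "flag_chart n \<sigma> v \<in> flag_domain n \<sigma>"
proof -
  have "flag_chart n \<sigma> v k \<subseteq> {(\<lambda>m. y m + c * std_basis k m) |y c. y \<in> flag_chart n \<sigma> v (k - 1)}"
    if k: "k \<in> {1..n}" for k
  proof -
    obtain q where q: "k = Suc q" using k by (cases k) auto
    show ?thesis
    proof
      fix u assume "u \<in> flag_chart n \<sigma> v k"
      then obtain a where a: "u = (\<lambda>m. a * flag_lift \<sigma> v (Suc q) m)"
        using k q by (auto simp: flag_chart_def cspan_def)
      define b c where "b = (if Suc q \<in> \<sigma> then a * v (Suc q) else a)"
        and "c = (if Suc q \<in> \<sigma> then a else a * v (Suc q))"
      have "u = (\<lambda>m. (b * flag_lift \<sigma> v q m) + c * std_basis k m)"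
        using a q by (auto simp: b_def c_def algebra_simps)
      moreover have "(\<lambda>m. b * flag_lift \<sigma> v q m) \<in> flag_chart n \<sigma> v (k - 1)"
        using k q by (auto simp: flag_chart_def cspan_def)
      ultimately show "u \<in> {(\<lambda>m. y m + c * std_basis k m) |y c. y \<in> flag_chart n \<sigma> v (k - 1)}"
        by (intro CollectI exI[of _ "\<lambda>m. b * flag_lift \<sigma> v q m"] exI[of _ c] conjI)
    qed
  qed
  moreover have "flag_chart n \<sigma> v \<in> (\<Pi>\<^sub>E k\<in>{..n}. lines n)"
    using flag_lift_nzvec by (auto simp: flag_chart_def lines_def)
  ultimately have "flag_chart n \<sigma> v \<in> bounded_flags n"
    by (simp add: bounded_flags_def) (simp add: flag_chart_def)
  then show ?thesis
    using cspan_flag_lift_affine(1) by (simp add: flag_domain_def) (simp add: flag_chart_def)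
qed

lemma flag_coord_chart:
  assumes "\<sigma> \<subseteq> {1..n}" "v \<in> coord_space {1..n}"
  shows "flag_coord n \<sigma> (flag_chart n \<sigma> v) = v"
proof
  fix k
  show "flag_coord n \<sigma> (flag_chart n \<sigma> v) k = v k"
  proof (cases "k \<in> {1..n}")
    case True
    then obtain q where q: "k = Suc q" by (cases k) auto
    have "flag_coord n \<sigma> (flag_chart n \<sigma> v) k = flag_lift \<sigma> v k (if k \<in> \<sigma> then pivot \<sigma> (k - 1) else k)"
      using True cspan_flag_lift_affine(2)[of \<sigma> k v] by (simp add: flag_coord_def flag_chart_def)
    also have "\<dots> = v k"
      using q pivot_le[of \<sigma> q] flag_lift_pivot[of \<sigma> v q] flag_lift_above[of q k \<sigma> v]
      by (auto simp: std_basis_def)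
    finally show ?thesis .
  next
    case False
    then have "v k = 0" using assms(2) by (simp add: coord_space_def)
    then show ?thesis using False by (auto simp: flag_coord_def)
  qed
qed

lemma flag_chart_coord:
  assumes l: "l \<in> flag_domain n \<sigma>"
  shows "flag_chart n \<sigma> (flag_coord n \<sigma> l) = l"
proof -
  let ?v = "flag_coord n \<sigma> l"
  have bf: "l \<in> bounded_flags n" and aff: "\<And>k. k \<le> n \<Longrightarrow> l k \<in> affine_part k (pivot \<sigma> k)"
    using l by (auto simp: flag_domain_def)
  have nrm: "l k = cspan (normalized (pivot \<sigma> k) (l k))" "normalized (pivot \<sigma> k) (l k) \<in> l k"
    "normalized (pivot \<sigma> k) (l k) (pivot \<sigma> k) = 1" if "k \<le> n" for k
    using aff[OF that] line_normalized(1-3)[of "l k" k] by blast+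
  have "l k = cspan (flag_lift \<sigma> ?v k)" if "k \<le> n" for k
    using that
  proof (induction k)
    case 0
    then show ?case using bf by (simp add: bounded_flags_def)
  next
    case (Suc k)
    then have IH: "l k = cspan (flag_lift \<sigma> ?v k)" by simp
    let ?u = "normalized (pivot \<sigma> (Suc k)) (l (Suc k))"
    obtain y c where y: "y \<in> l k" "?u = (\<lambda>m. y m + c * std_basis (Suc k) m)"
      using bounded_flags_step[OF bf Suc.prems nrm(2)[OF Suc.prems]] .
    obtain a where a: "y = (\<lambda>m. a * flag_lift \<sigma> ?v k m)"
      using y(1) IH by (auto simp: cspan_def)
    have u: "?u m = a * flag_lift \<sigma> ?v k m + c * std_basis (Suc k) m" for m
      using y(2) a by metis
    \<comment> \<open>The two entries at \<open>Suc k\<close> and at the previous pivot recover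
      \<open>c\<close> and \<open>a\<close>. One of them is normalised to 1, and the other is by
      definition the value of \<open>flag_coord\<close>.\<close>
    have uS: "?u (Suc k) = c" using u flag_lift_above[of k "Suc k"] by (simp add: std_basis_def)
    have up: "?u (pivot \<sigma> k) = a"
      using u flag_lift_pivot[of \<sigma> ?v k] pivot_le[of \<sigma> k] by (simp add: std_basis_def)
    have "?u = flag_lift \<sigma> ?v (Suc k)"
    proof (cases "Suc k \<in> \<sigma>")
      case True
      then have "c = 1" using nrm(3)[OF Suc.prems] uS by simp
      moreover have "?v (Suc k) = a" using True up Suc.prems by (simp add: flag_coord_def)
      ultimately show ?thesis using True u by auto
    next
      case False
      then have "a = 1" using nrm(3)[OF Suc.prems] up by simp
      moreover have "?v (Suc k) = c" using False uS Suc.prems by (simp add: flag_coord_def)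
      ultimately show ?thesis using False u by auto
    qed
    then show ?case using nrm(1)[OF Suc.prems] by simp
  qed
  moreover have "l \<in> extensional {..n}" using bf by (auto simp: bounded_flags_def PiE_def)
  ultimately show ?thesis by (intro ext) (auto simp: flag_chart_def extensional_def)
qed

lemma openin_flag_domain: "openin (BF n) (flag_domain n \<sigma>)"
proof -
  have "openin (product_topology projective_space {..n}) (\<Pi>\<^sub>E k\<in>{..n}. affine_part k (pivot \<sigma> k))"
    by (simp add: openin_PiE openin_affine_part)
  moreover have "flag_domain n \<sigma> = (\<Pi>\<^sub>E k\<in>{..n}. affine_part k (pivot \<sigma> k)) \<inter> bounded_flags n"
  proof -
    have "l \<in> (\<Pi>\<^sub>E k\<in>{..n}. affine_part k (pivot \<sigma> k)) \<longleftrightarrow> (\<forall>k\<le>n. l k \<in> affine_part k (pivot \<sigma> k))"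
      if "l \<in> bounded_flags n" for l
    proof -
      have "l \<in> extensional {..n}" using that by (simp add: bounded_flags_def PiE_iff)
      then show ?thesis by (simp add: PiE_iff Ball_def)
    qed
    then show ?thesis unfolding flag_domain_def by blast
  qed
  ultimately show ?thesis unfolding BF_def openin_subtopology by blast
qed

lemma homeomorphic_maps_flag_chart:
  assumes \<sigma>: "\<sigma> \<subseteq> {1..n}"
  shows "homeomorphic_maps (top_of_set (coord_space {1..n})) (subtopology (BF n) (flag_domain n \<sigma>))
    (flag_chart n \<sigma>) (flag_coord n \<sigma>)"
  unfolding homeomorphic_maps_def
proof (intro conjI ballI)
  have "continuous_map (top_of_set (coord_space {1..n})) (projective_space k) (\<lambda>v. flag_chart n \<sigma> v k)"
    if "k \<le> n" for k
    using that continuous_map_cspan[OF continuous_on_flag_lift[of "coord_space {1..n}" \<sigma> k], of k] flag_lift_nzvec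
    by (simp add: flag_chart_def)
  then have "continuous_map (top_of_set (coord_space {1..n})) (product_topology projective_space {..n}) (flag_chart n \<sigma>)"
    by (auto simp: continuous_map_componentwise flag_chart_def)
  then show "continuous_map (top_of_set (coord_space {1..n})) (subtopology (BF n) (flag_domain n \<sigma>)) (flag_chart n \<sigma>)"
    using flag_chart_mem by (auto simp: BF_def continuous_map_in_subtopology flag_domain_def)
next
  let ?D = "subtopology (BF n) (flag_domain n \<sigma>)"
  have proj: "continuous_map ?D (subtopology (projective_space k) (affine_part k (pivot \<sigma> k))) (\<lambda>l. l k)"
    if k: "k \<le> n" for k
    unfolding continuous_map_in_subtopology
  proof
    have "continuous_map (product_topology projective_space {..n}) (projective_space k) (\<lambda>l. l k)"
      using k by (intro continuous_map_product_projection) auto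
    then show "continuous_map ?D (projective_space k) (\<lambda>l. l k)"
      unfolding BF_def by (intro continuous_map_from_subtopology)
    show "(\<lambda>l. l k) \<in> topspace ?D \<rightarrow> affine_part k (pivot \<sigma> k)"
      using k by (auto simp: flag_domain_def)
  qed
  have "continuous_map ?D euclidean (\<lambda>l. flag_coord n \<sigma> l k)" for k
  proof (cases "k \<in> {1..n}")
    case True
    then show ?thesis
      using continuous_map_compose[OF proj continuous_map_normalized, of k]
      by (simp add: flag_coord_def o_def)
  next
    case False
    then have "(\<lambda>l. flag_coord n \<sigma> l k) = (\<lambda>l. 0)" by (auto simp: flag_coord_def)
    then show ?thesis by simp
  qed
  then have "continuous_map ?D euclidean (flag_coord n \<sigma>)"
    by (simp add: continuous_map_componentwise_UNIV flip: euclidean_product_topology)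
  then show "continuous_map ?D (top_of_set (coord_space {1..n})) (flag_coord n \<sigma>)"
    by (auto simp: continuous_map_in_subtopology coord_space_def flag_coord_def)
next
  fix v assume "v \<in> topspace (top_of_set (coord_space {1..n}))"
  then show "flag_coord n \<sigma> (flag_chart n \<sigma> v) = v" using flag_coord_chart[OF \<sigma>] by simp
next
  fix l assume "l \<in> topspace (subtopology (BF n) (flag_domain n \<sigma>))"
  then show "flag_chart n \<sigma> (flag_coord n \<sigma> l) = l" using flag_chart_coord by simp
qed

text \<open>The conditions below say \<open>a\<^sub>k = 0\<close> and \<open>b\<^sub>k \<noteq> 0\<close>, respectively.\<close>

definition flag_stratum :: "nat \<Rightarrow> nat set \<Rightarrow> (nat \<Rightarrow> (nat \<Rightarrow> complex) set) set" where
  "flag_stratum n \<sigma> = {l \<in> bounded_flags n. \<forall>k\<in>{1..n}. k \<in> \<sigma> \<longleftrightarrow> l k = cspan (std_basis k)}"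

definition flag_costratum :: "nat \<Rightarrow> nat set \<Rightarrow> (nat \<Rightarrow> (nat \<Rightarrow> complex) set) set" where
  "flag_costratum n \<sigma> = {l \<in> bounded_flags n. \<forall>k\<in>{1..n}. k \<in> \<sigma> \<longleftrightarrow> (\<exists>u\<in>l k. u k \<noteq> 0)}"

lemma bounded_flags_base:
  assumes "l \<in> bounded_flags n"
  shows "l 0 \<in> affine_part 0 0"
proof -
  have "l 0 = cspan (std_basis 0)" using assms by (simp add: bounded_flags_def)
  then have "std_basis 0 \<in> l 0" "std_basis 0 0 \<noteq> (0 :: complex)"
    using cspan_self by (simp_all add: std_basis_def)
  then show ?thesis using bounded_flags_lines[OF assms, of 0] by blast
qed

text \<open>For \<open>k \<notin> \<sigma>\<close> the line is not spanned by the new basis vector,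
  so it has a nonzero component along the previous line and inherits its nonzero pivot
  entry.\<close>

lemma flag_stratum_subset_domain: "flag_stratum n \<sigma> \<subseteq> flag_domain n \<sigma>"
proof
  fix l assume l: "l \<in> flag_stratum n \<sigma>"
  then have bf: "l \<in> bounded_flags n" and st: "\<And>k. k \<in> {1..n} \<Longrightarrow> k \<in> \<sigma> \<longleftrightarrow> l k = cspan (std_basis k)"
    by (auto simp: flag_stratum_def)
  have "l k \<in> affine_part k (pivot \<sigma> k)" if "k \<le> n" for k
    using that
  proof (induction k)
    case 0
    show ?case using bounded_flags_base[OF bf] by simp
  next
    case (Suc k)
    have L: "l (Suc k) \<in> lines (Suc k)" by (rule bounded_flags_lines[OF bf Suc.prems])
    show ?case
    proof (cases "Suc k \<in> \<sigma>")
      case True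
      then have "l (Suc k) = cspan (std_basis (Suc k))" using st Suc.prems by simp
      moreover have "std_basis (Suc k) (Suc k) \<noteq> (0 :: complex)" by (simp add: std_basis_def)
      ultimately have "\<exists>u\<in>l (Suc k). u (Suc k) \<noteq> 0" using cspan_self by blast
      then show ?thesis using True L by simp
    next
      case False
      obtain w where w: "w \<in> nzvec (Suc k)" "l (Suc k) = cspan w" using L by (auto simp: lines_def)
      then have wl: "w \<in> l (Suc k)" using cspan_self by simp
      obtain y c where y: "y \<in> l k" "w = (\<lambda>m. y m + c * std_basis (Suc k) m)"
        using bounded_flags_step[OF bf Suc.prems wl] .
      obtain u where u: "u \<in> l k" "u (pivot \<sigma> k) \<noteq> 0" using Suc by auto
      obtain v where v: "l k = cspan v" using Suc by (auto simp: lines_def)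
      obtain a b where ab: "u = (\<lambda>m. a * v m)" "y = (\<lambda>m. b * v m)"
        using u(1) y(1) v by (auto simp: cspan_def)
      \<comment> \<open>\<open>b\<close> is the component of \<open>w\<close> along the previous
        line; were it zero, \<open>l (Suc k)\<close> would be the line of the new basis
        vector.\<close>
      have "b \<noteq> 0"
      proof
        assume "b = 0"
        then have w': "w = (\<lambda>m. c * std_basis (Suc k) m)" using y(2) ab(2) by simp
        then have "c \<noteq> 0" using w(1) by (auto simp: nzvec_def)
        then have "l (Suc k) = cspan (std_basis (Suc k))" using w(2) w' cspan_scale by simp
        then show False using st Suc.prems False by simp
      qed
      then have "w (pivot \<sigma> (Suc k)) \<noteq> 0"
        using False u(2) ab y(2) pivot_le[of \<sigma> k] by (simp add: std_basis_def)
      then show ?thesis using L wl by blast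
    qed
  qed
  then show "l \<in> flag_domain n \<sigma>" using bf by (auto simp: flag_domain_def)
qed

text \<open>For \<open>k \<notin> \<sigma>\<close> the component along the new basis vector is zero,
  so the vectors of the line lie in the previous line and the pivot entry persists.\<close>

lemma flag_costratum_subset_domain: "flag_costratum n \<sigma> \<subseteq> flag_domain n \<sigma>"
proof
  fix l assume l: "l \<in> flag_costratum n \<sigma>"
  then have bf: "l \<in> bounded_flags n" and st: "\<And>k. k \<in> {1..n} \<Longrightarrow> k \<in> \<sigma> \<longleftrightarrow> (\<exists>u\<in>l k. u k \<noteq> 0)"
    by (auto simp: flag_costratum_def)
  have "l k \<in> affine_part k (pivot \<sigma> k)" if "k \<le> n" for k
    using that
  proof (induction k)
    case 0
    show ?case using bounded_flags_base[OF bf] by simp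
  next
    case (Suc k)
    have L: "l (Suc k) \<in> lines (Suc k)" by (rule bounded_flags_lines[OF bf Suc.prems])
    show ?case
    proof (cases "Suc k \<in> \<sigma>")
      case True
      then show ?thesis using L st[of "Suc k"] Suc.prems by auto
    next
      case False
      obtain w where w: "w \<in> nzvec (Suc k)" "l (Suc k) = cspan w" using L by (auto simp: lines_def)
      then have wl: "w \<in> l (Suc k)" using cspan_self by simp
      obtain y c where y: "y \<in> l k" "w = (\<lambda>m. y m + c * std_basis (Suc k) m)"
        using bounded_flags_step[OF bf Suc.prems wl] .
      have "w (Suc k) = 0" using False st[of "Suc k"] Suc.prems wl by auto
      moreover have "y (Suc k) = 0" using bounded_flags_above[OF bf _ y(1)] Suc.prems by simp
      ultimately have "w = y" using y(2) by (auto simp: std_basis_def fun_eq_iff)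
      then have "w \<in> l k" using y(1) by simp
      obtain u where u: "u \<in> l k" "u (pivot \<sigma> k) \<noteq> 0" using Suc by auto
      obtain v where v: "l k = cspan v" using Suc by (auto simp: lines_def)
      obtain a b where ab: "u = (\<lambda>m. a * v m)" "w = (\<lambda>m. b * v m)"
        using u(1) \<open>w \<in> l k\<close> v by (auto simp: cspan_def)
      have "b \<noteq> 0" using w(1) ab(2) by (auto simp: nzvec_def)
      then have "w (pivot \<sigma> (Suc k)) \<noteq> 0" using False u(2) ab by simp
      then show ?thesis using L wl by blast
    qed
  qed
  then show "l \<in> flag_domain n \<sigma>" using bf by (auto simp: flag_domain_def)
qed

text \<open>For \<open>k \<notin> \<sigma>\<close> the lift has entry 1 at a pivot below
  \<open>k\<close>, so it never spans the line of the \<open>k\<close>-th basis vector. For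
  \<open>k \<in> \<sigma>\<close> the coefficient of the previous lift is
  \<open>v k\<close>.\<close>

lemma flag_chart_stratum:
  assumes \<sigma>: "\<sigma> \<subseteq> {1..n}"
  shows "flag_chart n \<sigma> v \<in> flag_stratum n \<sigma> \<longleftrightarrow> (\<forall>t\<in>\<sigma>. v t = 0)"
proof -
  have "cspan (flag_lift \<sigma> v k) = cspan (std_basis k) \<longleftrightarrow> k \<in> \<sigma> \<and> v k = 0" if k: "k \<in> {1..n}" for k
  proof -
    obtain q where q: "k = Suc q" using k by (cases k) auto
    have "k \<in> \<sigma> \<and> v k = 0" if eq: "cspan (flag_lift \<sigma> v k) = cspan (std_basis k)"
    proof -
      obtain a where a: "flag_lift \<sigma> v k = (\<lambda>m. a * std_basis k m)"
        using eq cspan_self[of "flag_lift \<sigma> v k"] by (auto simp: cspan_def)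
      have "pivot \<sigma> k = k"
        using flag_lift_pivot[of \<sigma> v k] a by (auto simp: std_basis_def split: if_splits)
      then have "k \<in> \<sigma>" using pivot_mem[of \<sigma> k] q by auto
      moreover have "flag_lift \<sigma> v k (pivot \<sigma> q) = 0"
        using a pivot_le[of \<sigma> q] q by (simp add: std_basis_def)
      ultimately show ?thesis
        using q flag_lift_pivot[of \<sigma> v q] pivot_le[of \<sigma> q] by (simp add: std_basis_def)
    qed
    moreover have "cspan (flag_lift \<sigma> v k) = cspan (std_basis k)" if "k \<in> \<sigma> \<and> v k = 0"
      using that q by simp
    ultimately show ?thesis by blast
  qed
  then have "flag_chart n \<sigma> v \<in> flag_stratum n \<sigma> \<longleftrightarrow> (\<forall>k\<in>{1..n}. k \<in> \<sigma> \<longleftrightarrow> k \<in> \<sigma> \<and> v k = 0)"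
    using flag_chart_mem[of n \<sigma> v] by (simp add: flag_stratum_def flag_domain_def flag_chart_def)
  then show ?thesis using \<sigma> by blast
qed

lemma flag_chart_costratum:
  assumes \<sigma>: "\<sigma> \<subseteq> {1..n}"
  shows "flag_chart n \<sigma> v \<in> flag_costratum n \<sigma> \<longleftrightarrow> (\<forall>t\<in>{1..n} - \<sigma>. v t = 0)"
proof -
  have "(\<exists>u\<in>cspan (flag_lift \<sigma> v k). u k \<noteq> 0) \<longleftrightarrow> k \<in> \<sigma> \<or> v k \<noteq> 0" if k: "k \<in> {1..n}" for k
  proof -
    obtain q where q: "k = Suc q" using k by (cases k) auto
    have "(\<exists>u\<in>cspan (flag_lift \<sigma> v k). u k \<noteq> 0) \<longleftrightarrow> flag_lift \<sigma> v k k \<noteq> 0"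
      using cspan_self[of "flag_lift \<sigma> v k"] by (auto simp: cspan_def)
    then show ?thesis using q flag_lift_above[of q k] by (simp add: std_basis_def)
  qed
  then have "flag_chart n \<sigma> v \<in> flag_costratum n \<sigma> \<longleftrightarrow> (\<forall>k\<in>{1..n}. k \<in> \<sigma> \<longleftrightarrow> k \<in> \<sigma> \<or> v k \<noteq> 0)"
    using flag_chart_mem[of n \<sigma> v] by (simp add: flag_costratum_def flag_domain_def flag_chart_def)
  then show ?thesis by blast
qed

lemma flag_line_chart:
  assumes \<sigma>: "\<sigma> \<subseteq> {1..n}"
    and cell: "cell_chart (BF n) (flag_domain n \<sigma>) S {1..n} J (flag_chart n \<sigma>) (flag_coord n \<sigma>)"
  shows "line_chart (BF n) (\<lambda>l. l n) n (flag_domain n \<sigma>) S {1..n} J (flag_chart n \<sigma>) (flag_coord n \<sigma>)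
    (\<lambda>v. flag_lift \<sigma> v n) (pivot \<sigma> n)"
  unfolding line_chart_def
proof (intro conjI ballI impI allI)
  fix v v' :: "nat \<Rightarrow> complex" and m assume "\<forall>m. m \<notin> {pivot \<sigma> n<..n} \<longrightarrow> v m = v' m" "m < pivot \<sigma> n"
  then show "flag_lift \<sigma> v n m = flag_lift \<sigma> v' n m"
    by (intro flag_lift_below_pivot_cong) auto
qed (use cell pivot_le flag_lift_pivot flag_lift_above_pivot continuous_on_flag_lift in
      \<open>auto simp: flag_chart_def\<close>)

lemma flag_stratum_cell_chart:
  assumes "\<sigma> \<subseteq> {1..n}"
  shows "cell_chart (BF n) (flag_domain n \<sigma>) (flag_stratum n \<sigma>) {1..n} \<sigma> (flag_chart n \<sigma>) (flag_coord n \<sigma>)"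
  using assms openin_flag_domain flag_stratum_subset_domain homeomorphic_maps_flag_chart[OF assms]
    flag_chart_stratum[OF assms]
  by (simp add: cell_chart_def)

lemma flag_costratum_cell_chart:
  assumes "\<sigma> \<subseteq> {1..n}"
  shows "cell_chart (BF n) (flag_domain n \<sigma>) (flag_costratum n \<sigma>) {1..n} ({1..n} - \<sigma>) (flag_chart n \<sigma>) (flag_coord n \<sigma>)"
  using assms openin_flag_domain flag_costratum_subset_domain homeomorphic_maps_flag_chart[OF assms]
    flag_chart_costratum[OF assms]
  by (simp add: cell_chart_def)

lemma topspace_BF: "topspace (BF n) = bounded_flags n"
  using bounded_flags_subset[of n] by (auto simp: BF_def)

lemma BF_strata: "topspace (BF n) = (\<Union>\<sigma>\<in>Pow {1..n}. flag_stratum n \<sigma>)"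
  unfolding topspace_BF
proof (intro equalityI subsetI)
  fix l assume "l \<in> bounded_flags n"
  then have "l \<in> flag_stratum n {k \<in> {1..n}. l k = cspan (std_basis k)}"
    by (simp add: flag_stratum_def)
  then show "l \<in> (\<Union>\<sigma>\<in>Pow {1..n}. flag_stratum n \<sigma>)" by (rule UN_I[rotated]) blast
qed (simp add: flag_stratum_def)

lemma BF_costrata: "topspace (BF n) = (\<Union>\<sigma>\<in>Pow {1..n}. flag_costratum n \<sigma>)"
  unfolding topspace_BF
proof (intro equalityI subsetI)
  fix l assume "l \<in> bounded_flags n"
  then have "l \<in> flag_costratum n {k \<in> {1..n}. \<exists>u\<in>l k. u k \<noteq> 0}"
    by (simp add: flag_costratum_def)
  then show "l \<in> (\<Union>\<sigma>\<in>Pow {1..n}. flag_costratum n \<sigma>)" by (rule UN_I[rotated]) blast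
qed (simp add: flag_costratum_def)

text \<open>A line spanned by the \<open>k\<close>-th basis vector has no other nonzero entry, so
  lying in the domain of \<open>\<sigma>\<close> forces its pivot to be \<open>k\<close>. Hence
  \<open>\<tau> \<subset> \<sigma>\<close>.\<close>

lemma flag_stratum_order:
  assumes "\<sigma> \<subseteq> {1..n}" "\<tau> \<subseteq> {1..n}" "\<sigma> \<noteq> \<tau>" and ne: "flag_stratum n \<tau> \<inter> flag_domain n \<sigma> \<noteq> {}"
  shows "card \<tau> < card \<sigma>"
proof -
  obtain l where l: "l \<in> flag_stratum n \<tau>" "l \<in> flag_domain n \<sigma>" using ne by blast
  have "k \<in> \<sigma>" if k: "k \<in> \<tau>" for k
  proof -
    have kn: "k \<in> {1..n}" using k assms(2) by blast
    then have lk: "l k = cspan (std_basis k)" using l(1) k by (simp add: flag_stratum_def)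
    have "\<exists>u\<in>l k. u (pivot \<sigma> k) \<noteq> 0" using l(2) kn by (auto simp: flag_domain_def)
    then have "pivot \<sigma> k = k" unfolding lk by (auto simp: cspan_def std_basis_def split: if_splits)
    then show ?thesis using pivot_mem[of \<sigma> k] kn by auto
  qed
  then have "\<tau> \<subset> \<sigma>" using assms(3) by blast
  then show ?thesis using assms(1) by (meson finite_atLeastAtMost finite_subset psubset_card_mono)
qed

text \<open>The inclusion is opposite to that for \<open>flag_stratum\<close>: on the domain of
  \<open>\<sigma>\<close> the entry at each \<open>k \<in> \<sigma>\<close> is nonzero, so
  \<open>\<sigma> \<subset> \<tau>\<close>.\<close>

lemma flag_costratum_order:
  assumes "\<sigma> \<subseteq> {1..n}" "\<tau> \<subseteq> {1..n}" "\<sigma> \<noteq> \<tau>" and ne: "flag_costratum n \<tau> \<inter> flag_domain n \<sigma> \<noteq> {}"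
  shows "card ({1..n} - \<tau>) < card ({1..n} - \<sigma>)"
proof -
  obtain l where l: "l \<in> flag_costratum n \<tau>" "l \<in> flag_domain n \<sigma>" using ne by blast
  have "k \<in> \<tau>" if k: "k \<in> \<sigma>" for k
  proof -
    have kn: "k \<in> {1..n}" using k assms(1) by blast
    then obtain q where "k = Suc q" by (cases k) auto
    then have "pivot \<sigma> k = k" using k by simp
    moreover have "\<exists>u\<in>l k. u (pivot \<sigma> k) \<noteq> 0" using l(2) kn by (auto simp: flag_domain_def)
    ultimately show ?thesis using l(1) kn by (simp add: flag_costratum_def)
  qed
  then have "{1..n} - \<tau> \<subset> {1..n} - \<sigma>" using assms by blast
  then show ?thesis by (intro psubset_card_mono) auto
qed

section \<open>Counting strata\<close>

lemma projective_strata: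
  "topspace (projective_space j) = (\<Union>p\<in>{..j}. {l \<in> affine_part j p. \<forall>u\<in>l. \<forall>m>p. u m = 0})"
  unfolding topspace_projective_space
proof (intro equalityI subsetI)
  fix l assume l: "l \<in> lines j"
  then obtain v where v: "v \<in> nzvec j" "l = cspan v" by (auto simp: lines_def)
  define N where "N = {m. v m \<noteq> 0}"
  have N: "N \<subseteq> {..j}" "N \<noteq> {}"
    using v(1) by (auto simp: N_def nzvec_def cvec_def not_less[symmetric])
  have fin: "finite N" by (rule finite_subset[OF N(1)]) simp
  let ?p = "Max N"
  have p: "?p \<in> N" using fin N by simp
  have "v m = 0" if "m > ?p" for m
    using Max_ge[OF fin, of m] that by (force simp: N_def)
  then have "\<forall>u\<in>l. \<forall>m>?p. u m = 0" using v(2) by (auto simp: cspan_def)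
  moreover have "l \<in> affine_part j ?p"
    using cspan_mem_affine_part[OF v(1), of ?p] p v(2) by (simp add: N_def)
  ultimately show "l \<in> (\<Union>p\<in>{..j}. {l \<in> affine_part j p. \<forall>u\<in>l. \<forall>m>p. u m = 0})"
    using p N(1) by blast
qed auto

lemma projective_order:
  assumes "a \<in> {..j}" "b \<in> {..j}" "a \<noteq> b"
    and "{l \<in> affine_part j b. \<forall>u\<in>l. \<forall>m>b. u m = 0} \<inter> affine_part j a \<noteq> {}"
  shows "card {b<..j} < card {a<..j}"
proof -
  obtain l where "l \<in> {l \<in> affine_part j b. \<forall>u\<in>l. \<forall>m>b. u m = 0} \<inter> affine_part j a"
    using assms(4) unfolding ex_in_conv[symmetric] ..
  then have "\<forall>u\<in>l. \<forall>m>b. u m = 0" "\<exists>u\<in>l. u a \<noteq> 0" by simp_all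
  then have "\<not> b < a" by blast
  then show ?thesis using assms(1-3) by auto
qed

text \<open>\<open>s\<close> and \<open>r\<close> are the distances of the two pivots from the top, \<open>a\<close> and \<open>b\<close> the codimensions of
  the two strata; equal distances mean that the product stratum misses the hypersurface.\<close>

definition incidence_weight :: "nat \<Rightarrow> nat \<Rightarrow> nat \<Rightarrow> nat \<Rightarrow> nat poly" where
  "incidence_weight s a r b = (if r < s then monom 1 (a + b) else if s < r then monom 1 (a + b - 1) else 0)"

lemma card_eq_coeff_incidence_weight:
  assumes "finite I" "finite I'"
  shows "card {(c, d). c \<in> I \<and> d \<in> I' \<and> s c \<noteq> r d \<and> (if r d < s c then a c + b d else a c + b d - 1) = k}
    = coeff (\<Sum>c\<in>I. \<Sum>d\<in>I'. incidence_weight (s c) (a c) (r d) (b d)) k"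
proof -
  let ?Q = "\<lambda>e. s (fst e) \<noteq> r (snd e) \<and>
    (if r (snd e) < s (fst e) then a (fst e) + b (snd e) else a (fst e) + b (snd e) - 1) = k"
  have "coeff (\<Sum>c\<in>I. \<Sum>d\<in>I'. incidence_weight (s c) (a c) (r d) (b d)) k
      = (\<Sum>e\<in>I \<times> I'. coeff (incidence_weight (s (fst e)) (a (fst e)) (r (snd e)) (b (snd e))) k)"
    by (simp add: sum.cartesian_product case_prod_unfold coeff_sum)
  also have "\<dots> = (\<Sum>e\<in>I \<times> I'. if ?Q e then 1 else 0)"
    by (rule sum.cong) (auto simp: incidence_weight_def)
  also have "\<dots> = card {e \<in> I \<times> I'. ?Q e}"
    using assms by (simp flip: sum.inter_filter)
  also have "{e \<in> I \<times> I'. ?Q e} = {(c, d). c \<in> I \<and> d \<in> I' \<and> s c \<noteq> r d \<and>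
      (if r d < s c then a c + b d else a c + b d - 1) = k}"
    by (simp add: set_eq_iff conj_assoc)
  finally show ?thesis by simp
qed

lemma sum_Pow_Suc:
  fixes f :: "nat set \<Rightarrow> 'a::comm_monoid_add"
  shows "(\<Sum>\<sigma>\<in>Pow {1..Suc n}. f \<sigma>) = (\<Sum>\<sigma>\<in>Pow {1..n}. f \<sigma> + f (insert (Suc n) \<sigma>))"
proof -
  have "Pow {1..Suc n} = Pow {1..n} \<union> insert (Suc n) ` Pow {1..n}"
    by (simp add: atLeastAtMostSuc_conv Pow_insert)
  moreover have "inj_on (insert (Suc n)) (Pow {1..n})"
  proof (rule inj_onI)
    fix x y assume "x \<in> Pow {1..n}" "y \<in> Pow {1..n}" and eq: "insert (Suc n) x = insert (Suc n) y"
    then have "Suc n \<notin> x" "Suc n \<notin> y" by auto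
    then show "x = y" using eq by (metis insert_ident)
  qed
  moreover have "Pow {1..n} \<inter> insert (Suc n) ` Pow {1..n} = {}" by auto
  ultimately show ?thesis
    by (simp add: sum.union_disjoint sum.reindex sum.distrib)
qed

lemma subset_not_mem_Suc: "\<sigma> \<subseteq> {1..n} \<Longrightarrow> Suc n \<notin> \<sigma>"
  by auto

lemma depth_Suc:
  assumes "\<sigma> \<subseteq> {1..n}"
  shows "Suc n - pivot \<sigma> (Suc n) = Suc (n - pivot \<sigma> n)"
    and "Suc n - pivot (insert (Suc n) \<sigma>) (Suc n) = 0"
    and "card (insert (Suc n) \<sigma>) = Suc (card \<sigma>)"
    and "card ({1..Suc n} - \<sigma>) = Suc (card ({1..n} - \<sigma>))"
    and "card ({1..Suc n} - insert (Suc n) \<sigma>) = card ({1..n} - \<sigma>)"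
proof -
  have fin: "finite \<sigma>" using assms finite_subset by blast
  have ni: "Suc n \<notin> \<sigma>" by (rule subset_not_mem_Suc[OF assms])
  show "Suc n - pivot \<sigma> (Suc n) = Suc (n - pivot \<sigma> n)"
    using ni pivot_le[of \<sigma> n] by simp
  show "Suc n - pivot (insert (Suc n) \<sigma>) (Suc n) = 0" by simp
  show "card (insert (Suc n) \<sigma>) = Suc (card \<sigma>)" using fin ni by simp
  have "{1..Suc n} - \<sigma> = insert (Suc n) ({1..n} - \<sigma>)" using ni by auto
  then show "card ({1..Suc n} - \<sigma>) = Suc (card ({1..n} - \<sigma>))" by simp
  have "{1..Suc n} - insert (Suc n) \<sigma> = {1..n} - \<sigma>" by auto
  then show "card ({1..Suc n} - insert (Suc n) \<sigma>) = card ({1..n} - \<sigma>)" by simp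
qed

text \<open>Supplies the hypothesis of \<open>incidence_weight_Suc\<close> for flags: every index
  above the pivot is a condition of the costratum.\<close>

lemma depth_le_card_complement: "n - pivot \<sigma> n \<le> card ({1..n} - \<sigma>)"
proof -
  have "{pivot \<sigma> n<..n} \<subseteq> {1..n} - \<sigma>" using not_mem_above_pivot[of \<sigma> n] by auto
  from card_mono[OF _ this] show ?thesis by simp
qed

text \<open>The indeterminate \<open>L\<close>, which marks complex codimension: the Betti number in
  degree \<open>2 * k\<close> is the coefficient of its \<open>k\<close>-th power.\<close>

definition lefschetz :: "nat poly" where "lefschetz = monom 1 1"

lemma lefschetz_power: "lefschetz ^ m = monom 1 m"
  by (simp add: lefschetz_def monom_power)

lemma incidence_weight_simps:
  "incidence_weight (Suc s) a 0 b = lefschetz ^ (a + b)"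
  "incidence_weight 0 a (Suc r) b = lefschetz ^ (a + b - 1)"
  "incidence_weight 0 a 0 b = 0"
  by (simp_all add: incidence_weight_def lefschetz_power)

text \<open>The bound \<open>r \<le> b\<close> guards the natural-number subtraction: for
  \<open>s < r\<close> it gives \<open>b \<ge> 1\<close>, so \<open>a + b - 1\<close> is not
  truncated.\<close>

lemma incidence_weight_Suc:
  assumes "r \<le> b"
  shows "incidence_weight (Suc s) a (Suc r) (Suc b) = lefschetz * incidence_weight s a r b"
proof (cases "s < r")
  case True
  then have "a + b = Suc (a + b - 1)" using assms by simp
  then show ?thesis using True by (simp add: incidence_weight_def lefschetz_def mult_monom)
qed (simp add: incidence_weight_def lefschetz_def mult_monom)

lemma sum_lefschetz_card: "(\<Sum>\<sigma>\<in>Pow {1..n}. lefschetz ^ card \<sigma>) = (1 + lefschetz) ^ n"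
proof (induction n)
  case (Suc n)
  have "(\<Sum>\<sigma>\<in>Pow {1..Suc n}. lefschetz ^ card \<sigma>) = (\<Sum>\<sigma>\<in>Pow {1..n}. (1 + lefschetz) * lefschetz ^ card \<sigma>)"
    unfolding sum_Pow_Suc by (rule sum.cong) (auto simp: depth_Suc(3) algebra_simps)
  then show ?case using Suc by (simp flip: sum_distrib_left)
qed simp

lemma sum_lefschetz_card_complement:
  "(\<Sum>\<sigma>\<in>Pow {1..n}. lefschetz ^ card ({1..n} - \<sigma>)) = (1 + lefschetz) ^ n"
proof (induction n)
  case (Suc n)
  have "(\<Sum>\<sigma>\<in>Pow {1..Suc n}. lefschetz ^ card ({1..Suc n} - \<sigma>))
      = (\<Sum>\<sigma>\<in>Pow {1..n}. (1 + lefschetz) * lefschetz ^ card ({1..n} - \<sigma>))"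
    unfolding sum_Pow_Suc by (rule sum.cong) (auto simp: depth_Suc(4,5) algebra_simps simp del: One_nat_def)
  then show ?case using Suc by (simp flip: sum_distrib_left)
qed simp

section \<open>Recursions and closed forms for the Poincare polynomials\<close>

definition flag_flag_poly :: "nat \<Rightarrow> nat \<Rightarrow> nat poly" where
  "flag_flag_poly i j = (\<Sum>\<sigma>\<in>Pow {1..i}. \<Sum>\<tau>\<in>Pow {1..j}.
     incidence_weight (i - pivot \<sigma> i) (card \<sigma>) (j - pivot \<tau> j) (card ({1..j} - \<tau>)))"

definition flag_projective_poly :: "nat \<Rightarrow> nat \<Rightarrow> nat poly" where
  "flag_projective_poly i j = (\<Sum>\<sigma>\<in>Pow {1..i}. \<Sum>p\<in>{..j}.
     incidence_weight (i - pivot \<sigma> i) (card \<sigma>) (j - p) (card {p<..j}))"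

lemma flag_flag_poly_0_0: "flag_flag_poly 0 0 = 0"
  by (simp add: flag_flag_poly_def incidence_weight_simps)

lemma flag_flag_poly_Suc_0: "flag_flag_poly (Suc i) 0 = (1 + lefschetz) ^ i"
proof -
  have "flag_flag_poly (Suc i) 0 = (\<Sum>\<sigma>\<in>Pow {1..i}. lefschetz ^ card \<sigma>)"
    unfolding flag_flag_poly_def sum_Pow_Suc
    by (rule sum.cong) (auto simp: depth_Suc incidence_weight_simps simp del: pivot.simps(2) One_nat_def)
  then show ?thesis by (simp only: sum_lefschetz_card)
qed

lemma flag_flag_poly_0_Suc: "flag_flag_poly 0 (Suc j) = (1 + lefschetz) ^ j"
proof -
  have "flag_flag_poly 0 (Suc j) = (\<Sum>\<tau>\<in>Pow {1..Suc j}.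
     incidence_weight 0 0 (Suc j - pivot \<tau> (Suc j)) (card ({1..Suc j} - \<tau>)))"
    by (simp add: flag_flag_poly_def del: pivot.simps(2) One_nat_def)
  also have "\<dots> = (\<Sum>\<sigma>\<in>Pow {1..j}. lefschetz ^ card ({1..j} - \<sigma>))"
    unfolding sum_Pow_Suc
    by (rule sum.cong) (auto simp: depth_Suc incidence_weight_simps simp del: pivot.simps(2) One_nat_def)
  finally show ?thesis by (simp only: sum_lefschetz_card_complement)
qed

text \<open>Split by membership of the top index. If it lies in neither set, both pivot distances
  and the second codimension grow by one, which gives \<open>L\<close> times the old weight. If it
  lies only in the second or only in the first, one distance is 0 and the weights, with the
  codimensions \<open>a\<close>, \<open>b\<close> of the smaller strata, are \<open>L^(a+b)\<close>
  and \<open>L^(a+b+1)\<close>. If it lies in both, the distances agree and the pair is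
  lost.\<close>

lemma flag_flag_poly_Suc_Suc:
  "flag_flag_poly (Suc i) (Suc j) = (1 + lefschetz) ^ (i + j + 1) + lefschetz * flag_flag_poly i j"
proof -
  have "flag_flag_poly (Suc i) (Suc j) = (\<Sum>\<sigma>\<in>Pow {1..i}. \<Sum>\<tau>\<in>Pow {1..j}.
      (1 + lefschetz) * (lefschetz ^ card \<sigma> * lefschetz ^ card ({1..j} - \<tau>))
      + lefschetz * incidence_weight (i - pivot \<sigma> i) (card \<sigma>) (j - pivot \<tau> j) (card ({1..j} - \<tau>)))"
    unfolding flag_flag_poly_def sum_Pow_Suc sum.distrib[symmetric]
    by (intro sum.cong refl)
       (auto simp: depth_Suc incidence_weight_simps incidence_weight_Suc[OF depth_le_card_complement]
          power_add algebra_simps simp del: pivot.simps(2) One_nat_def)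
  also have "\<dots> = (1 + lefschetz) * (\<Sum>\<sigma>\<in>Pow {1..i}. \<Sum>\<tau>\<in>Pow {1..j}.
      lefschetz ^ card \<sigma> * lefschetz ^ card ({1..j} - \<tau>)) + lefschetz * flag_flag_poly i j"
    by (simp only: flag_flag_poly_def sum.distrib sum_distrib_left)
  also have "(\<Sum>\<sigma>\<in>Pow {1..i}. \<Sum>\<tau>\<in>Pow {1..j}. lefschetz ^ card \<sigma> * lefschetz ^ card ({1..j} - \<tau>))
      = (\<Sum>\<sigma>\<in>Pow {1..i}. lefschetz ^ card \<sigma>) * (\<Sum>\<tau>\<in>Pow {1..j}. lefschetz ^ card ({1..j} - \<tau>))"
    by (simp only: sum_product)
  finally show ?thesis
    unfolding sum_lefschetz_card sum_lefschetz_card_complement by (simp add: power_add mult.assoc)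
qed

text \<open>The recursion stops when one index reaches 0. For \<open>i = j\<close> it stops at
  \<open>flag_flag_poly 0 0 = 0\<close>, hence the missing last term.\<close>

lemma flag_flag_poly_eq:
  "flag_flag_poly i j = (\<Sum>m<min i j. lefschetz ^ m * (1 + lefschetz) ^ (i + j - 1 - 2 * m))
     + (if i = j then 0 else lefschetz ^ min i j * (1 + lefschetz) ^ (i + j - 1 - 2 * min i j))"
proof (induction i arbitrary: j)
  case 0
  then show ?case by (cases j) (simp_all add: flag_flag_poly_0_0 flag_flag_poly_0_Suc)
next
  case (Suc i)
  show ?case
  proof (cases j)
    case 0
    then show ?thesis by (simp add: flag_flag_poly_Suc_0)
  next
    case (Suc l)
    have sh: "Suc i + Suc l - 1 - 2 * Suc m = i + l - 1 - 2 * m" for m by simp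
    have "(\<Sum>m<min (Suc i) (Suc l). lefschetz ^ m * (1 + lefschetz) ^ (Suc i + Suc l - 1 - 2 * m))
       = (1 + lefschetz) ^ (i + l + 1)
         + lefschetz * (\<Sum>m<min i l. lefschetz ^ m * (1 + lefschetz) ^ (i + l - 1 - 2 * m))"
      unfolding min_Suc_Suc sum.lessThan_Suc_shift sh sum_distrib_left by (simp add: mult.assoc)
    then show ?thesis
      unfolding Suc flag_flag_poly_Suc_Suc Suc.IH min_Suc_Suc
      by (simp add: algebra_simps)
  qed
qed

text \<open>Indexing by \<open>e = j - p\<close> makes the pivot distance and the codimension of a
  cell in projective space the same number.\<close>

lemma flag_projective_poly_depth:
  "flag_projective_poly i j = (\<Sum>\<sigma>\<in>Pow {1..i}. \<Sum>e\<le>j. incidence_weight (i - pivot \<sigma> i) (card \<sigma>) e e)"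
  unfolding flag_projective_poly_def
  by (intro sum.cong refl sum.reindex_bij_witness[where i = "\<lambda>e. j - e" and j = "\<lambda>p. j - p"]) auto

lemma flag_projective_poly_Suc_0: "flag_projective_poly (Suc i) 0 = (1 + lefschetz) ^ i"
proof -
  have "flag_projective_poly (Suc i) 0 = (\<Sum>\<sigma>\<in>Pow {1..i}. lefschetz ^ card \<sigma>)"
    unfolding flag_projective_poly_depth sum_Pow_Suc
    by (rule sum.cong) (auto simp: depth_Suc incidence_weight_simps simp del: pivot.simps(2) One_nat_def)
  then show ?thesis by (simp only: sum_lefschetz_card)
qed

text \<open>With the top index outside the flag pattern, \<open>e = 0\<close> contributes
  \<open>L^a\<close> and positive \<open>e\<close> gives the shifted old weights. With it inside,
  the distance is 0, so \<open>e = 0\<close> is lost and \<open>e + 1\<close> contributes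
  \<open>L^(a+1+e)\<close>.\<close>

lemma flag_projective_poly_Suc_Suc:
  "flag_projective_poly (Suc i) (Suc j) = (1 + lefschetz) ^ i * (1 + lefschetz * (\<Sum>e\<le>j. lefschetz ^ e))
     + lefschetz * flag_projective_poly i j"
proof -
  define C where "C = 1 + lefschetz * (\<Sum>e\<le>j. lefschetz ^ e)"
  have "flag_projective_poly (Suc i) (Suc j) = (\<Sum>\<sigma>\<in>Pow {1..i}. lefschetz ^ card \<sigma> * C
      + lefschetz * (\<Sum>e\<le>j. incidence_weight (i - pivot \<sigma> i) (card \<sigma>) e e))"
    unfolding flag_projective_poly_depth sum_Pow_Suc sum.atMost_Suc_shift C_def
    by (intro sum.cong refl)
       (auto simp: depth_Suc incidence_weight_simps incidence_weight_Suc sum_distrib_left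
          power_add algebra_simps simp del: pivot.simps(2) One_nat_def)
  also have "\<dots> = (\<Sum>\<sigma>\<in>Pow {1..i}. lefschetz ^ card \<sigma>) * C + lefschetz * flag_projective_poly i j"
    by (simp only: flag_projective_poly_depth sum.distrib sum_distrib_left sum_distrib_right)
  finally show ?thesis by (simp only: sum_lefschetz_card C_def)
qed

lemma flag_projective_poly_eq:
  "j < i \<Longrightarrow> flag_projective_poly i j =
     (\<Sum>m<j. lefschetz ^ m * (1 + lefschetz) ^ i) + lefschetz ^ j * (1 + lefschetz) ^ (i - j - 1)"
proof (induction j arbitrary: i)
  case 0
  then show ?case by (cases i) (simp_all add: flag_projective_poly_Suc_0)
next
  case (Suc j)
  then obtain h where h: "i = Suc h" "j < h" by (cases i) auto
  let ?q = "1 + lefschetz" and ?s = "\<Sum>m<Suc j. lefschetz ^ m"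
  have s: "?s = 1 + lefschetz * (\<Sum>m<j. lefschetz ^ m)"
    unfolding sum.lessThan_Suc_shift by (simp add: sum_distrib_left)
  have "flag_projective_poly i (Suc j) = ?q ^ h * (1 + lefschetz * ?s)
      + lefschetz * ((\<Sum>m<j. lefschetz ^ m) * ?q ^ h + lefschetz ^ j * ?q ^ (h - j - 1))"
    unfolding h(1) flag_projective_poly_Suc_Suc Suc.IH[OF h(2)]
    by (simp add: sum_distrib_right lessThan_Suc_atMost)
  \<comment> \<open>By \<open>s\<close>, the leading 1 and the shifted partial sum combine to a
    second \<open>?s\<close>, which produces the missing factor \<open>1 + L\<close>.\<close>
  also have "\<dots> = ?q ^ h * (lefschetz * ?s + ?s) + lefschetz ^ Suc j * ?q ^ (h - j - 1)"
    unfolding s by (simp add: algebra_simps)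
  also have "?q ^ h * (lefschetz * ?s + ?s) = (\<Sum>m<Suc j. lefschetz ^ m * ?q ^ i)"
    unfolding sum_distrib_right[symmetric] h(1) by (simp add: algebra_simps)
  finally show ?case using h by simp
qed

lemma coeff_lefschetz_binom:
  "coeff (lefschetz ^ m * (1 + lefschetz) ^ n) k = binom (int n) (int k - int m)"
proof -
  have lin: "1 + lefschetz = [:1, 1:]"
    by (simp add: lefschetz_def monom_altdef one_pCons)
  have "coeff ((1 + lefschetz) ^ n) l = n choose l" for l
  proof (cases "l \<le> n")
    case True
    then show ?thesis using lin by (simp add: coeff_linear_poly_power del: One_nat_def)
  next
    case False
    have "degree ((1 + lefschetz) ^ n) \<le> degree (1 + lefschetz) * n" by (rule degree_power_le)
    then have "degree ((1 + lefschetz) ^ n) < l" using False lin by simp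
    then show ?thesis using False by (simp add: coeff_eq_0)
  qed
  then show ?thesis
    by (auto simp: lefschetz_power coeff_monom_mult binom_def nat_diff_distrib)
qed

section \<open>Betti numbers of the two families of hypersurfaces\<close>

lemma incidence_charts_flag:
  assumes \<sigma>: "\<sigma> \<subseteq> {1..i}" and "line_chart Y' lam' j W' S' K' J' g' x' z' P'" "{P'<..j} \<subseteq> J'"
  shows "incidence_charts (BF i) Y' (\<lambda>l. l i) lam' i j (flag_domain i \<sigma>) (flag_stratum i \<sigma>) {1..i} \<sigma>
    (flag_chart i \<sigma>) (flag_coord i \<sigma>) (\<lambda>v. flag_lift \<sigma> v i) (pivot \<sigma> i) W' S' K' J' g' x' z' P'"
proof
  show "line_chart (BF i) (\<lambda>l. l i) i (flag_domain i \<sigma>) (flag_stratum i \<sigma>) {1..i} \<sigma>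
      (flag_chart i \<sigma>) (flag_coord i \<sigma>) (\<lambda>v. flag_lift \<sigma> v i) (pivot \<sigma> i)"
    by (rule flag_line_chart[OF \<sigma> flag_stratum_cell_chart[OF \<sigma>]])
  show "\<sigma> \<inter> {pivot \<sigma> i<..i} = {}" using not_mem_above_pivot by fastforce
qed (use assms flag_lift_below_pivot in auto)

lemma betti_RR: "betti (2 * k) (RR i j) = enat (coeff (flag_flag_poly i j) k)"
proof -
  have RR: "RR i j = subtopology (prod_topology (BF i) (BF j)) (incidence i j (\<lambda>l. l i) (\<lambda>l. l j))"
    by (simp add: RR_def incidence_def)
  have "betti (2 * k) (RR i j) = enat (card {(\<sigma>, \<tau>). \<sigma> \<in> Pow {1..i} \<and> \<tau> \<in> Pow {1..j} \<and>
      i - pivot \<sigma> i \<noteq> j - pivot \<tau> j \<and> (if j - pivot \<tau> j < i - pivot \<sigma> i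
        then card \<sigma> + card ({1..j} - \<tau>) else card \<sigma> + card ({1..j} - \<tau>) - 1) = k})"
    unfolding RR
  proof (rule betti_incidence)
    fix \<sigma> \<tau> :: "nat set" assume \<sigma>: "\<sigma> \<in> Pow {1..i}" and \<tau>: "\<tau> \<in> Pow {1..j}"
    show "incidence_charts (BF i) (BF j) (\<lambda>l. l i) (\<lambda>l. l j) i j (flag_domain i \<sigma>) (flag_stratum i \<sigma>) {1..i} \<sigma>
       (flag_chart i \<sigma>) (flag_coord i \<sigma>) (\<lambda>v. flag_lift \<sigma> v i) (pivot \<sigma> i)
       (flag_domain j \<tau>) (flag_costratum j \<tau>) {1..j} ({1..j} - \<tau>)
       (flag_chart j \<tau>) (flag_coord j \<tau>) (\<lambda>v. flag_lift \<tau> v j) (pivot \<tau> j)"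
    proof (rule incidence_charts_flag)
      show "line_chart (BF j) (\<lambda>l. l j) j (flag_domain j \<tau>) (flag_costratum j \<tau>) {1..j} ({1..j} - \<tau>)
       (flag_chart j \<tau>) (flag_coord j \<tau>) (\<lambda>v. flag_lift \<tau> v j) (pivot \<tau> j)"
        using \<tau> by (intro flag_line_chart flag_costratum_cell_chart) auto
      show "{pivot \<tau> j<..j} \<subseteq> {1..j} - \<tau>" using not_mem_above_pivot[of \<tau> j] by auto
    qed (use \<sigma> in auto)
  qed (use flag_stratum_order flag_costratum_order BF_strata BF_costrata in auto)
  then show ?thesis by (simp only: card_eq_coeff_incidence_weight finite_Pow_iff finite_atLeastAtMost flag_flag_poly_def)
qed

lemma betti_BR: "betti (2 * k) (BR i j) = enat (coeff (flag_projective_poly i j) k)"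
proof -
  have BR: "BR i j = subtopology (prod_topology (BF i) (projective_space j)) (incidence i j (\<lambda>l. l i) (\<lambda>q. q))"
    by (simp add: BR_def incidence_def)
  have "betti (2 * k) (BR i j) = enat (card {(\<sigma>, p). \<sigma> \<in> Pow {1..i} \<and> p \<in> {..j} \<and>
      i - pivot \<sigma> i \<noteq> j - p \<and> (if j - p < i - pivot \<sigma> i
        then card \<sigma> + card {p<..j} else card \<sigma> + card {p<..j} - 1) = k})"
    unfolding BR
  proof (rule betti_incidence)
    fix \<sigma> and p assume \<sigma>: "\<sigma> \<in> Pow {1..i}" and p: "p \<in> {..j}"
    show "incidence_charts (BF i) (projective_space j) (\<lambda>l. l i) (\<lambda>q. q) i j
       (flag_domain i \<sigma>) (flag_stratum i \<sigma>) {1..i} \<sigma>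
       (flag_chart i \<sigma>) (flag_coord i \<sigma>) (\<lambda>v. flag_lift \<sigma> v i) (pivot \<sigma> i)
       (affine_part j p) {l \<in> affine_part j p. \<forall>u\<in>l. \<forall>m>p. u m = 0} ({..j} - {p}) {p<..j}
       (\<lambda>v. cspan (v(p := 1))) (\<lambda>l. (normalized p l)(p := 0)) (\<lambda>v. v(p := 1)) p"
      using \<sigma> p by (intro incidence_charts_flag projective_line_chart) auto
  next
    show "topspace (projective_space j) = (\<Union>p\<in>{..j}. {l \<in> affine_part j p. \<forall>u\<in>l. \<forall>m>p. u m = 0})"
      by (rule projective_strata)
  next
    fix a b assume "a \<in> {..j}" "b \<in> {..j}" "a \<noteq> b"
      "{l \<in> affine_part j b. \<forall>u\<in>l. \<forall>m>b. u m = 0} \<inter> affine_part j a \<noteq> {}"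
    then show "card {b<..j} < card {a<..j}" by (rule projective_order)
  qed (use flag_stratum_order BF_strata in auto)
  then show ?thesis by (simp only: card_eq_coeff_incidence_weight finite_Pow_iff finite_atLeastAtMost finite_atMost flag_projective_poly_def)
qed

theorem corollaryB14:
  fixes i j k :: nat
  shows
    "(i > j \<and> j > 0 \<longrightarrow>
        betti (2 * k) (BR i j) =
          enat ((\<Sum>m<j. binom (int i) (int k - int m)) + binom (int i - int j - 1) (int k - int j))) \<and>
     (i > 0 \<and> j > 0 \<and> i \<noteq> j \<longrightarrow>
        betti (2 * k) (RR i j) =
          enat (\<Sum>m = 0..min i j. binom (int i + int j - 1 - 2 * int m) (int k - int m))) \<and>
     (i > 1 \<longrightarrow>
        betti (2 * k) (RR i i) =
          enat (\<Sum>m<i. binom (2 * int i - 1 - 2 * int m) (int k - int m)))"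
proof (intro conjI impI)
  assume "i > j \<and> j > 0"
  then have j: "j < i" by simp
  then have "int (i - j - 1) = int i - int j - 1" by simp
  then have "coeff (flag_projective_poly i j) k
      = (\<Sum>m<j. binom (int i) (int k - int m)) + binom (int i - int j - 1) (int k - int j)"
    by (simp only: flag_projective_poly_eq[OF j] coeff_add coeff_sum coeff_lefschetz_binom)
  then show "betti (2 * k) (BR i j) =
      enat ((\<Sum>m<j. binom (int i) (int k - int m)) + binom (int i - int j - 1) (int k - int j))"
    by (simp only: betti_BR)
next
  assume ij: "i > 0 \<and> j > 0 \<and> i \<noteq> j"
  \<comment> \<open>Since \<open>i \<noteq> j\<close>, the exponent is at least
    \<open>|i - j| - 1 \<ge> 0\<close> even at \<open>m = min i j\<close>, so natural and integer
    subtraction agree.\<close>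
  have exp: "int (i + j - 1 - 2 * m) = int i + int j - 1 - 2 * int m" if "m \<le> min i j" for m
    using ij that by auto
  have "coeff (flag_flag_poly i j) k
      = (\<Sum>m\<le>min i j. coeff (lefschetz ^ m * (1 + lefschetz) ^ (i + j - 1 - 2 * m)) k)"
    unfolding flag_flag_poly_eq using ij
    by (simp add: coeff_sum lessThan_Suc_atMost[symmetric] del: coeff_add) (simp add: coeff_sum)
  also have "\<dots> = (\<Sum>m = 0..min i j. binom (int i + int j - 1 - 2 * int m) (int k - int m))"
    unfolding coeff_lefschetz_binom atMost_atLeast0 by (intro sum.cong refl, subst exp) auto
  finally show "betti (2 * k) (RR i j) =
      enat (\<Sum>m = 0..min i j. binom (int i + int j - 1 - 2 * int m) (int k - int m))"
    by (simp only: betti_RR)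
next
  assume "i > 1"
  have exp: "int (i + i - 1 - 2 * m) = 2 * int i - 1 - 2 * int m" if "m < i" for m
    using that by auto
  have "coeff (flag_flag_poly i i) k
      = (\<Sum>m<i. coeff (lefschetz ^ m * (1 + lefschetz) ^ (i + i - 1 - 2 * m)) k)"
    by (simp add: flag_flag_poly_eq coeff_sum)
  also have "\<dots> = (\<Sum>m<i. binom (2 * int i - 1 - 2 * int m) (int k - int m))"
    unfolding coeff_lefschetz_binom by (intro sum.cong refl, subst exp) auto
  finally show "betti (2 * k) (RR i i) = enat (\<Sum>m<i. binom (2 * int i - 1 - 2 * int m) (int k - int m))"
    by (simp only: betti_RR)
qed

end
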